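(* Let $K\subset\mathbb{C}$ be a non-thin compact set, let $D$ be the connected component of $\widehat{\mathbb{C}}\setminus K$ containing $\infty$, let $g$ be the Green's function for $D$ with pole at $\infty$, and let $\omega$ be the equilibrium measure of $K$. Let $l>0$, let $W_1,\ldots,W_n$ be the bounded connected components of $\mathbb{C}\setminus g^{-1}(l)$, and let $K_j:=K\cap W_j$. For $j=1,\ldots,n$ let $\phi_j:W_j\to\mathbb{C}$ be a univalent map such that $\widehat{K}_j:=\phi_j(K_j)$ is a non-thin compact set whose Green's function $g_j$ satisfies $g_j=\frac{1}{\omega(K_j)}\,g\circ\phi_j^{-1}$ on $\phi_j(W_j)$. Let $\widehat{\omega}_j$ denote the equilibrium measure of $\widehat{K}_j$. Then $$\widehat{\omega}_j=\frac{1}{\omega(K_j)}\,(\phi_j)_*\bigl(\omega|_{K_j}\bigr).$$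
   Context: Univalent means holomorphic and injective. A compact set $K\subset\mathbb{C}$ is non-thin if it is nonempty and is non-thin (in the sense of potential theory) at each of its boundary points; such a set is non-polar. (When $\widehat{\mathbb{C}}\setminus K$ is connected, $K$ is non-thin if and only if every boundary point of $D=\widehat{\mathbb{C}}\setminus K$ is regular for the Dirichlet problem.) For a Borel probability measure $\mu$ with compact support, $p_\mu(z)=\int\log|z-w|\,d\mu(w)$ and $I(\mu)=\int p_\mu\,d\mu$. The equilibrium measure $\omega=\omega_K$ of a non-polar compact $K$ is the unique Borel probability measure supported in $K$ maximizing $I$. The Green's function of $K$ (equivalently, for $D$, the component of $\widehat{\mathbb{C}}\setminus K$ containing $\infty$) is $g:\widehat{\mathbb{C}}\to[0,\infty]$, $g(\infty)=\infty$, $g=p_\omega-I(\omega)$ on $\mathbb{C}$; it is the unique function subharmonic on $\mathbb{C}$, harmonic on $D\setminus\{\infty\}$, with $g(z)=\log|z|+O(1)$ as $z\to\infty$, bounded outside each neighbourhood of $\infty$, equal to $0$ on $\widehat{\mathbb{C}}\setminus\overline{D}$, and with $g(z)\to0$ as $z\to\zeta$ for all $\zeta\in\partial D$ outside a Borel polar set. $(\phi_j)_*$ denotes push-forward of measures. *)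

theory Defs
  imports "HOL-Probability.Probability"
begin

(* Extended-valued Lebesgue integral: positive part minus negative part. Below it is only applied
   to functions bounded above on a set of full measure in a finite measure space, so the positive
   part is finite; with ereal's convention \<infinity> - \<infinity> = \<infinity> it would be meaningless otherwise. *)
definition ereal_integral :: "'a measure \<Rightarrow> ('a \<Rightarrow> ereal) \<Rightarrow> ereal" where
  "ereal_integral M f =
     enn2ereal (\<integral>\<^sup>+ x. e2ennreal (f x) \<partial>M) - enn2ereal (\<integral>\<^sup>+ x. e2ennreal (- f x) \<partial>M)"

(* The case split is needed because ln 0 = 0 in HOL. *)
definition log_dist :: "complex \<Rightarrow> complex \<Rightarrow> ereal" where
  "log_dist z w = (if z = w then - \<infinity> else ereal (ln (dist z w)))"

definition log_potential :: "complex measure \<Rightarrow> complex \<Rightarrow> ereal" where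
  "log_potential \<mu> z = ereal_integral \<mu> (\<lambda>w. log_dist z w)"

definition log_energy :: "complex measure \<Rightarrow> ereal" where
  "log_energy \<mu> = ereal_integral \<mu> (log_potential \<mu>)"

definition borel_prob_on :: "complex set \<Rightarrow> complex measure \<Rightarrow> bool" where
  "borel_prob_on K \<mu> \<longleftrightarrow> prob_space \<mu> \<and> sets \<mu> = sets borel \<and> emeasure \<mu> (- K) = 0"

(* For non-polar compact K there is exactly one such measure. *)
definition equilibrium_measure :: "complex set \<Rightarrow> complex measure \<Rightarrow> bool" where
  "equilibrium_measure K \<omega> \<longleftrightarrow>
     borel_prob_on K \<omega> \<and> (\<forall>\<mu>. borel_prob_on K \<mu> \<longrightarrow> log_energy \<mu> \<le> log_energy \<omega>)"

(* Functions on the Riemann sphere are functions on complex option, None being the point at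
   infinity. This is also the Green's function, with pole at infinity, of the component of the
   complement of K in the sphere that contains infinity. *)
definition greens_function :: "complex set \<Rightarrow> (complex option \<Rightarrow> ereal) \<Rightarrow> bool" where
  "greens_function K g \<longleftrightarrow>
     g None = \<infinity> \<and>
     (\<exists>\<omega>. equilibrium_measure K \<omega> \<and> (\<forall>z. g (Some z) = log_potential \<omega> z - log_energy \<omega>))"

(* Upper semicontinuous, values < \<infinity>, local submean inequality. The function constantly -\<infinity> is
   allowed, which makes no difference to thinness. *)
definition subharmonic_on :: "complex set \<Rightarrow> (complex \<Rightarrow> ereal) \<Rightarrow> bool" where
  "subharmonic_on U u \<longleftrightarrow>
     open U \<and>
     (\<forall>z\<in>U. u z < \<infinity>) \<and>
     (\<forall>c. open {z \<in> U. u z < c}) \<and>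
     (\<forall>z\<in>U. \<exists>\<rho>>0. ball z \<rho> \<subseteq> U \<and>
        (\<forall>r. 0 < r \<and> r < \<rho> \<longrightarrow>
           u z \<le> ereal (1 / (2 * pi)) *
             ereal_integral (restrict_space lborel {0..2 * pi}) (\<lambda>t. u (z + rcis r t))))"

(* The filter "at \<zeta> within S" omits \<zeta> itself. *)
definition non_thin_at :: "complex set \<Rightarrow> complex \<Rightarrow> bool" where
  "non_thin_at S \<zeta> \<longleftrightarrow>
     \<zeta> islimpt S \<and>
     (\<forall>U u. \<zeta> \<in> U \<and> subharmonic_on U u \<longrightarrow> Limsup (at \<zeta> within S) u = u \<zeta>)"

definition non_thin_compact :: "complex set \<Rightarrow> bool" where
  "non_thin_compact K \<longleftrightarrow> compact K \<and> K \<noteq> {} \<and> (\<forall>\<zeta>\<in>frontier K. non_thin_at K \<zeta>)"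

definition univalent_on :: "(complex \<Rightarrow> complex) \<Rightarrow> complex set \<Rightarrow> bool" where
  "univalent_on f W \<longleftrightarrow> f holomorphic_on W \<and> inj_on f W"

end

theory Submission
  imports Defs "HOL-Complex_Analysis.Complex_Analysis"
begin

text \<open>
  Write \<open>\<psi>\<close> for the inverse of \<open>\<phi> j\<close>. On the image of \<open>W j\<close> the potential of the equilibrium
  measure \<open>\<omega>h j\<close> is a constant plus a multiple of \<open>p \<circ> \<psi>\<close>, where \<open>p\<close> is the potential of \<open>\<omega>\<close>. By
  Jensen's formula a potential minus its mean over circles of radius \<open>r\<close> is, up to sign, the
  convolution of the measure with \<open>log\<^sup>+ (r / \<bar>x\<bar>)\<close>; since \<open>\<psi> z - w = (z - \<phi> j w) * F z\<close> with \<open>F\<close>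
  zero-free, the same computation for \<open>p \<circ> \<psi>\<close> yields the push-forward of \<open>\<omega>\<close>. Hence both sides of the
  claim have the same smoothings for all small \<open>r\<close>, and letting \<open>r\<close> tend to \<open>0\<close> shows that they agree.

  Two facts of potential theory enter. The equilibrium measure is unique, because \<open>- log\<close> is an
  integral of Gaussians up to a constant and hence positive definite on differences of probability
  measures. And \<open>g \<le> 0\<close> on \<open>K\<close>, which makes the level set \<open>{g \<noteq> l}\<close> open: the part of \<open>K\<close> where \<open>g\<close>
  is bounded below by a positive constant carries no measure of finite energy, so near a point where
  \<open>g > 0\<close> a small multiple of a potential that is very negative on that part can be added to \<open>g\<close>,
  contradicting non-thinness.
\<close>

section \<open>Logarithmic potentials via a nonnegative kernel\<close>

text \<open>Potentials take the value -infinity, and the comparison has to hold at such points too,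
  so nothing can be subtracted freely. All logarithms are therefore measured from a constant
  \<open>R\<close> that bounds the distances in play: \<open>ln R - log\<close> is nonnegative,
  identities become sums in \<open>ennreal\<close>, and a term is cancelled only once it is known to
  be finite. Circle means are finite even around points of infinite potential, which is why the
  argument compares means at each centre and small radius. Uniqueness enters because
  \<open>greens_function\<close> merely asserts that some equilibrium measure represents
  \<open>g\<close>, whereas \<open>\<omega>\<close> and \<open>\<omega>h j\<close> are given
  separately. Openness of the complement of the level set makes each \<open>W j\<close> open, which
  gives \<open>\<phi> j\<close> a holomorphic inverse on its image. The hard part of
  \<open>g \<le> 0\<close> on \<open>K\<close> is to turn the absence of measures of finite energy
  into measures with large potential; this is a compactness argument on point configurations,
  carried from the plane to the real line by a space-filling curve.\<close>

lemma ereal_integral_eq_bound_minus: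
  assumes fin: "finite_measure M" and f[measurable]: "f \<in> borel_measurable M"
    and le: "AE x in M. f x \<le> ereal c"
  shows "ereal_integral M f =
    ereal (c * measure M (space M)) - enn2ereal (\<integral>\<^sup>+ x. e2ennreal (ereal c - f x) \<partial>M)"
proof -
  interpret finite_measure M by fact
  define P where "P = (\<integral>\<^sup>+ x. e2ennreal (f x) \<partial>M)"
  define N where "N = (\<integral>\<^sup>+ x. e2ennreal (- f x) \<partial>M)"
  define X where "X = (\<integral>\<^sup>+ x. e2ennreal (ereal c - f x) \<partial>M)"
  define m where "m = measure M (space M)"
  have m0: "m \<ge> 0" by (simp add: m_def)
  have const: "(\<integral>\<^sup>+ x. ennreal a \<partial>M) = ennreal (a * m)" if "a \<ge> 0" for a
    using that by (simp add: emeasure_eq_measure ennreal_mult m_def)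
  show ?thesis
  \<comment> \<open>Only nonnegative constants exist in \<open>ennreal\<close>, so
    \<open>f = c - (c - f)\<close> is rearranged as f^+ + (c - f) = c + f^- for
    \<open>c \<ge> 0\<close>, and as f^- = (c - f) + (- c) otherwise.\<close>
  proof (cases "c \<ge> 0")
    case True
    have "AE x in M. e2ennreal (f x) + e2ennreal (ereal c - f x) = ennreal c + e2ennreal (- f x)"
      using le
    proof eventually_elim
      case (elim x)
      show ?case
      proof (cases "f x")
        case (real r)
        then have "r \<le> c" using elim by simp
        then show ?thesis using True real
          by (cases "r \<ge> 0") (auto simp: ennreal_neg
              simp flip: ennreal_plus)
      qed (use elim in \<open>auto simp: e2ennreal_infty\<close>)
    qed
    then have "P + X = (\<integral>\<^sup>+ x. ennreal c + e2ennreal (- f x) \<partial>M)"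
      unfolding P_def X_def by (subst nn_integral_add[symmetric]) (auto intro!: nn_integral_cong_AE)
    also have "\<dots> = ennreal (c * m) + N"
      using True by (subst nn_integral_add) (auto simp: const[OF True, simplified] N_def)
    finally have PX: "P + X = ennreal (c * m) + N" .
    have "P \<le> (\<integral>\<^sup>+ x. ennreal c \<partial>M)"
      unfolding P_def using le by (intro nn_integral_mono_AE) (auto elim!: eventually_mono dest: e2ennreal_mono)
    also have "\<dots> = ennreal (c * m)" using True by (rule const)
    finally have "P < \<top>" by (simp add: le_less_trans)
    then obtain p where p: "P = ennreal p" "p \<ge> 0" by (cases P) auto
    have cm: "0 \<le> c * m" using True m0 by simp
    show ?thesis
      unfolding ereal_integral_def P_def[symmetric] N_def[symmetric] X_def[symmetric] m_def[symmetric]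
    proof (cases N)
      case (real n)
      then have "X < \<top>" using PX p cm by (cases X) (auto simp flip: ennreal_plus)
      then obtain x where x: "X = ennreal x" "x \<ge> 0" by (cases X) auto
      have "p + x = c * m + n" using PX p x real cm
        by (simp flip: ennreal_plus)
      then show "enn2ereal P - enn2ereal N = ereal (c * m) - enn2ereal X"
        using p x real by (simp add: enn2ereal_ennreal)
    next
      case top
      then have "X = \<top>" using PX p by auto
      then show "enn2ereal P - enn2ereal N = ereal (c * m) - enn2ereal X"
        using p top by (simp add: enn2ereal_ennreal)
    qed
  next
    case False
    have "AE x in M. e2ennreal (f x) = 0"
      using le by eventually_elim (metis False e2ennreal_neg ereal_less_eq(5) nle_le order_trans)
    then have P0: "P = 0" unfolding P_def by (subst nn_integral_cong_AE[where v="\<lambda>_. 0"]) auto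
    have "AE x in M. e2ennreal (- f x) = e2ennreal (ereal c - f x) + ennreal (- c)"
      using le
    proof eventually_elim
      case (elim x)
      show ?case
      proof (cases "f x")
        case (real r)
        then have "r \<le> c" using elim by simp
        then show ?thesis using False real
          by (auto simp: simp flip: ennreal_plus)
      qed (use elim in \<open>auto simp: e2ennreal_infty\<close>)
    qed
    then have "N = (\<integral>\<^sup>+ x. e2ennreal (ereal c - f x) + ennreal (- c) \<partial>M)"
      unfolding N_def by (rule nn_integral_cong_AE)
    also have "\<dots> = X + ennreal (- c * m)"
      using False const[of "- c"] by (subst nn_integral_add) (auto simp: X_def)
    finally have NX: "N = X + ennreal (- c * m)" .
    have cm: "0 \<le> - c * m" using False m0 by (simp add: mult_nonpos_nonneg)
    show ?thesis
      unfolding ereal_integral_def P_def[symmetric] N_def[symmetric] X_def[symmetric] m_def[symmetric]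
      by (cases X) (use NX cm P0 in \<open>auto simp: enn2ereal_ennreal zero_ennreal.rep_eq simp flip: ennreal_plus\<close>)
  qed
qed

text \<open>This is \<open>log\<^sup>+ (R / d)\<close>, since \<^term>\<open>ennreal\<close> maps negative numbers to \<open>0\<close>.\<close>

definition log_kernel :: "real \<Rightarrow> real \<Rightarrow> ennreal" where
  "log_kernel R d = (if d = 0 then \<top> else ennreal (ln (R / d)))"

lemma log_kernel_measurable[measurable]: "log_kernel R \<in> borel_measurable borel"
  unfolding log_kernel_def[abs_def] by measurable

text \<open>For a measure within distance \<open>R\<close> of \<open>z\<close> this is
  \<open>ln R\<close> times the total mass, minus the logarithmic potential at \<open>z\<close>. The
  sign is reversed: where the potential is -infinity, \<open>pot\<close> is \<top>, and equilibrium
  measures minimise \<open>energy\<close>.\<close>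

definition pot :: "real \<Rightarrow> complex measure \<Rightarrow> complex \<Rightarrow> ennreal" where
  "pot R \<alpha> z = (\<integral>\<^sup>+ w. log_kernel R (dist z w) \<partial>\<alpha>)"

definition energy :: "real \<Rightarrow> complex measure \<Rightarrow> complex measure \<Rightarrow> ennreal" where
  "energy R \<mu> \<nu> = (\<integral>\<^sup>+ z. pot R \<mu> z \<partial>\<nu>)"

lemma pot_measurable[measurable]:
  assumes "finite_measure \<alpha>" and [measurable_cong]: "sets \<alpha> = sets borel"
  shows "pot R \<alpha> \<in> borel_measurable borel"
proof -
  interpret finite_measure \<alpha> by fact
  show ?thesis unfolding pot_def[abs_def] by measurable
qed

lemma log_dist_measurable[measurable]: "log_dist z \<in> borel_measurable borel"
  unfolding log_dist_def[abs_def] by measurable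

lemma e2ennreal_ln_minus_log_dist:
  assumes "R > 0"
  shows "e2ennreal (ereal (ln R) - log_dist z w) = log_kernel R (dist z w)"
  using assms by (auto simp: log_dist_def log_kernel_def e2ennreal_infty ln_div)

lemma log_potential_eq:
  assumes fin: "finite_measure \<alpha>" and s[measurable_cong]: "sets \<alpha> = sets borel" and R: "R > 0"
    and le: "AE w in \<alpha>. dist z w \<le> R"
  shows "log_potential \<alpha> z = ereal (ln R * measure \<alpha> (space \<alpha>)) - enn2ereal (pot R \<alpha> z)"
proof -
  have "AE w in \<alpha>. log_dist z w \<le> ereal (ln R)"
    using le by eventually_elim (use R in \<open>auto simp: log_dist_def\<close>)
  from ereal_integral_eq_bound_minus[OF fin _ this] show ?thesis
    unfolding log_potential_def e2ennreal_ln_minus_log_dist[OF R] pot_def by simp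
qed

lemma e2ennreal_minus_minus:
  "e2ennreal (ereal a - (ereal a - enn2ereal x)) = x"
proof (cases x)
  case (real r)
  then have "ereal a - (ereal a - enn2ereal x) = ereal r"
    by (simp add: enn2ereal_ennreal)
  then show ?thesis
    using real by simp
next
  case top
  then show ?thesis by (simp add: e2ennreal_infty)
qed

lemma borel_prob_onD:
  assumes "borel_prob_on K \<mu>" "closed K"
  shows "prob_space \<mu>" "finite_measure \<mu>" "sets \<mu> = sets borel" "space \<mu> = UNIV" "AE w in \<mu>. w \<in> K"
proof -
  show 1: "prob_space \<mu>" "sets \<mu> = sets borel" using assms by (auto simp: borel_prob_on_def)
  show "finite_measure \<mu>" using 1 prob_space.finite_measure by auto
  show sp: "space \<mu> = UNIV" using 1(2) sets_eq_imp_space_eq by fastforce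
  have "- K \<in> sets \<mu>" using 1(2) assms(2) by auto
  then show "AE w in \<mu>. w \<in> K" using assms(1) sp
    by (intro AE_I[where N="-K"]) (auto simp: borel_prob_on_def)
qed

lemma log_energy_eq:
  assumes "borel_prob_on K \<mu>" "closed K" "R > 0"
    and d: "\<And>z w. z \<in> K \<Longrightarrow> w \<in> K \<Longrightarrow> dist z w \<le> R"
  shows "log_energy \<mu> = ereal (ln R) - enn2ereal (energy R \<mu> \<mu>)"
proof -
  note D = borel_prob_onD[OF assms(1,2)]
  interpret prob_space \<mu> by fact
  note D(3)[measurable_cong]
  have lp: "log_potential \<mu> z = ereal (ln R) - enn2ereal (pot R \<mu> z)" if "z \<in> K" for z
  proof -
    have "AE w in \<mu>. dist z w \<le> R" using D(5) d[OF that] by (auto elim!: eventually_mono)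
    from log_potential_eq[OF D(2,3) assms(3) this] prob_space show ?thesis by simp
  qed
  have [measurable]: "pot R \<mu> \<in> borel_measurable \<mu>"
    using pot_measurable[OF D(2,3)] by measurable
  have "log_energy \<mu> = ereal_integral \<mu> (\<lambda>z. ereal (ln R) - enn2ereal (pot R \<mu> z))"
    unfolding log_energy_def ereal_integral_def
    using D(5) by (intro arg_cong2[where f="(-)"] arg_cong[where f=enn2ereal] nn_integral_cong_AE)
      (auto simp: lp elim!: eventually_mono)
  also have "\<dots> = ereal (ln R * measure \<mu> (space \<mu>)) - enn2ereal (\<integral>\<^sup>+ x. e2ennreal (ereal (ln R) - (ereal (ln R) - enn2ereal (pot R \<mu> x))) \<partial>\<mu>)"
    by (rule ereal_integral_eq_bound_minus) (auto simp: D ereal_minus_le_iff enn2ereal_nonneg ereal_le_add_self)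
  also have "\<dots> = ereal (ln R) - enn2ereal (energy R \<mu> \<mu>)"
    using prob_space by (simp add: e2ennreal_minus_minus energy_def)
  finally show ?thesis .
qed

lemma log_kernel_lsc:
  assumes "d \<longlonglongrightarrow> D" "R > 0" "\<And>n. d n \<ge> 0"
  shows "log_kernel R D \<le> liminf (\<lambda>n. log_kernel R (d n))"
proof (cases "D = 0")
  case False
  have D: "D > 0" using assms(1,3) False LIMSEQ_le_const[OF assms(1), of 0] by force
  have ev: "eventually (\<lambda>n. d n \<noteq> 0) sequentially"
    using tendsto_imp_eventually_ne[OF assms(1) False] .
  have "(\<lambda>n. ennreal (ln (R / d n))) \<longlonglongrightarrow> ennreal (ln (R / D))"
    using assms D by (intro tendsto_ennrealI tendsto_intros) auto
  then have "(\<lambda>n. log_kernel R (d n)) \<longlonglongrightarrow> log_kernel R D"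
    unfolding log_kernel_def using ev False
    by (subst tendsto_cong[where g="\<lambda>n. ennreal (ln (R / d n))"]) (auto elim!: eventually_mono)
  then show ?thesis
    by (simp add: lim_imp_Liminf)
next
  case True
  show ?thesis unfolding le_Liminf_iff
  proof (intro allI impI)
    fix y assume "y < log_kernel R D"
    then obtain m where m: "y = ennreal m" "m \<ge> 0" by (cases y) auto
    have "eventually (\<lambda>n. d n < R * exp (- m - 1)) sequentially"
      using assms(1) True \<open>R > 0\<close> by (intro order_tendstoD) auto
    then show "eventually (\<lambda>n. y < log_kernel R (d n)) sequentially"
    proof eventually_elim
      case (elim n)
      show ?case
      proof (cases "d n = 0")
        case False
        then have d: "d n > 0" using assms(3)[of n] by simp
        have "ln (d n) < ln (R * exp (- m - 1))" using elim d by simp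
        also have "\<dots> = ln R - m - 1" using \<open>R>0\<close> by (simp add: ln_mult)
        finally have "m < ln (R / d n)" using d \<open>R>0\<close> by (simp add: ln_div)
        then show ?thesis using False m by (simp add: log_kernel_def ennreal_lessI)
      qed (simp add: log_kernel_def m)
    qed
  qed
qed

lemma pot_lsc:
  assumes s[measurable_cong]: "sets \<alpha> = sets borel" and "R > 0"
    and z: "z \<longlonglongrightarrow> x"
  shows "pot R \<alpha> x \<le> liminf (\<lambda>n. pot R \<alpha> (z n))"
proof -
  have "pot R \<alpha> x \<le> (\<integral>\<^sup>+ w. liminf (\<lambda>n. log_kernel R (dist (z n) w)) \<partial>\<alpha>)"
    unfolding pot_def
    using z \<open>R>0\<close> by (intro nn_integral_mono log_kernel_lsc tendsto_intros) auto
  also have "\<dots> \<le> liminf (\<lambda>n. pot R \<alpha> (z n))"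
    unfolding pot_def by (rule nn_integral_liminf) measurable
  finally show ?thesis .
qed

lemma closed_pot_le:
  assumes "sets \<alpha> = sets borel" and "R > 0"
  shows "closed {z. pot R \<alpha> z \<le> c}"
  unfolding closed_sequential_limits
proof (intro allI impI)
  fix z x assume *: "(\<forall>n. z n \<in> {z. pot R \<alpha> z \<le> c}) \<and> z \<longlonglongrightarrow> x"
  then have "pot R \<alpha> x \<le> liminf (\<lambda>n. pot R \<alpha> (z n))" using pot_lsc[OF assms] by blast
  also have "\<dots> \<le> liminf (\<lambda>n. c)" using * by (intro Liminf_mono) auto
  finally show "x \<in> {z. pot R \<alpha> z \<le> c}" by (simp add: Liminf_const)
qed

section \<open>Circle means of the logarithmic kernel\<close>

definition circle_mean :: "real \<Rightarrow> (complex \<Rightarrow> ennreal) \<Rightarrow> complex \<Rightarrow> ennreal" where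
  "circle_mean r f u = ennreal (1 / (2 * pi)) * (\<integral>\<^sup>+ t. f (u + rcis r t) * indicator {0..2 * pi} t \<partial>lborel)"

text \<open>A zero-free function on a ball is the exponential of some holomorphic \<open>g\<close>;
  its log-modulus is \<open>Re g\<close>, and Cauchy's formula for \<open>g\<close> at the centre
  gives the mean value property.\<close>

lemma has_integral_ln_norm_circle:
  assumes holo: "F holomorphic_on ball u r'" and nz: "\<And>z. z \<in> ball u r' \<Longrightarrow> F z \<noteq> 0"
    and r: "0 < r" "r < r'"
  shows "((\<lambda>t. ln (norm (F (u + rcis r t)))) has_integral 2 * pi * ln (norm (F u))) {0..2 * pi}"
proof -
  obtain g where g: "g holomorphic_on ball u r'" "\<And>z. z \<in> ball u r' \<Longrightarrow> F z = exp (g z)"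
    using contractible_imp_holomorphic_log[OF holo convex_imp_contractible[OF convex_ball] nz] by blast
  have sub: "cball u r \<subseteq> ball u r'" using r by auto
  have "((\<lambda>w. g w / (w - u)) has_contour_integral (2 * of_real pi * \<i> * g u)) (circlepath u r)"
    using r by (intro Cauchy_integral_circlepath_simple holomorphic_on_subset[OF g(1) sub]) auto
  then have "((\<lambda>t. g (u + r * cis t) / (u + r * cis t - u) * r * \<i> * cis t) has_integral (2 * of_real pi * \<i> * g u)) {0..2*pi}"
    unfolding circlepath_def by (subst (asm) has_contour_integral_part_circlepath_iff) auto
  then have "((\<lambda>t. - \<i> * (g (u + r * cis t) / (u + r * cis t - u) * r * \<i> * cis t)) has_integral (- \<i> * (2 * of_real pi * \<i> * g u))) {0..2*pi}"
    by (rule has_integral_mult_right)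
  then have "((\<lambda>t. g (u + rcis r t)) has_integral (2 * of_real pi * g u)) {0..2*pi}"
  proof (rule has_integral_eq_rhs[OF has_integral_eq, rotated])
    fix t
    have "- \<i> * (g (u + r * cis t) / (r * cis t) * r * \<i> * cis t) = g (u + r * cis t) * (- \<i> * \<i>)"
      using r by (simp add: field_simps)
    then show "- \<i> * (g (u + r * cis t) / (u + r * cis t - u) * r * \<i> * cis t) = g (u + rcis r t)"
      using r by (simp add: rcis_def)
  qed simp
  from has_integral_Re[OF this]
  have "((\<lambda>t. Re (g (u + rcis r t))) has_integral (2 * pi * Re (g u))) {0..2*pi}" by simp
  moreover have "ln (norm (F (u + rcis r t))) = Re (g (u + rcis r t))" for t
    using r by (subst g(2)) (auto simp: dist_norm)
  moreover have "ln (norm (F u)) = Re (g u)"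
    using r by (subst g(2)) auto
  ultimately show ?thesis by simp
qed

lemma has_bochner_integral_interval:
  fixes f :: "real \<Rightarrow> real"
  assumes "(f has_integral I) {a..b}" "continuous_on {a..b} f"
  shows "has_bochner_integral lborel (\<lambda>t. indicator {a..b} t * f t) I"
proof -
  have si: "set_integrable lborel {a..b} f"
    using assms(2) by (rule borel_integrable_atLeastAtMost')
  have "(LINT t:{a..b}|lborel. f t) = I"
    using set_borel_integral_eq_integral(2)[OF si] assms(1) by (simp add: integral_unique)
  with si show ?thesis
    unfolding has_bochner_integral_iff set_integrable_def set_lebesgue_integral_def by simp
qed

text \<open>For |x| > r the function x + z is zero-free on a disc larger than the circle. For |x| <
  r its zero is reflected: on the circle its modulus equals that of r + (cnj x / r) z, which is
  zero-free on a larger disc and has the value r at 0.\<close>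

lemma ln_circle_ne:
  assumes "norm x \<noteq> r" "r > 0"
  shows "has_bochner_integral lborel (\<lambda>t. indicator {0..2*pi} t * ln (norm (x + rcis r t))) (2 * pi * ln (max (norm x) r))"
proof (rule has_bochner_integral_interval)
  have ne: "x + rcis r t \<noteq> 0" for t
  proof
    assume "x + rcis r t = 0"
    then have "x = - rcis r t" by (simp add: eq_neg_iff_add_eq_0)
    then have "norm x = r" using assms by simp
    with assms show False by simp
  qed
  show "continuous_on {0..2*pi} (\<lambda>t. ln (norm (x + rcis r t)))"
    using ne unfolding rcis_def cis_conv_exp by (intro continuous_intros) auto
  show "((\<lambda>t. ln (norm (x + rcis r t))) has_integral 2 * pi * ln (max (norm x) r)) {0..2 * pi}"
  proof (cases "r < norm x")
    case True
    have "((\<lambda>t. ln (norm (x + (0 + rcis r t)))) has_integral 2 * pi * ln (norm (x + 0))) {0..2 * pi}"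
      by (rule has_integral_ln_norm_circle[where r'="norm x"])
        (use True assms in \<open>auto intro!: holomorphic_intros simp: add_eq_0_iff\<close>)
    with True show ?thesis by simp
  next
    case False
    then have xr: "norm x < r" using assms by simp
    \<comment> \<open>The reflected function vanishes only at - r^2 / cnj x, whose modulus is the
      radius taken here; for x = 0 it is constant and any radius beyond r serves.\<close>
    define r' where "r' = (if x = 0 then r + 1 else r * (r / norm x))"
    have r': "r < r'" using xr assms by (auto simp: r'_def field_simps)
    have "((\<lambda>t. ln (norm (of_real r + cnj x / r * (0 + rcis r t)))) has_integral
        2 * pi * ln (norm (of_real r + cnj x / r * (0::complex)))) {0..2 * pi}"
    proof (rule has_integral_ln_norm_circle[where r'=r' and F="\<lambda>z::complex. of_real r + cnj x / r * z"])
      fix z :: complex assume z: "z \<in> ball 0 r'"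
      have "norm (cnj x / r * z) < r"
        using z assms by (auto simp: r'_def norm_mult norm_divide field_simps split: if_splits)
      then show "of_real r + cnj x / r * z \<noteq> 0"
        using assms by (metis add_eq_0_iff less_irrefl norm_minus_cancel norm_of_real abs_of_pos)
    qed (use r' assms in \<open>auto intro!: holomorphic_intros\<close>)
    moreover have "norm (of_real r + cnj x / r * (0 + rcis r t)) = norm (x + rcis r t)" for t
    proof -
      have "norm (x + rcis r t) = norm (cnj (x + rcis r t))" by (simp only: complex_mod_cnj)
      also have "\<dots> = norm (cis t * cnj (x + rcis r t))" by (simp add: norm_mult)
      also have "cis t * cnj (x + rcis r t) = of_real r + cnj x / r * (0 + rcis r t)"
        using assms by (simp add: rcis_def algebra_simps cis_cnj cis_mult)
      finally show ?thesis ..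
    qed
    ultimately show ?thesis using xr assms by (simp add: max_def)
  qed
qed

lemma AE_rcis_ne:
  assumes "r > 0"
  shows "AE t in lborel. rcis r t \<noteq> c"
proof -
  have "countable {t. rcis r t = c}"
  proof (cases "\<exists>s. rcis r s = c")
    case True
    then obtain s where s: "rcis r s = c" by blast
    have "{t. rcis r t = c} \<subseteq> range (\<lambda>n::int. s + 2 * pi * n)"
    proof
      fix t assume "t \<in> {t. rcis r t = c}"
      then have "cis t = cis s" using s assms by (auto simp: rcis_def)
      then have "sin t = sin s \<and> cos t = cos s" by (simp add: complex_eq_iff)
      then show "t \<in> range (\<lambda>n::int. s + 2 * pi * n)"
        unfolding sin_cos_eq_iff by (auto simp: algebra_simps)
    qed
    then show ?thesis by (rule countable_subset) simp
  next
    case False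
    then have "{t. rcis r t = c} = {}" by auto
    then show ?thesis by (metis countable_empty)
  qed
  from countable_imp_null_set_lborel[OF this] show ?thesis
    by (intro AE_I[where N="{t. rcis r t = c}"]) auto
qed

text \<open>The squared norm is a quadratic in the scale s with derivative 2 s |x|^2 + 2 (x
  \<bullet> w), which is nonnegative for s \<ge> 1 by Cauchy-Schwarz, since |x| = |w|.\<close>

lemma norm_scale_add_mono:
  fixes x w :: complex
  assumes "norm x = norm w" "1 \<le> s'" "s' \<le> s"
  shows "norm (of_real s' * x + w) \<le> norm (of_real s * x + w)"
proof -
  have e: "norm (of_real a * x + w)^2 = a^2 * (norm x)^2 + 2 * a * (x \<bullet> w) + (norm x)^2" for a
  proof -
    have "norm (of_real a * x + w)^2 = (a *\<^sub>R x + w) \<bullet> (a *\<^sub>R x + w)"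
      by (simp add: power2_norm_eq_inner scaleR_conv_of_real)
    also have "\<dots> = a^2 * (x \<bullet> x) + 2 * a * (x \<bullet> w) + w \<bullet> w"
      by (simp add: inner_add_left inner_add_right inner_commute power2_eq_square algebra_simps)
    finally show ?thesis using assms(1) by (simp flip: power2_norm_eq_inner)
  qed
  have cs: "- (x \<bullet> w) \<le> (norm x)^2"
    using norm_cauchy_schwarz[of "- x" w] assms(1) by (simp add: power2_eq_square)
  have "(s - s') * ((s + s') * (norm x)^2 + 2 * (x \<bullet> w)) \<ge> 0"
  proof (intro mult_nonneg_nonneg)
    have "2 * (norm x)^2 \<le> (s + s') * (norm x)^2"
      using assms by (intro mult_right_mono) auto
    then show "0 \<le> (s + s') * (norm x)^2 + 2 * (x \<bullet> w)" using cs by linarith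
  qed (use assms in auto)
  then have "norm (of_real s' * x + w)^2 \<le> norm (of_real s * x + w)^2"
    unfolding e by (simp add: algebra_simps power2_eq_square)
  then show ?thesis by (rule power2_le_imp_le) simp
qed

text \<open>If \<open>\<bar>x\<bar> = r\<close>, the integrand has a singularity; \<open>\<bar>s x + w\<bar>\<close> decreases as \<open>s\<close> decreases to \<open>1\<close>, so
  the formula follows by monotone convergence from the case \<open>\<bar>x\<bar> > r\<close>.\<close>

lemma ln_circle:
  assumes r: "r > 0"
  shows "has_bochner_integral lborel (\<lambda>t. indicator {0..2*pi} t * ln (norm (x + rcis r t))) (2 * pi * ln (max (norm x) r))"
proof (cases "norm x = r")
  case False
  then show ?thesis using ln_circle_ne r by blast
next
  case True
  define s :: "nat \<Rightarrow> real" where "s n = 1 + 1 / Suc n" for n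
  have s1: "s n > 1" for n by (simp add: s_def)
  have smono: "s n \<le> s m" if "m \<le> n" for m n using that by (simp add: s_def field_simps)
  have slim: "s \<longlonglongrightarrow> 1" unfolding s_def
    using LIMSEQ_inverse_real_of_nat_add[of 1] by (simp add: field_simps)
  have norm_s: "norm (of_real (s n) * x) = s n * r" for n
    using s1[of n] True by (simp add: norm_mult)
  have gt: "s n * r > r" for n using s1[of n] r by simp
  have *: "has_bochner_integral lborel (\<lambda>t. - (indicator {0..2*pi} t * ln (norm (x + rcis r t)))) (- (2 * pi * ln r))"
  proof (rule has_bochner_integral_monotone_convergence[where
        f="\<lambda>n t. - (indicator {0..2*pi} t * ln (norm (of_real (s n) * x + rcis r t)))"])
    fix n
    have "has_bochner_integral lborel (\<lambda>t. indicator {0..2*pi} t * ln (norm (of_real (s n) * x + rcis r t))) (2 * pi * ln (s n * r))"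
      using ln_circle_ne[of "of_real (s n) * x" r] gt[of n] r unfolding norm_s by (simp add: max_def)
    then have "has_bochner_integral lborel (\<lambda>t. - (indicator {0..2*pi} t * ln (norm (of_real (s n) * x + rcis r t)))) (- (2 * pi * ln (s n * r)))"
      by (rule has_bochner_integral_minus)
    then show "integrable lborel (\<lambda>t. - (indicator {0..2*pi} t * ln (norm (of_real (s n) * x + rcis r t))))" by (simp add: has_bochner_integral_iff)
  next
    have ne: "of_real (s n) * x + rcis r t \<noteq> 0" for n t
    proof
      assume "of_real (s n) * x + rcis r t = 0"
      then have "of_real (s n) * x = - rcis r t" by (simp add: eq_neg_iff_add_eq_0)
      then have "norm (of_real (s n) * x) = norm (- rcis r t)" by simp
      then show False using norm_s[of n] gt[of n] r by simp
    qed
    show "AE t in lborel. mono (\<lambda>n. - (indicator {0..2*pi} t * ln (norm (of_real (s n) * x + rcis r t))))"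
    proof (intro AE_I2 monoI)
      fix t and m n :: nat assume "m \<le> n"
      then have "norm (of_real (s n) * x + rcis r t) \<le> norm (of_real (s m) * x + rcis r t)"
        using s1[of n] True r by (intro norm_scale_add_mono smono) auto
      then have "ln (norm (of_real (s n) * x + rcis r t)) \<le> ln (norm (of_real (s m) * x + rcis r t))"
        using ne by (subst ln_le_cancel_iff) auto
      then show "- (indicator {0..2*pi} t * ln (norm (of_real (s m) * x + rcis r t)))
          \<le> - (indicator {0..2*pi} t * ln (norm (of_real (s n) * x + rcis r t)))"
        by (auto simp: indicator_def)
    qed
    show "AE t in lborel. (\<lambda>n. - (indicator {0..2*pi} t * ln (norm (of_real (s n) * x + rcis r t))))
         \<longlonglongrightarrow> - (indicator {0..2*pi} t * ln (norm (x + rcis r t)))"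
      using AE_rcis_ne[OF r, of "- x"]
    proof eventually_elim
      case (elim t)
      then have "x + rcis r t \<noteq> 0" by (metis add_eq_0_iff)
      moreover have "(\<lambda>n. of_real (s n) * x + rcis r t) \<longlonglongrightarrow> of_real 1 * x + rcis r t"
        by (intro tendsto_intros slim)
      ultimately have "(\<lambda>n. ln (norm (of_real (s n) * x + rcis r t))) \<longlonglongrightarrow> ln (norm (x + rcis r t))"
        by (intro tendsto_ln tendsto_norm) auto
      then show ?case by (intro tendsto_minus tendsto_mult_left)
    qed
    have "(\<lambda>n. - (2 * pi * ln (s n * r))) \<longlonglongrightarrow> - (2 * pi * ln (1 * r))"
      using r by (intro tendsto_intros slim) auto
    moreover have "(LINT t|lborel. - (indicator {0..2*pi} t * ln (norm (of_real (s n) * x + rcis r t)))) = - (2 * pi * ln (s n * r))" for n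
      using ln_circle_ne[of "of_real (s n) * x" r] gt[of n] r unfolding norm_s by (simp add: max_def has_bochner_integral_iff)
    ultimately show "(\<lambda>n. LINT t|lborel. - (indicator {0..2*pi} t * ln (norm (of_real (s n) * x + rcis r t)))) \<longlonglongrightarrow> - (2 * pi * ln r)"
      by simp
    show "(\<lambda>t. - (indicator {0..2*pi} t * ln (norm (x + rcis r t)))) \<in> borel_measurable lborel"
      unfolding rcis_def cis_conv_exp by measurable
  qed
  from has_bochner_integral_minus[OF *] show ?thesis using True r by simp
qed

text \<open>Carries Jensen's formula from signed integrals to \<open>circle_mean\<close>. The sign
  of \<open>I\<close> is recorded because later sums in \<open>ennreal\<close> can only be split
  into nonnegative terms.\<close>

lemma circle_mean_const_minus:
  assumes int: "has_bochner_integral lborel (\<lambda>t. indicator {0..2*pi} t * h t) (2 * pi * I)"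
    and ae: "AE t in lborel. t \<in> {0..2*pi} \<longrightarrow> f (u + rcis r t) = ennreal (h t) \<and> h t \<ge> 0"
  shows "circle_mean r f u = ennreal I" "I \<ge> 0"
proof -
  have nn: "AE t in lborel. 0 \<le> indicator {0..2*pi} t * h t"
    using ae by eventually_elim (auto simp: indicator_def)
  have "(\<integral>\<^sup>+ t. f (u + rcis r t) * indicator {0..2 * pi} t \<partial>lborel)
      = (\<integral>\<^sup>+ t. ennreal (indicator {0..2*pi} t * h t) \<partial>lborel)"
    using ae by (intro nn_integral_cong_AE) (auto elim!: eventually_mono simp: indicator_def)
  also have "\<dots> = ennreal (2 * pi * I)"
    using int nn by (simp add: has_bochner_integral_iff nn_integral_eq_integral)
  finally show "circle_mean r f u = ennreal I"
    unfolding circle_mean_def by (simp flip: ennreal_mult')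
  have "0 \<le> 2 * pi * I"
    using int nn integral_nonneg_AE[OF nn] by (simp add: has_bochner_integral_iff)
  then show "I \<ge> 0" using pi_gt_zero by (simp add: zero_le_mult_iff not_le)
qed

text \<open>Jensen's formula with one zero: over the circle \<open>ln (norm (z - y))\<close>
  averages to the logarithm of the larger of |u - y| and r, and \<open>ln (norm (F z))\<close> to
  its value at u. The excess of the first mean over its value at u is
  \<open>log_kernel r (dist u y)\<close>. The bound by \<open>R\<close> keeps the kernel from being
  cut off at 0 on the circle.\<close>

lemma circle_mean_log_kernel:
  assumes holo: "F holomorphic_on ball u r'" and nz: "\<And>z. z \<in> ball u r' \<Longrightarrow> F z \<noteq> 0"
    and r: "0 < r" "r < r'" and R: "R > 0"
    and le: "\<And>z. z \<in> cball u r \<Longrightarrow> norm ((z - y) * F z) \<le> R"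
  shows "circle_mean r (\<lambda>z. log_kernel R (norm ((z - y) * F z))) u + log_kernel r (dist u y)
    = log_kernel R (norm ((u - y) * F u))"
proof -
  define I where "I = ln R - ln (norm (F u)) - ln (max (norm (u - y)) r)"
  define h where "h t = ln R - ln (norm (F (u + rcis r t))) - ln (norm (u - y + rcis r t))" for t
  have cont: "continuous_on {0..2*pi} (\<lambda>t. ln (norm (F (u + rcis r t))))"
  proof -
    have "continuous_on {0..2*pi} (\<lambda>t. F (u + rcis r t))"
    proof (rule continuous_on_compose2[OF holomorphic_on_imp_continuous_on[OF holo]])
      show "continuous_on {0..2*pi} (\<lambda>t. u + rcis r t)"
        unfolding rcis_def cis_conv_exp by (intro continuous_intros)
    qed (use r in \<open>auto simp: dist_norm\<close>)
    then show ?thesis using r by (intro continuous_intros) (auto intro!: nz simp: dist_norm)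
  qed
  have c: "has_bochner_integral lborel (\<lambda>t. indicator {0..2*pi} t * ln R) (2 * pi * ln R)"
    by (rule has_bochner_integral_interval) (use has_integral_const_real[of "ln R" 0 "2*pi"] in auto)
  have 1: "has_bochner_integral lborel (\<lambda>t. indicator {0..2*pi} t * h t) (2 * pi * I)"
    using has_bochner_integral_diff[OF has_bochner_integral_diff[OF c
        has_bochner_integral_interval[OF has_integral_ln_norm_circle[OF holo nz r] cont]]
        ln_circle[OF r(1), of "u - y"]]
    by (simp add: h_def I_def algebra_simps)
  have 2: "AE t in lborel. t \<in> {0..2*pi} \<longrightarrow>
      log_kernel R (norm ((u + rcis r t - y) * F (u + rcis r t))) = ennreal (h t) \<and> h t \<ge> 0"
    using AE_rcis_ne[OF r(1), of "y - u"]
  proof eventually_elim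
    case (elim t)
    have z: "u + rcis r t \<in> cball u r" using r by (simp add: dist_norm)
    have F0: "F (u + rcis r t) \<noteq> 0" using r by (intro nz) (auto simp: dist_norm)
    have y0: "u + rcis r t - y \<noteq> 0" using elim by (auto simp: algebra_simps)
    have nn: "norm ((u + rcis r t - y) * F (u + rcis r t)) > 0" using F0 y0 by simp
    have "ln (R / norm ((u + rcis r t - y) * F (u + rcis r t)))
        = ln R - (ln (norm (u + rcis r t - y)) + ln (norm (F (u + rcis r t))))"
      using R F0 y0 by (subst norm_mult) (simp add: ln_div ln_mult)
    moreover have "u + rcis r t - y = u - y + rcis r t" by simp
    then have nyt: "norm (u + rcis r t - y) = norm (u - y + rcis r t)" by (rule arg_cong)
    ultimately have "ln (R / norm ((u + rcis r t - y) * F (u + rcis r t))) = h t"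
      unfolding h_def nyt[symmetric] by (simp only: diff_diff_eq add.commute)
    moreover have "ln (R / norm ((u + rcis r t - y) * F (u + rcis r t))) \<ge> 0"
      using le[OF z] nn by (intro ln_ge_zero) (simp add: field_simps)
    ultimately show ?case using nn by (simp add: log_kernel_def)
  qed
  note cm = circle_mean_const_minus[OF 1, where f="\<lambda>z. log_kernel R (norm ((z - y) * F z))", OF 2]
  have Fu: "F u \<noteq> 0" using r by (intro nz) auto
  show ?thesis
  proof (cases "u = y")
    case True
    then show ?thesis by (simp add: log_kernel_def)
  next
    case False
    then have uy: "norm (u - y) > 0" by simp
    have X: "log_kernel R (norm ((u - y) * F u)) = ennreal (ln R - ln (norm (F u)) - ln (norm (u - y)))"
      using uy Fu R False unfolding norm_mult log_kernel_def by (simp add: ln_div ln_mult algebra_simps)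
    have Y: "log_kernel r (dist u y) = ennreal (ln r - ln (norm (u - y)))"
      using uy r False by (simp add: log_kernel_def dist_norm ln_div)
    show ?thesis
    proof (cases "norm (u - y) \<le> r")
      case True
      then have "ln (norm (u - y)) \<le> ln r" using uy r(1) by simp
      then show ?thesis using True cm(2)
        unfolding cm(1) X Y by (auto simp: I_def max_def simp flip: ennreal_plus)
    next
      case False
      then have "ln r \<le> ln (norm (u - y))" using uy r by simp
      then show ?thesis using False cm(2)
        unfolding cm(1) X Y by (auto simp: I_def max_def ennreal_neg)
    qed
  qed
qed

text \<open>Reduced to the case with a zero by inventing one, \<open>y\<close>, on the boundary of
  the larger ball: the open ball does not contain it, and at distance r' > r from u it contributes
  no correction.\<close>

lemma circle_mean_log_kernel_nonzero:
  assumes holo: "F holomorphic_on ball u r'" and nz: "\<And>z. z \<in> ball u r' \<Longrightarrow> F z \<noteq> 0"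
    and r: "0 < r" "r < r'" and R: "R > 0"
    and le: "\<And>z. z \<in> cball u r \<Longrightarrow> norm (F z) \<le> R"
  shows "circle_mean r (\<lambda>z. log_kernel R (norm (F z))) u = log_kernel R (norm (F u))"
proof -
  define y where "y = u + of_real r'"
  have yz: "z - y \<noteq> 0" if "z \<in> ball u r'" for z
    using that r by (auto simp: y_def dist_norm)
  have sub: "cball u r \<subseteq> ball u r'" using r by auto
  have eq: "(z - y) * (F z / (z - y)) = F z" if "z \<in> ball u r'" for z using yz[OF that] by simp
  have "circle_mean r (\<lambda>z. log_kernel R (norm ((z - y) * (F z / (z - y))))) u + log_kernel r (dist u y)
    = log_kernel R (norm ((u - y) * (F u / (u - y))))"
  proof (rule circle_mean_log_kernel[OF _ _ r R])
    show "(\<lambda>z. F z / (z - y)) holomorphic_on ball u r'"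
      using yz by (intro holomorphic_intros holo) auto
    show "norm ((z - y) * (F z / (z - y))) \<le> R" if "z \<in> cball u r" for z
      using eq le that sub by (metis subsetD)
  qed (use nz yz in auto)
  moreover have "log_kernel r (dist u y) = 0"
    using r by (auto simp: log_kernel_def y_def dist_norm intro!: ennreal_neg ln_le_zero_iff[THEN iffD2])
  moreover have "circle_mean r (\<lambda>z. log_kernel R (norm ((z - y) * (F z / (z - y))))) u = circle_mean r (\<lambda>z. log_kernel R (norm (F z))) u"
  proof -
    have "u + rcis r t \<in> ball u r'" for t using r by (simp add: dist_norm)
    then show ?thesis unfolding circle_mean_def by (simp only: eq)
  qed
  moreover have "(u - y) * (F u / (u - y)) = F u" using r by (intro eq) auto
  ultimately show ?thesis by simp
qed

section \<open>Measures determined by smoothings\<close>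

lemma nn_integral_lborel_dist:
  fixes y :: "'a::euclidean_space"
  assumes [measurable]: "k \<in> borel_measurable borel" "A \<in> sets borel"
  shows "(\<integral>\<^sup>+ u. k (dist u y) * indicator A (dist u y) \<partial>lborel) = (\<integral>\<^sup>+ u. k (norm u) * indicator A (norm (u::'a)) \<partial>lborel)"
proof -
  have "(\<integral>\<^sup>+ u. k (norm u) * indicator A (norm (u::'a)) \<partial>lborel)
      = (\<integral>\<^sup>+ u. k (norm u) * indicator A (norm (u::'a)) \<partial>distr lborel borel ((+) (- y)))"
    by (simp add: lborel_distr_plus)
  also have "\<dots> = (\<integral>\<^sup>+ u. k (dist u y) * indicator A (dist u y) \<partial>lborel)"
    by (subst nn_integral_distr) (auto simp: dist_norm)
  finally show ?thesis ..
qed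

text \<open>Radial kernels on the plane, not normalised: \<open>c n\<close> is the total mass and
  \<open>t d n\<close> bounds the fraction of it beyond distance \<open>d\<close>. Logarithmic
  kernels of shrinking radius and narrowing Gaussians both fit.\<close>

locale approximate_identity =
  fixes k :: "nat \<Rightarrow> real \<Rightarrow> ennreal" and c :: "nat \<Rightarrow> real" and t :: "real \<Rightarrow> nat \<Rightarrow> real"
  assumes k_measurable[measurable]: "\<And>n. k n \<in> borel_measurable borel"
    and c_pos: "\<And>n. c n > 0"
    and total: "\<And>n. (\<integral>\<^sup>+ u. k n (norm (u::complex)) \<partial>lborel) = ennreal (c n)"
    and tail: "\<And>n d. d > 0 \<Longrightarrow> (\<integral>\<^sup>+ u. k n (norm (u::complex)) * indicator {d<..} (norm u) \<partial>lborel) \<le> ennreal (t d n * c n)"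
    and tail_nonneg: "\<And>n d. d > 0 \<Longrightarrow> t d n \<ge> 0"
    and tail_lim: "\<And>d. d > 0 \<Longrightarrow> t d \<longlonglongrightarrow> 0"
begin

text \<open>Both smoothings are integrated over the \<open>d\<close>-neighbourhood of
  \<open>C\<close>. Up to the tail, the \<alpha>-mass of \<open>C\<close> stays in that
  neighbourhood, and the \<beta>-mass found there comes from within \<open>2 * d\<close> of
  \<open>C\<close>. As the smoothings agree, letting \<open>n\<close> tend to infinity and then
  \<open>d\<close> to 0 gives the inequality.\<close>

lemma emeasure_closed_le:
  fixes C :: "complex set"
  assumes fin: "finite_measure \<alpha>" "finite_measure \<beta>"
    and s[measurable_cong]: "sets \<alpha> = sets borel" "sets \<beta> = sets borel"
    and eq: "\<And>n. AE u in lborel. (\<integral>\<^sup>+ y. k n (dist u y) \<partial>\<alpha>) = (\<integral>\<^sup>+ y. k n (dist u y) \<partial>\<beta>)"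
    and C: "closed C"
  shows "measure \<alpha> C \<le> measure \<beta> C"
proof (cases "C = {}")
  case False
  interpret a: finite_measure \<alpha> by fact
  interpret b: finite_measure \<beta> by fact
  interpret pa: pair_sigma_finite lborel \<alpha> by standard
  interpret pb: pair_sigma_finite lborel \<beta> by standard
  define N where "N \<delta> = {u. infdist u C \<le> \<delta>}" for \<delta>
  have clN: "closed (N \<delta>)" for \<delta>
    unfolding N_def by (intro closed_Collect_le continuous_intros)
  have [measurable]: "C \<in> sets borel" using C by simp
  have [measurable]: "N \<delta> \<in> sets borel" for \<delta> using clN by simp
  have key: "measure \<alpha> C \<le> measure \<beta> (N (2 * d)) + t d n * (measure \<beta> UNIV + measure \<alpha> UNIV)" if d: "d > 0" for d n
  proof -
    define \<tau> where "\<tau> = ennreal (t d n * c n)"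
    have far: "(\<integral>\<^sup>+ u. k n (dist u y) * indicator {d<..} (dist u y) \<partial>lborel) \<le> \<tau>" for y :: complex
      using tail[OF d, of n] by (subst nn_integral_lborel_dist) (auto simp: \<tau>_def)
    have all: "(\<integral>\<^sup>+ u. k n (dist u y) \<partial>lborel) = ennreal (c n)" for y :: complex
      using total[of n] nn_integral_lborel_dist[of "k n" UNIV y] by simp
    have near: "(\<integral>\<^sup>+ u. k n (dist u y) \<partial>lborel) \<le> (\<integral>\<^sup>+ u. k n (dist u y) * indicator (N d) u \<partial>lborel) + \<tau>"
      if "y \<in> C" for y
    proof -
      have "u \<in> N d" if "\<not> dist u y > d" for u
        using infdist_le[OF \<open>y \<in> C\<close>, of u] that by (auto simp: N_def)
      then have "(\<integral>\<^sup>+ u. k n (dist u y) \<partial>lborel) \<le> (\<integral>\<^sup>+ u. k n (dist u y) * indicator (N d) u + k n (dist u y) * indicator {d<..} (dist u y) \<partial>lborel)"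
        by (intro nn_integral_mono) (auto simp: indicator_def)
      also have "\<dots> = (\<integral>\<^sup>+ u. k n (dist u y) * indicator (N d) u \<partial>lborel) + (\<integral>\<^sup>+ u. k n (dist u y) * indicator {d<..} (dist u y) \<partial>lborel)"
        by (intro nn_integral_add) auto
      finally show ?thesis using far[of y] by (meson add_left_mono order_trans)
    qed
    have away: "(\<integral>\<^sup>+ u. k n (dist u y) * indicator (N d) u \<partial>lborel) \<le> ennreal (c n) * indicator (N (2*d)) y + \<tau>" for y
    proof (cases "y \<in> N (2 * d)")
      case True
      have "(\<integral>\<^sup>+ u. k n (dist u y) * indicator (N d) u \<partial>lborel) \<le> (\<integral>\<^sup>+ u. k n (dist u y) \<partial>lborel)"
        by (intro nn_integral_mono) (auto simp: indicator_def)
      then show ?thesis using True all[of y] by (auto intro: order_trans simp: add_increasing2)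
    next
      case False
      have "dist u y > d" if "u \<in> N d" for u
        using that False infdist_triangle[of y C u] by (auto simp: N_def dist_commute)
      then have "(\<integral>\<^sup>+ u. k n (dist u y) * indicator (N d) u \<partial>lborel) \<le> (\<integral>\<^sup>+ u. k n (dist u y) * indicator {d<..} (dist u y) \<partial>lborel)"
        by (intro nn_integral_mono) (auto simp: indicator_def)
      then show ?thesis using far[of y] False by (auto intro: order_trans)
    qed
    have "ennreal (c n) * emeasure \<alpha> C = (\<integral>\<^sup>+ y. ennreal (c n) * indicator C y \<partial>\<alpha>)"
      by (simp add: nn_integral_cmult_indicator)
    also have "\<dots> \<le> (\<integral>\<^sup>+ y. (\<integral>\<^sup>+ u. k n (dist u y) * indicator (N d) u \<partial>lborel) + \<tau> \<partial>\<alpha>)"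
      by (intro nn_integral_mono) (use near all in \<open>auto simp: indicator_def\<close>)
    also have "\<dots> = (\<integral>\<^sup>+ y. (\<integral>\<^sup>+ u. k n (dist u y) * indicator (N d) u \<partial>lborel) \<partial>\<alpha>) + \<tau> * emeasure \<alpha> UNIV"
      using sets_eq_imp_space_eq[OF s(1)] by (subst nn_integral_add) auto
    also have "(\<integral>\<^sup>+ y. (\<integral>\<^sup>+ u. k n (dist u y) * indicator (N d) u \<partial>lborel) \<partial>\<alpha>)
      = (\<integral>\<^sup>+ u. (\<integral>\<^sup>+ y. k n (dist u y) * indicator (N d) u \<partial>\<alpha>) \<partial>lborel)"
      by (rule pa.Fubini') measurable
    also have "\<dots> = (\<integral>\<^sup>+ u. (\<integral>\<^sup>+ y. k n (dist u y) * indicator (N d) u \<partial>\<beta>) \<partial>lborel)"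
      using eq[of n] by (intro nn_integral_cong_AE) (auto elim!: eventually_mono simp: nn_integral_multc)
    also have "\<dots> = (\<integral>\<^sup>+ y. (\<integral>\<^sup>+ u. k n (dist u y) * indicator (N d) u \<partial>lborel) \<partial>\<beta>)"
      by (rule pb.Fubini'[symmetric]) measurable
    also have "\<dots> \<le> (\<integral>\<^sup>+ y. ennreal (c n) * indicator (N (2*d)) y + \<tau> \<partial>\<beta>)"
      by (intro nn_integral_mono away)
    also have "\<dots> = ennreal (c n) * emeasure \<beta> (N (2*d)) + \<tau> * emeasure \<beta> UNIV"
      using sets_eq_imp_space_eq[OF s(2)] by (subst nn_integral_add) (auto simp: nn_integral_cmult_indicator)
    finally have "ennreal (c n * measure \<alpha> C) \<le> ennreal (c n * measure \<beta> (N (2*d)) + t d n * c n * measure \<beta> UNIV + t d n * c n * measure \<alpha> UNIV)"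
      using c_pos[of n] tail_nonneg[OF d, of n]
      by (simp add: a.emeasure_eq_measure b.emeasure_eq_measure \<tau>_def less_imp_le flip: ennreal_plus ennreal_mult)
    then have "c n * measure \<alpha> C \<le> c n * measure \<beta> (N (2*d)) + t d n * c n * measure \<beta> UNIV + t d n * c n * measure \<alpha> UNIV"
      using c_pos[of n] tail_nonneg[OF d, of n] by (subst (asm) ennreal_le_iff) auto
    then have "c n * measure \<alpha> C \<le> c n * (measure \<beta> (N (2*d)) + t d n * (measure \<beta> UNIV + measure \<alpha> UNIV))"
      by (simp add: algebra_simps)
    then show ?thesis using c_pos[of n] by simp
  qed
  have "measure \<alpha> C \<le> measure \<beta> (N (2 * d)) + 0 * (measure \<beta> UNIV + measure \<alpha> UNIV)" if "d > 0" for d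
  proof (rule LIMSEQ_le_const)
    show "(\<lambda>n. measure \<beta> (N (2 * d)) + t d n * (measure \<beta> UNIV + measure \<alpha> UNIV)) \<longlonglongrightarrow>
        measure \<beta> (N (2 * d)) + 0 * (measure \<beta> UNIV + measure \<alpha> UNIV)"
      by (intro tendsto_intros tail_lim that)
  qed (use key[OF that] in auto)
  then have *: "measure \<alpha> C \<le> measure \<beta> (N (2 * d))" if "d > 0" for d using that by simp
  have le: "measure \<alpha> C \<le> measure \<beta> (N (2 * (1 / Suc n)))" for n by (rule *) simp
  have "(\<lambda>n. measure \<beta> (N (2 * (1 / Suc n)))) \<longlonglongrightarrow> measure \<beta> (\<Inter>n. N (2 * (1 / Suc n)))"
  proof (rule b.finite_Lim_measure_decseq)
    show "decseq (\<lambda>n. N (2 * (1 / Suc n)))"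
    proof (rule decseq_SucI)
      fix n
      have "2 * (1 / real (Suc (Suc n))) \<le> 2 * (1 / real (Suc n))" by (intro mult_left_mono divide_left_mono) auto
      then show "N (2 * (1 / real (Suc (Suc n)))) \<subseteq> N (2 * (1 / real (Suc n)))"
        unfolding N_def by (intro Collect_mono impI) (rule order_trans)
    qed
  qed auto
  moreover have "(\<Inter>n. N (2 * (1 / Suc n))) = C"
  proof safe
    fix x assume x: "x \<in> (\<Inter>n. N (2 * (1 / Suc n)))"
    have "(\<lambda>n. 2 * (1 / real (Suc n))) \<longlonglongrightarrow> 2 * 0"
      using LIMSEQ_inverse_real_of_nat by (intro tendsto_intros) (simp add: inverse_eq_divide)
    then have "infdist x C \<le> 2 * 0"
      by (rule LIMSEQ_le_const) (use x in \<open>auto simp: N_def\<close>)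
    then have "infdist x C = 0" using infdist_nonneg[of x C] by simp
    then show "x \<in> C" using C False in_closed_iff_infdist_zero by blast
  qed (auto simp: N_def)
  ultimately have "(\<lambda>n. measure \<beta> (N (2 * (1 / Suc n)))) \<longlonglongrightarrow> measure \<beta> C" by simp
  then show ?thesis by (rule LIMSEQ_le_const) (use le in blast)
qed simp

lemma measure_eq:
  fixes \<alpha> \<beta> :: "complex measure"
  assumes fin: "finite_measure \<alpha>" "finite_measure \<beta>"
    and s: "sets \<alpha> = sets borel" "sets \<beta> = sets borel"
    and eq: "\<And>n. AE u in lborel. (\<integral>\<^sup>+ y. k n (dist u y) \<partial>\<alpha>) = (\<integral>\<^sup>+ y. k n (dist u y) \<partial>\<beta>)"
  shows "\<alpha> = \<beta>"
proof -
  interpret a: finite_measure \<alpha> by fact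
  interpret b: finite_measure \<beta> by fact
  have *: "emeasure \<alpha> C = emeasure \<beta> C" if "closed C" for C
  proof -
    have "AE u in lborel. (\<integral>\<^sup>+ y. k n (dist u y) \<partial>\<beta>) = (\<integral>\<^sup>+ y. k n (dist u y) \<partial>\<alpha>)" for n
      using eq[of n] by eventually_elim simp
    then show ?thesis
      using emeasure_closed_le[OF fin s, OF eq that] emeasure_closed_le[OF fin(2,1) s(2,1), OF _ that]
      by (metis a.emeasure_eq_measure b.emeasure_eq_measure order_antisym)
  qed
  show ?thesis
  proof (rule measure_eqI_generator_eq[where E="Collect closed" and \<Omega>=UNIV and A="\<lambda>_. UNIV"])
    show "sets \<alpha> = sigma_sets UNIV (Collect closed)" "sets \<beta> = sigma_sets UNIV (Collect closed)"
      using s by (simp_all add: borel_eq_closed)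
  qed (auto simp: Int_stable_def * )
qed

end

text \<open>The i-th indicator says that ln (r / d) is at least i, so for d \<le> r the sum is the
  integer part of ln (r / d) plus one.\<close>

lemma log_kernel_le_suminf:
  assumes "r > 0" "d > 0"
  shows "log_kernel r d \<le> (\<Sum>i. indicator {..r * exp (- real i)} d)"
proof (cases "d < r")
  case True
  define x where "x = ln (r / d)"
  have x: "x > 0" using True assms by (simp add: x_def)
  define n where "n = nat \<lfloor>x\<rfloor> + 1"
  have "log_kernel r d = ennreal x" using assms by (simp add: log_kernel_def x_def)
  also have "\<dots> \<le> ennreal (real n)" unfolding n_def using x by (intro ennreal_leI) linarith
  also have "\<dots> = (\<Sum>i<n. 1)" by (simp add: ennreal_of_nat_eq_real_of_nat)
  also have "\<dots> = (\<Sum>i<n. indicator {..r * exp (- real i)} d)"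
  proof (rule sum.cong)
    fix i assume "i \<in> {..<n}"
    then have "real i \<le> x" unfolding n_def using x by simp linarith
    then have "exp (real i) \<le> r / d" using assms by (simp add: x_def ln_ge_iff)
    then have "d \<le> r * exp (- real i)" using assms by (simp add: exp_minus field_simps)
    then show "1 = indicator {..r * exp (- real i)} d" by simp
  qed simp
  also have "\<dots> \<le> (\<Sum>i. indicator {..r * exp (- real i)} d)"
    by (rule sum_le_suminf) auto
  finally show ?thesis .
next
  case False
  then have "log_kernel r d = 0" using assms
    by (auto simp: log_kernel_def intro!: ennreal_neg ln_le_zero_iff[THEN iffD2])
  then show ?thesis by simp
qed

text \<open>The discs of radius \<open>r * exp (- real i)\<close> in the preceding bound have areas
  in geometric progression with ratio \<open>exp (-2)\<close>.\<close>

lemma nn_integral_log_kernel_finite: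
  assumes "r > 0"
  shows "(\<integral>\<^sup>+ u. log_kernel r (norm (u::complex)) \<partial>lborel) < \<top>"
proof -
  define v where "v = unit_ball_vol (real DIM(complex)) * r\<^sup>2"
  have "(\<integral>\<^sup>+ u. log_kernel r (norm (u::complex)) \<partial>lborel)
      \<le> (\<integral>\<^sup>+ u. (\<Sum>i. indicator (cball (0::complex) (r * exp (- real i))) u) \<partial>lborel)"
  proof (rule nn_integral_mono_AE)
    show "AE u in lborel. log_kernel r (norm (u::complex)) \<le> (\<Sum>i. indicator (cball 0 (r * exp (- real i))) u)"
      using AE_lborel_singleton[of "0::complex"]
    proof eventually_elim
      case (elim u)
      then show ?case using log_kernel_le_suminf[OF assms, of "norm u"]
        by (simp add: indicator_def)
    qed
  qed
  also have "\<dots> = (\<Sum>i. emeasure lborel (cball (0::complex) (r * exp (- real i))))"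
    by (subst nn_integral_suminf) (auto intro!: borel_measurable_indicator borel_closed)
  also have "\<dots> = (\<Sum>i. ennreal (v * (exp (-2)) ^ i))"
  proof (intro suminf_cong)
    fix i
    have "exp (-2) ^ i = exp (real i * (-2) :: real)" by (simp only: exp_of_nat_mult)
    also have "\<dots> = exp (- real i + - real i)" by simp
    also have "\<dots> = exp (- real i) ^ 2" by (simp only: exp_add power2_eq_square)
    finally have "(r * exp (- real i)) ^ 2 = r\<^sup>2 * exp (-2) ^ i" by (simp add: power_mult_distrib)
    then show "emeasure lborel (cball (0::complex) (r * exp (- real i))) = ennreal (v * (exp (-2)) ^ i)"
      using assms by (simp add: emeasure_cball v_def mult.assoc)
  qed
  also have "\<dots> = ennreal (\<Sum>i. v * (exp (-2)) ^ i)"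
    by (rule suminf_ennreal2) (auto intro!: summable_mult summable_geometric simp: v_def)
  also have "\<dots> < \<top>" by simp
  finally show ?thesis .
qed

text \<open>\<open>pot r\<close> is convolution with a kernel that vanishes outside the disc of
  radius r, so along radii tending to 0 it forms an approximate identity.\<close>

lemma measure_eq_of_pot_eq:
  assumes fin: "finite_measure \<alpha>" "finite_measure \<beta>"
    and s: "sets \<alpha> = sets borel" "sets \<beta> = sets borel" and r0: "r0 > 0"
    and eq: "\<And>r u. 0 < r \<Longrightarrow> r < r0 \<Longrightarrow> pot r \<alpha> u = pot r \<beta> u"
  shows "\<alpha> = \<beta>"
proof -
  \<comment> \<open>The shift by 2 keeps \<open>r n\<close> positive and strictly below
    \<open>r0\<close> from n = 0 on.\<close>
  define r where "r n = r0 / (real n + 2)" for n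
  have r: "0 < r n" "r n < r0" for n using r0 by (auto simp: r_def field_simps add_pos_nonneg)
  define I where "I n = (\<integral>\<^sup>+ u. log_kernel (r n) (norm (u::complex)) \<partial>lborel)" for n
  have Ipos: "I n > 0" for n
  proof (rule ccontr)
    assume "\<not> I n > 0"
    then have "I n = 0" by simp
    then have "AE u in lborel. log_kernel (r n) (norm (u::complex)) = 0"
      unfolding I_def by (subst (asm) nn_integral_0_iff_AE) auto
    then have "AE u in lborel. (u::complex) \<notin> ball 0 (r n)"
      by eventually_elim (auto simp: log_kernel_def ennreal_eq_0_iff r split: if_splits)
    then have "emeasure lborel (ball 0 (r n) :: complex set) = 0"
      by (subst (asm) AE_iff_measurable[where N="ball 0 (r n)"]) auto
    moreover have "emeasure lborel (ball 0 (r n) :: complex set) \<noteq> 0"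
      using r(1)[of n] unit_ball_vol_pos[of 2] unfolding less_le by (simp add: emeasure_ball)
    ultimately show False by simp
  qed
  have Ifin: "I n < \<top>" for n
    unfolding I_def by (rule nn_integral_log_kernel_finite) (rule r)
  \<comment> \<open>No mass lies beyond \<open>d\<close> once \<open>r n \<le> d\<close>; for the
    finitely many earlier n the trivial fraction 1 is used.\<close>
  interpret approximate_identity "\<lambda>n. log_kernel (r n)" "\<lambda>n. enn2real (I n)" "\<lambda>d n. if r n \<le> d then 0 else 1"
  proof
    fix n show "0 < enn2real (I n)" using Ipos Ifin by (simp add: enn2real_positive_iff)
    show "(\<integral>\<^sup>+ u. log_kernel (r n) (norm (u::complex)) \<partial>lborel) = ennreal (enn2real (I n))"
      using Ifin[of n] by (simp add: I_def)
    fix d :: real assume "d > 0"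
    show "(\<integral>\<^sup>+ u. log_kernel (r n) (norm (u::complex)) * indicator {d<..} (norm u) \<partial>lborel)
        \<le> ennreal ((if r n \<le> d then 0 else 1) * enn2real (I n))"
    proof (cases "r n \<le> d")
      case True
      then have "log_kernel (r n) (norm (u::complex)) * indicator {d<..} (norm u) = 0" for u
        using r(1)[of n] by (auto simp: log_kernel_def indicator_def field_simps intro!: ennreal_neg ln_le_zero_iff[THEN iffD2])
      then show ?thesis by (simp only: nn_integral_const) simp
    next
      case False
      have "(\<integral>\<^sup>+ u. log_kernel (r n) (norm (u::complex)) * indicator {d<..} (norm u) \<partial>lborel) \<le> I n"
        unfolding I_def by (intro nn_integral_mono) (auto simp: indicator_def)
      then show ?thesis using False Ifin[of n] by simp
    qed
  next
    fix d :: real assume d: "d > 0"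
    have "r \<longlonglongrightarrow> 0" unfolding r_def by real_asymp
    then have "eventually (\<lambda>n. r n < d) sequentially" using d by (rule order_tendstoD)
    then have "eventually (\<lambda>n. (if r n \<le> d then 0 else 1) = (0::real)) sequentially"
      by eventually_elim auto
    then show "(\<lambda>n. if r n \<le> d then 0 else 1::real) \<longlonglongrightarrow> 0" by (rule tendsto_eventually)
  qed auto
  show ?thesis
    by (rule measure_eq[OF fin s]) (use eq[OF r] in \<open>simp add: pot_def\<close>)
qed

section \<open>Positive definiteness of the logarithmic kernel\<close>

lemma nn_integral_exp_neg:
  assumes "a > (0::real)"
  shows "(\<integral>\<^sup>+ t. ennreal (a * exp (- a * t)) * indicator {b..} t \<partial>lborel) = ennreal (exp (- a * b))"
proof -
  have "(\<integral>\<^sup>+ t. ennreal (a * exp (- a * t)) * indicator {b..} t \<partial>lborel) = ennreal (0 - (- exp (- a * b)))"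
  proof (rule nn_integral_FTC_atLeast)
    have "((\<lambda>t. - exp (- a * t)) \<longlongrightarrow> - 0) at_top"
      using assms by (intro tendsto_minus) real_asymp
    then show "((\<lambda>t. - exp (- a * t)) \<longlongrightarrow> 0) at_top" by simp
  qed (use assms in \<open>auto intro!: derivative_eq_intros\<close>)
  then show ?thesis by simp
qed

text \<open>Layer-cake argument: the Gaussian is the integral of \<open>a * exp (- a * t)\<close>
  over t \<ge> |u|^2, and for fixed t the points u with |u|^2 \<le> t fill a disc of area
  \<open>pi * t\<close>.\<close>

lemma nn_integral_gaussian:
  assumes a: "a > 0"
  shows "(\<integral>\<^sup>+ u. ennreal (exp (- a * (norm (u::complex))\<^sup>2)) \<partial>lborel) = ennreal (pi / a)"
proof -
  have "(\<integral>\<^sup>+ u. ennreal (exp (- a * (norm (u::complex))\<^sup>2)) \<partial>lborel)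
      = (\<integral>\<^sup>+ u. (\<integral>\<^sup>+ t. ennreal (a * exp (- a * t)) * indicator {(norm u)\<^sup>2..} t \<partial>lborel) \<partial>(lborel :: complex measure))"
    by (simp only: nn_integral_exp_neg[OF a])
  also have "\<dots> = (\<integral>\<^sup>+ t. (\<integral>\<^sup>+ u. ennreal (a * exp (- a * t)) * indicator {(norm u)\<^sup>2..} t \<partial>(lborel :: complex measure)) \<partial>lborel)"
  proof (rule lborel_pair.Fubini')
    have "(\<lambda>(t, u). ennreal (a * exp (- a * t)) * (if (norm (u::complex))\<^sup>2 \<le> t then 1 else 0)) \<in> borel_measurable (lborel \<Otimes>\<^sub>M lborel)"
      by measurable
    then show "(\<lambda>(t, u). ennreal (a * exp (- a * t)) * indicator {(norm (u::complex))\<^sup>2..} t) \<in> borel_measurable (lborel \<Otimes>\<^sub>M lborel)"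
      by (simp add: indicator_def split_beta' if_distrib cong: if_cong)
  qed
  also have "\<dots> = (\<integral>\<^sup>+ t. ennreal (pi * a * t * exp (- a * t)) * indicator {0..} t \<partial>lborel)"
  proof (rule nn_integral_cong)
    fix t :: real
    show "(\<integral>\<^sup>+ u. ennreal (a * exp (- a * t)) * indicator {(norm u)\<^sup>2..} t \<partial>(lborel :: complex measure))
       = ennreal (pi * a * t * exp (- a * t)) * indicator {0..} t"
    proof (cases "t \<ge> 0")
      case True
      have "indicator {(norm (u::complex))\<^sup>2..} t = (indicator (cball 0 (sqrt t)) u :: ennreal)" for u
      proof -
        have "(norm u)\<^sup>2 \<le> t \<longleftrightarrow> norm u \<le> sqrt t"
          by (metis abs_norm_cancel real_sqrt_abs real_sqrt_le_iff)
        then show ?thesis by (simp add: indicator_def)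
      qed
      then have "(\<integral>\<^sup>+ u. ennreal (a * exp (- a * t)) * indicator {(norm u)\<^sup>2..} t \<partial>(lborel :: complex measure))
          = ennreal (a * exp (- a * t)) * emeasure lborel (cball (0::complex) (sqrt t))"
        by (simp add: nn_integral_cmult_indicator)
      also have "\<dots> = ennreal (a * exp (- a * t)) * ennreal (pi * t)"
        using True by (simp add: emeasure_cball unit_ball_vol_2)
      also have "\<dots> = ennreal (pi * a * t * exp (- a * t))"
        using True a by (subst ennreal_mult[symmetric]) (simp_all add: mult_ac)
      finally show ?thesis using True by simp
    next
      case False
      then have "\<not> (norm (u::complex))\<^sup>2 \<le> t" for u by (meson order_trans zero_le_power2)
      with False show ?thesis by simp
    qed
  qed
  also have "\<dots> = ennreal (0 - (- (pi / a) * (a * 0 + 1) * exp (- a * 0)))"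
  proof (rule nn_integral_FTC_atLeast[where F="\<lambda>t. - (pi / a) * (a * t + 1) * exp (- a * t)"])
    show "((\<lambda>t. - (pi / a) * (a * t + 1) * exp (- a * t)) \<longlongrightarrow> 0) at_top"
      using a by real_asymp
    fix t :: real assume "0 \<le> t"
    show "DERIV (\<lambda>t. - (pi / a) * (a * t + 1) * exp (- a * t)) t :> pi * a * t * exp (- a * t)"
      using a by (auto intro!: derivative_eq_intros simp: field_simps)
  qed (use a in auto)
  finally show ?thesis by simp
qed

text \<open>Completing the square at the midpoint \<open>m\<close>. A Gaussian of exponent s is
  thus, up to a factor, the overlap of two Gaussians of exponent 2 s, which is the source of
  positive definiteness.\<close>

lemma gaussian_convolution:
  fixes x y :: complex
  assumes s: "s > 0"
  shows "(\<integral>\<^sup>+ u. ennreal (exp (- (2 * s) * (dist u x)\<^sup>2)) * ennreal (exp (- (2 * s) * (dist u y)\<^sup>2)) \<partial>lborel)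
    = ennreal (pi / (4 * s)) * ennreal (exp (- s * (dist x y)\<^sup>2))"
proof -
  define m where "m = (1/2) *\<^sub>R (x + y)"
  have "2 * s * (dist u x)\<^sup>2 + 2 * s * (dist u y)\<^sup>2 = s * (dist x y)\<^sup>2 + 4 * s * (dist u m)\<^sup>2" for u
  proof -
    have "2 * (dist u x)\<^sup>2 + 2 * (dist u y)\<^sup>2 = (dist x y)\<^sup>2 + 4 * (dist u m)\<^sup>2"
      unfolding dist_norm cmod_power2 m_def by (simp add: power2_eq_square field_simps)
    from arg_cong[OF this, of "\<lambda>z. s * z"] show ?thesis by (simp add: algebra_simps)
  qed
  then have "- (2 * s) * (dist u x)\<^sup>2 + - (2 * s) * (dist u y)\<^sup>2 = - s * (dist x y)\<^sup>2 + - (4 * s) * (dist u m)\<^sup>2" for u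
    by (simp add: minus_equation_iff) (smt (verit))
  then have "exp (- (2 * s) * (dist u x)\<^sup>2) * exp (- (2 * s) * (dist u y)\<^sup>2)
      = exp (- s * (dist x y)\<^sup>2) * exp (- (4 * s) * (dist u m)\<^sup>2)" for u
    by (simp only: exp_add[symmetric])
  then have "(\<integral>\<^sup>+ u. ennreal (exp (- (2 * s) * (dist u x)\<^sup>2)) * ennreal (exp (- (2 * s) * (dist u y)\<^sup>2)) \<partial>lborel)
    = (\<integral>\<^sup>+ u. ennreal (exp (- s * (dist x y)\<^sup>2)) * ennreal (exp (- (4 * s) * (dist u m)\<^sup>2)) \<partial>lborel)"
    by (intro nn_integral_cong) (simp only: ennreal_mult[symmetric] exp_ge_zero)
  also have "\<dots> = ennreal (exp (- s * (dist x y)\<^sup>2)) * ennreal (pi / (4 * s))"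
    using nn_integral_lborel_dist[of "\<lambda>d. ennreal (exp (- (4 * s) * d\<^sup>2))" UNIV m] nn_integral_gaussian[of "4 * s"] s
    by (simp add: nn_integral_cmult)
  finally show ?thesis by (simp only: mult.commute)
qed

text \<open>Frullani's integrand, which over s > 0 integrates to ln (R^2 / d^2). The subtracted
  exponential gives convergence at s = 0 and does not depend on d, so it drops out of the energy of
  a difference of probability measures.\<close>

definition frullani_kernel :: "real \<Rightarrow> real \<Rightarrow> real \<Rightarrow> real" where
  "frullani_kernel R s d = (exp (- s * d\<^sup>2) - exp (- s * R\<^sup>2)) / s"

lemma frullani_kernel_measurable[measurable]:
  "(\<lambda>x. frullani_kernel R (f x) (g x)) \<in> borel_measurable M"
  if [measurable]: "f \<in> borel_measurable M" "g \<in> borel_measurable M"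
  unfolding frullani_kernel_def by measurable

text \<open>For d > 0 the kernel is the integral of \<open>exp (- s * \<tau>)\<close> over \<tau>
  from d^2 to R^2; exchanging integrals leaves that of 1 / \<tau>. For d = 0 the integral dominates
  the one at \<open>R * exp (- m)\<close>, which is \<open>2 * m\<close>, for every m, so it is
  infinite.\<close>

lemma nn_integral_frullani:
  assumes d: "0 \<le> d" "d \<le> R" "R > 0"
  shows "(\<integral>\<^sup>+ s. ennreal (frullani_kernel R s d) * indicator {0<..} s \<partial>lborel) = 2 * log_kernel R d"
proof -
  let ?J = "\<lambda>d. \<integral>\<^sup>+ s. ennreal (frullani_kernel R s d) * indicator {0<..} s \<partial>lborel"
  have pos: "?J d = ennreal (2 * ln (R / d))"
    if d: "0 < d" "d \<le> R" for d
  proof -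
    have "?J d
      = (\<integral>\<^sup>+ s. (\<integral>\<^sup>+ \<tau>. ennreal (exp (- s * \<tau>)) * indicator {d\<^sup>2..R\<^sup>2} \<tau> * indicator {0<..} s \<partial>lborel) \<partial>lborel)"
    proof (intro nn_integral_cong)
      fix s :: real
      show "ennreal (frullani_kernel R s d) * indicator {0<..} s = (\<integral>\<^sup>+ \<tau>. ennreal (exp (- s * \<tau>)) * indicator {d\<^sup>2..R\<^sup>2} \<tau> * indicator {0<..} s \<partial>lborel)"
      proof (cases "s > 0")
        case True
        have "(\<integral>\<^sup>+ \<tau>. ennreal (exp (- s * \<tau>)) * indicator {d\<^sup>2..R\<^sup>2} \<tau> \<partial>lborel) = ennreal (- exp (- s * R\<^sup>2) / s - (- exp (- s * d\<^sup>2) / s))"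
          by (rule nn_integral_FTC_Icc) (use True d in \<open>auto intro!: derivative_eq_intros power_mono\<close>)
        then show ?thesis using True by (simp add: frullani_kernel_def diff_divide_distrib)
      qed simp
    qed
    also have "\<dots> = (\<integral>\<^sup>+ \<tau>. (\<integral>\<^sup>+ s. ennreal (exp (- s * \<tau>)) * indicator {d\<^sup>2..R\<^sup>2} \<tau> * indicator {0<..} s \<partial>lborel) \<partial>lborel)"
      by (rule lborel_pair.Fubini') measurable
    also have "\<dots> = (\<integral>\<^sup>+ \<tau>. ennreal (1 / \<tau>) * indicator {d\<^sup>2..R\<^sup>2} \<tau> \<partial>lborel)"
    proof (intro nn_integral_cong)
      fix \<tau> :: real
      show "(\<integral>\<^sup>+ s. ennreal (exp (- s * \<tau>)) * indicator {d\<^sup>2..R\<^sup>2} \<tau> * indicator {0<..} s \<partial>lborel) = ennreal (1 / \<tau>) * indicator {d\<^sup>2..R\<^sup>2} \<tau>"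
      proof (cases "\<tau> \<in> {d\<^sup>2..R\<^sup>2}")
        case True
        then have \<tau>: "\<tau> > 0" using d by (meson atLeastAtMost_iff less_le_trans zero_less_power)
        have "(\<integral>\<^sup>+ s. ennreal (exp (- s * \<tau>)) * indicator {0<..} s \<partial>lborel)
           = (\<integral>\<^sup>+ s. ennreal (1 / \<tau>) * (ennreal (\<tau> * exp (- \<tau> * s)) * indicator {0..} s) \<partial>lborel)"
        proof (rule nn_integral_cong_AE)
          have e: "ennreal (exp (- s * \<tau>)) = ennreal (1 / \<tau>) * ennreal (\<tau> * exp (- \<tau> * s))" for s
            using \<tau> by (subst ennreal_mult[symmetric]) (simp_all add: mult.commute)
          show "AE s in lborel. ennreal (exp (- s * \<tau>)) * indicator {0<..} s = ennreal (1 / \<tau>) * (ennreal (\<tau> * exp (- \<tau> * s)) * indicator {0..} s)"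
            using AE_lborel_singleton[of "0::real"]
            by eventually_elim (simp only: e, simp add: indicator_def mult.assoc)
        qed
        also have "\<dots> = ennreal (1 / \<tau>)"
          using nn_integral_exp_neg[OF \<tau>, of 0] by (simp add: nn_integral_cmult)
        finally show ?thesis using True by simp
      qed simp
    qed
    also have "\<dots> = ennreal (ln (R\<^sup>2) - ln (d\<^sup>2))"
    proof (rule nn_integral_FTC_Icc)
      fix \<tau> :: real assume "\<tau> \<in> {d\<^sup>2..R\<^sup>2}"
      moreover have "0 < d\<^sup>2" using d by simp
      ultimately have "\<tau> > 0" by (meson atLeastAtMost_iff less_le_trans)
      then show "DERIV ln \<tau> :> 1 / \<tau>" "0 \<le> 1 / \<tau>" by (auto intro!: derivative_eq_intros)
    qed (use d in \<open>auto intro!: power_mono\<close>)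
    also have "ln (R\<^sup>2) - ln (d\<^sup>2) = 2 * ln (R / d)" using d by (simp add: ln_div ln_realpow)
    finally show ?thesis .
  qed
  show ?thesis
  proof (cases "d = 0")
    case False
    then show ?thesis using pos[of d] d by (simp add: log_kernel_def ennreal_mult')
  next
    case True
    have "ennreal (2 * m) \<le> ?J 0" if "m \<ge> 0" for m
    proof -
      define d' where "d' = R * exp (- m)"
      have d': "0 < d'" "d' \<le> R" using d that by (auto simp: d'_def)
      have "ln (R / d') = m" using d by (simp add: d'_def exp_minus inverse_eq_divide)
      then have "ennreal (2 * m) = ?J d'"
        using pos[OF d'] by simp
      also have "\<dots> \<le> ?J 0"
        by (intro nn_integral_mono) (auto simp: frullani_kernel_def indicator_def intro!: ennreal_leI divide_right_mono)
      finally show ?thesis .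
    qed
    note lower = this
    have "?J 0 = \<top>"
    proof (cases "?J 0")
      case (real r)
      then have "ennreal (2 * (r + 1)) \<le> ennreal r" using lower[of "r + 1"] by simp
      then have "2 * (r + 1) \<le> r" using real(1) by (subst (asm) ennreal_le_iff) auto
      then show ?thesis using real(1) by simp
    qed simp
    then show ?thesis using True by (simp add: log_kernel_def ennreal_mult_top)
  qed
qed


section \<open>Energies as integrals of Gaussian smoothings\<close>

text \<open>The exponent is doubled so that, by \<open>gaussian_convolution\<close>, the product of
  two such smoothings integrates to a multiple of \<open>gauss_form\<close> at s.\<close>

definition gauss_mass :: "complex measure \<Rightarrow> real \<Rightarrow> complex \<Rightarrow> ennreal" where
  "gauss_mass \<mu> s u = (\<integral>\<^sup>+ x. ennreal (exp (- (2 * s) * (dist u x)\<^sup>2)) \<partial>\<mu>)"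

definition gauss_form :: "complex measure \<Rightarrow> complex measure \<Rightarrow> real \<Rightarrow> ennreal" where
  "gauss_form \<mu> \<nu> s = (\<integral>\<^sup>+ x. (\<integral>\<^sup>+ y. ennreal (exp (- s * (dist x y)\<^sup>2)) \<partial>\<nu>) \<partial>\<mu>)"

lemma gauss_mass_measurable:
  assumes "finite_measure \<mu>" and [measurable_cong]: "sets \<mu> = sets borel"
    and [measurable]: "f \<in> borel_measurable M" "g \<in> borel_measurable M"
  shows "(\<lambda>x. gauss_mass \<mu> (f x) (g x)) \<in> borel_measurable M"
proof -
  interpret finite_measure \<mu> by fact
  show ?thesis unfolding gauss_mass_def by measurable
qed

lemma gauss_form_eq:
  assumes fin: "finite_measure \<mu>" "finite_measure \<nu>" and s[measurable_cong]: "sets \<mu> = sets borel" "sets \<nu> = sets borel"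
    and s0: "s > 0"
  shows "ennreal (pi / (4 * s)) * gauss_form \<mu> \<nu> s = (\<integral>\<^sup>+ u. gauss_mass \<mu> s u * gauss_mass \<nu> s u \<partial>lborel)"
proof -
  interpret m: finite_measure \<mu> by fact
  interpret n: finite_measure \<nu> by fact
  interpret p: pair_sigma_finite \<nu> lborel by standard
  interpret q: pair_sigma_finite \<mu> lborel by standard
  let ?e = "\<lambda>u x. ennreal (exp (- (2 * s) * (dist u x)\<^sup>2))"
  have "ennreal (pi / (4 * s)) * gauss_form \<mu> \<nu> s
     = (\<integral>\<^sup>+ x. (\<integral>\<^sup>+ y. ennreal (pi / (4 * s)) * ennreal (exp (- s * (dist x y)\<^sup>2)) \<partial>\<nu>) \<partial>\<mu>)"
    unfolding gauss_form_def by (simp add: nn_integral_cmult)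
  also have "\<dots> = (\<integral>\<^sup>+ x. (\<integral>\<^sup>+ y. (\<integral>\<^sup>+ u. ?e u x * ?e u y \<partial>lborel) \<partial>\<nu>) \<partial>\<mu>)"
    by (simp only: gaussian_convolution[OF s0])
  also have "\<dots> = (\<integral>\<^sup>+ x. (\<integral>\<^sup>+ u. (\<integral>\<^sup>+ y. ?e u x * ?e u y \<partial>\<nu>) \<partial>lborel) \<partial>\<mu>)"
    by (intro nn_integral_cong p.Fubini'[symmetric]) measurable
  also have "\<dots> = (\<integral>\<^sup>+ x. (\<integral>\<^sup>+ u. ?e u x * gauss_mass \<nu> s u \<partial>lborel) \<partial>\<mu>)"
    unfolding gauss_mass_def by (intro nn_integral_cong nn_integral_cmult) measurable
  also have "\<dots> = (\<integral>\<^sup>+ u. (\<integral>\<^sup>+ x. ?e u x * gauss_mass \<nu> s u \<partial>\<mu>) \<partial>lborel)"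
  proof (rule q.Fubini'[symmetric])
    note [measurable] = gauss_mass_measurable[OF fin(2) s(2)]
    show "(\<lambda>(x, u). ?e u x * gauss_mass \<nu> s u) \<in> borel_measurable (\<mu> \<Otimes>\<^sub>M lborel)" by measurable
  qed
  also have "\<dots> = (\<integral>\<^sup>+ u. gauss_mass \<mu> s u * gauss_mass \<nu> s u \<partial>lborel)"
    unfolding gauss_mass_def by (intro nn_integral_cong nn_integral_multc) measurable
  finally show ?thesis .
qed

lemma gauss_mass_le:
  assumes "prob_space \<mu>" "s > 0"
  shows "gauss_mass \<mu> s u \<le> 1"
proof -
  interpret prob_space \<mu> by fact
  have "gauss_mass \<mu> s u \<le> (\<integral>\<^sup>+ x. 1 \<partial>\<mu>)"
    unfolding gauss_mass_def using assms by (intro nn_integral_mono) (simp add: ennreal_le_1)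
  then show ?thesis by (simp add: emeasure_space_1)
qed

text \<open>Frullani's formula turns mutual energy into an integral over scales s, with
  \<open>B s\<close> the energy for the Frullani kernel. The subtracted exponential reappears as a
  summand on the left, as values are in \<open>ennreal\<close>; since both measures have mass one it
  is the same for every pair.\<close>

lemma energy_eq_gauss:
  assumes pr: "prob_space \<mu>" "prob_space \<nu>" and s[measurable_cong]: "sets \<mu> = sets borel" "sets \<nu> = sets borel"
    and R: "R > 0" and le: "AE x in \<mu>. AE y in \<nu>. dist x y \<le> R"
  obtains B where "B \<in> borel_measurable borel"
    and "\<And>s. s > 0 \<Longrightarrow> B s + ennreal (exp (- s * R\<^sup>2) / s) = ennreal (1 / s) * gauss_form \<mu> \<nu> s"
    and "2 * (\<integral>\<^sup>+ x. (\<integral>\<^sup>+ y. log_kernel R (dist x y) \<partial>\<nu>) \<partial>\<mu>) = (\<integral>\<^sup>+ s. B s * indicator {0<..} s \<partial>lborel)"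
proof
  let ?k = "\<lambda>s x y. ennreal (frullani_kernel R s (dist x y))"
  let ?c = "\<lambda>s. ennreal (exp (- s * R\<^sup>2) / s)"
  let ?g = "\<lambda>s x y. ennreal (1 / s) * ennreal (exp (- s * (dist x y)\<^sup>2))"
  interpret m: prob_space \<mu> by fact
  interpret n: prob_space \<nu> by fact
  interpret p: pair_sigma_finite \<nu> lborel by standard
  interpret q: pair_sigma_finite \<mu> lborel by standard
  define B where "B s = (\<integral>\<^sup>+ x. (\<integral>\<^sup>+ y. ?k s x y \<partial>\<nu>) \<partial>\<mu>)" for s
  show [measurable]: "B \<in> borel_measurable borel" unfolding B_def[abs_def] by measurable
  show "B s + ?c s = ennreal (1 / s) * gauss_form \<mu> \<nu> s" if s: "s > 0" for s
  proof -
    have c: "(\<integral>\<^sup>+ x. (\<integral>\<^sup>+ y. ?c s \<partial>\<nu>) \<partial>\<mu>) = ?c s"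
      by (simp add: m.emeasure_space_1 n.emeasure_space_1)
    have "B s + ?c s
        = (\<integral>\<^sup>+ x. (\<integral>\<^sup>+ y. ?k s x y + ?c s \<partial>\<nu>) \<partial>\<mu>)"
      unfolding B_def by (subst c[symmetric]) (simp add: nn_integral_add)
    also have "\<dots> = (\<integral>\<^sup>+ x. (\<integral>\<^sup>+ y. ?g s x y \<partial>\<nu>) \<partial>\<mu>)"
    proof (rule nn_integral_cong_AE)
      show "AE x in \<mu>. (\<integral>\<^sup>+ y. ?k s x y + ?c s \<partial>\<nu>)
        = (\<integral>\<^sup>+ y. ?g s x y \<partial>\<nu>)"
        using le
      proof eventually_elim
        case (elim x)
        show ?case
        proof (rule nn_integral_cong_AE)
          show "AE y in \<nu>. ?k s x y + ?c s
              = ?g s x y"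
            using elim
          proof eventually_elim
            case (elim y)
            have "exp (- s * R\<^sup>2) \<le> exp (- s * (dist x y)\<^sup>2)"
              using elim s by (simp add: power_mono)
            then have "0 \<le> frullani_kernel R s (dist x y)" using s by (simp add: frullani_kernel_def)
            then have "?k s x y + ?c s
                = ennreal (frullani_kernel R s (dist x y) + exp (- s * R\<^sup>2) / s)"
              using s by (intro ennreal_plus[symmetric]) auto
            also have "frullani_kernel R s (dist x y) + exp (- s * R\<^sup>2) / s = 1 / s * exp (- s * (dist x y)\<^sup>2)"
              by (simp add: frullani_kernel_def diff_divide_distrib)
            also have "ennreal \<dots> = ?g s x y"
              using s by (intro ennreal_mult) auto
            finally show ?case .
          qed
        qed
      qed
    qed
    also have "\<dots> = ennreal (1 / s) * gauss_form \<mu> \<nu> s"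
      unfolding gauss_form_def by (simp add: nn_integral_cmult)
    finally show ?thesis .
  qed
  have "2 * (\<integral>\<^sup>+ x. (\<integral>\<^sup>+ y. log_kernel R (dist x y) \<partial>\<nu>) \<partial>\<mu>)
      = (\<integral>\<^sup>+ x. (\<integral>\<^sup>+ y. 2 * log_kernel R (dist x y) \<partial>\<nu>) \<partial>\<mu>)"
    by (simp add: nn_integral_cmult)
  also have "\<dots> = (\<integral>\<^sup>+ x. (\<integral>\<^sup>+ y. (\<integral>\<^sup>+ s. ?k s x y * indicator {0<..} s \<partial>lborel) \<partial>\<nu>) \<partial>\<mu>)"
  proof (rule nn_integral_cong_AE)
    show "AE x in \<mu>. (\<integral>\<^sup>+ y. 2 * log_kernel R (dist x y) \<partial>\<nu>)
        = (\<integral>\<^sup>+ y. (\<integral>\<^sup>+ s. ?k s x y * indicator {0<..} s \<partial>lborel) \<partial>\<nu>)"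
      using le
    proof eventually_elim
      case (elim x)
      then show ?case using R
        by (intro nn_integral_cong_AE) (auto elim!: eventually_mono simp: nn_integral_frullani)
    qed
  qed
  also have "\<dots> = (\<integral>\<^sup>+ x. (\<integral>\<^sup>+ s. (\<integral>\<^sup>+ y. ?k s x y * indicator {0<..} s \<partial>\<nu>) \<partial>lborel) \<partial>\<mu>)"
    by (intro nn_integral_cong p.Fubini'[symmetric]) measurable
  also have "\<dots> = (\<integral>\<^sup>+ s. (\<integral>\<^sup>+ x. (\<integral>\<^sup>+ y. ?k s x y * indicator {0<..} s \<partial>\<nu>) \<partial>\<mu>) \<partial>lborel)"
    by (intro q.Fubini'[symmetric]) measurable
  also have "\<dots> = (\<integral>\<^sup>+ s. B s * indicator {0<..} s \<partial>lborel)"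
    unfolding B_def by (simp add: nn_integral_multc)
  finally show "2 * (\<integral>\<^sup>+ x. (\<integral>\<^sup>+ y. log_kernel R (dist x y) \<partial>\<nu>) \<partial>\<mu>) = (\<integral>\<^sup>+ s. B s * indicator {0<..} s \<partial>lborel)" .
qed

lemma energy_eq: "energy R \<mu> \<nu> = (\<integral>\<^sup>+ x. (\<integral>\<^sup>+ y. log_kernel R (dist x y) \<partial>\<mu>) \<partial>\<nu>)"
  by (simp add: energy_def pot_def)

text \<open>The energy of \<open>\<mu> - \<nu>\<close> is up to a factor the integral over \<open>s\<close> of the squared \<open>L\<^sup>2\<close> norms of its Gaussian
  smoothings, and the hypotheses force it to vanish.\<close>

lemma eq_of_energy_le:
  assumes pr: "prob_space \<mu>" "prob_space \<nu>" and s: "sets \<mu> = sets borel" "sets \<nu> = sets borel"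
    and R: "R > 0" and K: "AE x in \<mu>. x \<in> K" "AE x in \<nu>. x \<in> K" "\<And>x y. x \<in> K \<Longrightarrow> y \<in> K \<Longrightarrow> dist x y \<le> R"
    and fin: "energy R \<mu> \<mu> < \<top>" "energy R \<nu> \<nu> < \<top>"
    and ge: "energy R \<mu> \<mu> \<le> energy R \<mu> \<nu>" "energy R \<nu> \<nu> \<le> energy R \<mu> \<nu>"
  shows "\<mu> = \<nu>"
proof -
  let ?c = "\<lambda>s. ennreal (exp (- s * R\<^sup>2) / s)"
  interpret m: prob_space \<mu> by fact
  interpret n: prob_space \<nu> by fact
  have fm: "finite_measure \<mu>" "finite_measure \<nu>" by unfold_locales
  have leR: "AE x in M. AE y in N. dist x y \<le> R"
    if "AE x in M. x \<in> K" "AE y in N. y \<in> K" for M N :: "complex measure"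
    using that(1) by eventually_elim (use that(2) K(3) in \<open>auto elim!: eventually_mono\<close>)
  obtain B1 where B1: "B1 \<in> borel_measurable borel"
      "\<And>s. s > 0 \<Longrightarrow> B1 s + ?c s = ennreal (1 / s) * gauss_form \<mu> \<mu> s"
      "2 * energy R \<mu> \<mu> = (\<integral>\<^sup>+ s. B1 s * indicator {0<..} s \<partial>lborel)"
    unfolding energy_eq using energy_eq_gauss[OF pr(1,1) s(1,1) R leR[OF K(1,1)]] by blast
  obtain B2 where B2: "B2 \<in> borel_measurable borel"
      "\<And>s. s > 0 \<Longrightarrow> B2 s + ?c s = ennreal (1 / s) * gauss_form \<nu> \<nu> s"
      "2 * energy R \<nu> \<nu> = (\<integral>\<^sup>+ s. B2 s * indicator {0<..} s \<partial>lborel)"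
    unfolding energy_eq using energy_eq_gauss[OF pr(2,2) s(2,2) R leR[OF K(2,2)]] by blast
  obtain B3 where B3: "B3 \<in> borel_measurable borel"
      "\<And>s. s > 0 \<Longrightarrow> B3 s + ?c s = ennreal (1 / s) * gauss_form \<nu> \<mu> s"
      "2 * energy R \<mu> \<nu> = (\<integral>\<^sup>+ s. B3 s * indicator {0<..} s \<partial>lborel)"
    unfolding energy_eq using energy_eq_gauss[OF pr(2,1) s(2,1) R leR[OF K(2,1)]] by blast
  note [measurable] = B1(1) B2(1) B3(1) gauss_mass_measurable[OF fm(1) s(1)] gauss_mass_measurable[OF fm(2) s(2)]
  define D where "D s u = ennreal ((enn2real (gauss_mass \<mu> s u) - enn2real (gauss_mass \<nu> s u))\<^sup>2)" for s u
  have D_meas[measurable]: "(\<lambda>(s, u). D s u) \<in> borel_measurable (borel \<Otimes>\<^sub>M borel)"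
    unfolding D_def by measurable
  \<comment> \<open>The factor \<open>4 / pi\<close> reduces the \<open>pi / (4 * s)\<close> of
    \<open>gauss_form_eq\<close> to \<open>1 / s\<close>.\<close>
  define Q where "Q s = ennreal (4 / pi) * (\<integral>\<^sup>+ u. D s u \<partial>lborel)" for s
  have Q_meas[measurable]: "Q \<in> borel_measurable borel" unfolding Q_def[abs_def] by measurable
  \<comment> \<open>Pointwise this is a^2 + b^2 = 2 a b + (a - b)^2 for the two smoothings, which
    are at most 1. The Frullani corrections occur twice on either side and cancel because they are
    finite.\<close>
  have B: "B1 s + B2 s = 2 * B3 s + Q s" if s0: "s > 0" for s
  proof -
    note GF = gauss_form_eq[OF fm(1,1) s(1,1) s0] gauss_form_eq[OF fm(2,2) s(2,2) s0] gauss_form_eq[OF fm(2,1) s(2,1) s0]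
    have pt: "gauss_mass \<mu> s u * gauss_mass \<mu> s u + gauss_mass \<nu> s u * gauss_mass \<nu> s u
        = 2 * (gauss_mass \<nu> s u * gauss_mass \<mu> s u) + D s u" for u
    proof -
      have "gauss_mass \<mu> s u < \<top>" "gauss_mass \<nu> s u < \<top>"
        using gauss_mass_le[OF pr(1) s0, of u] gauss_mass_le[OF pr(2) s0, of u] by (auto intro: le_less_trans)
      then obtain a b where ab: "gauss_mass \<mu> s u = ennreal a" "gauss_mass \<nu> s u = ennreal b" "a \<ge> 0" "b \<ge> 0"
        by (metis ennreal_cases less_irrefl)
      have "2 * (ennreal b * ennreal a) = ennreal (2 * (b * a))" using ab by (simp add: ennreal_mult)
      moreover have "ennreal a * ennreal a + ennreal b * ennreal b = ennreal (a * a + b * b)"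
        using ab by (simp add: ennreal_mult)
      moreover have "ennreal (2 * (b * a)) + ennreal ((a - b)\<^sup>2) = ennreal (2 * (b * a) + (a - b)\<^sup>2)"
        using ab by (intro ennreal_plus[symmetric]) auto
      moreover have "2 * (b * a) + (a - b)\<^sup>2 = a * a + b * b" by (simp add: power2_eq_square algebra_simps)
      ultimately show ?thesis using ab by (simp add: D_def)
    qed
    define c where "c = ennreal (pi / (4 * s))"
    have "c * gauss_form \<mu> \<mu> s + c * gauss_form \<nu> \<nu> s
      = (\<integral>\<^sup>+ u. gauss_mass \<mu> s u * gauss_mass \<mu> s u + gauss_mass \<nu> s u * gauss_mass \<nu> s u \<partial>lborel)"
      unfolding c_def GF by (rule nn_integral_add[symmetric]) measurable
    also have "\<dots> = 2 * (c * gauss_form \<nu> \<mu> s) + (\<integral>\<^sup>+ u. D s u \<partial>lborel)"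
      unfolding c_def GF pt by (simp add: nn_integral_add nn_integral_cmult)
    finally have c_eq: "c * gauss_form \<mu> \<mu> s + c * gauss_form \<nu> \<nu> s = 2 * (c * gauss_form \<nu> \<mu> s) + (\<integral>\<^sup>+ u. D s u \<partial>lborel)" .
    have c1: "ennreal (4 / pi) * c = ennreal (1 / s)"
      unfolding c_def using s0 by (subst ennreal_mult[symmetric]) auto
    have "ennreal (1 / s) * gauss_form \<mu> \<mu> s + ennreal (1 / s) * gauss_form \<nu> \<nu> s
        = ennreal (4 / pi) * (c * gauss_form \<mu> \<mu> s + c * gauss_form \<nu> \<nu> s)"
      by (simp only: c1[symmetric] distrib_left mult.assoc)
    also have "\<dots> = 2 * (ennreal (1 / s) * gauss_form \<nu> \<mu> s) + Q s"
      unfolding c_eq Q_def by (simp only: c1[symmetric] distrib_left mult_ac)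
    finally have "(B1 s + ?c s) + (B2 s + ?c s)
       = 2 * (B3 s + ?c s) + Q s"
      using B1(2)[OF s0] B2(2)[OF s0] B3(2)[OF s0] by simp
    then have "2 * ?c s + (B1 s + B2 s) = 2 * ?c s + (2 * B3 s + Q s)"
      by (simp add: algebra_simps mult_2)
    then show ?thesis by (simp add: ennreal_mult_eq_top_iff ennreal_add_left_cancel)
  qed
  have "2 * energy R \<mu> \<mu> + 2 * energy R \<nu> \<nu> = (\<integral>\<^sup>+ s. (B1 s + B2 s) * indicator {0<..} s \<partial>lborel)"
    unfolding B1(3) B2(3) by (subst nn_integral_add[symmetric]) (auto simp: distrib_right)
  also have "\<dots> = (\<integral>\<^sup>+ s. 2 * (B3 s * indicator {0<..} s) + Q s * indicator {0<..} s \<partial>lborel)"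
    by (intro nn_integral_cong) (auto simp: B indicator_def)
  also have "\<dots> = 2 * (2 * energy R \<mu> \<nu>) + (\<integral>\<^sup>+ s. Q s * indicator {0<..} s \<partial>lborel)"
    unfolding B3(3) by (simp add: nn_integral_add nn_integral_cmult)
  finally have eq: "2 * energy R \<mu> \<mu> + 2 * energy R \<nu> \<nu> = 2 * (2 * energy R \<mu> \<nu>) + (\<integral>\<^sup>+ s. Q s * indicator {0<..} s \<partial>lborel)" .
  have "(\<integral>\<^sup>+ s. Q s * indicator {0<..} s \<partial>lborel) = 0"
  proof -
    have "2 * energy R \<mu> \<mu> + 2 * energy R \<nu> \<nu> \<le> 2 * energy R \<mu> \<nu> + 2 * energy R \<mu> \<nu>"
      by (intro add_mono mult_left_mono ge) auto
    also have "\<dots> = 2 * (2 * energy R \<mu> \<nu>)" by (simp only: mult_2)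
    finally have "2 * (2 * energy R \<mu> \<nu>) + (\<integral>\<^sup>+ s. Q s * indicator {0<..} s \<partial>lborel) \<le> 2 * (2 * energy R \<mu> \<nu>) + 0"
      unfolding eq by simp
    moreover have "2 * energy R \<mu> \<mu> + 2 * energy R \<nu> \<nu> < \<top>" using fin by (simp add: ennreal_mult_less_top)
    then have "2 * (2 * energy R \<mu> \<nu>) \<noteq> \<top>" unfolding eq by auto
    ultimately show ?thesis by (simp only: ennreal_add_left_cancel_le) simp
  qed
  then have "AE s in lborel. Q s * indicator {0<..} s = 0"
    by (subst (asm) nn_integral_0_iff_AE) auto
  then have AE_Q: "AE s in lborel. s > 0 \<longrightarrow> (AE u in lborel. gauss_mass \<mu> s u = gauss_mass \<nu> s u)"
  proof eventually_elim
    case (elim s)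
    show ?case
    proof
      assume s0: "s > 0"
      then have "(\<integral>\<^sup>+ u. D s u \<partial>lborel) = 0" using elim by (auto simp: Q_def)
      then have "AE u in lborel. D s u = 0" by (subst (asm) nn_integral_0_iff_AE) measurable
      then show "AE u in lborel. gauss_mass \<mu> s u = gauss_mass \<nu> s u"
      proof eventually_elim
        case (elim u)
        then have "enn2real (gauss_mass \<mu> s u) = enn2real (gauss_mass \<nu> s u)"
          by (simp add: D_def ennreal_eq_0_iff)
        moreover have "gauss_mass \<mu> s u < \<top>" "gauss_mass \<nu> s u < \<top>"
          using gauss_mass_le[OF pr(1) s0, of u] gauss_mass_le[OF pr(2) s0, of u] by (auto intro: le_less_trans)
        ultimately show ?case by (metis ennreal_enn2real)
      qed
    qed
  qed
  \<comment> \<open>The smoothings are known to agree only for almost every s; each interval (n, n +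
    1) has positive measure and so contains a good scale.\<close>
  have "\<exists>s. s > real n \<and> (AE u in lborel. gauss_mass \<mu> s u = gauss_mass \<nu> s u)" for n
  proof (rule ccontr)
    assume *: "\<nexists>s. s > real n \<and> (AE u in lborel. gauss_mass \<mu> s u = gauss_mass \<nu> s u)"
    have "AE s in lborel. s \<notin> {real n<..<real n + 1}"
      using AE_Q by eventually_elim (use * in force)
    then have "emeasure lborel {real n<..<real n + 1} = 0"
      by (subst (asm) AE_iff_measurable[where N="{real n<..<real n + 1}"]) auto
    then show False by simp
  qed
  then obtain \<sigma> where \<sigma>: "\<And>n. \<sigma> n > real n" "\<And>n. AE u in lborel. gauss_mass \<mu> (\<sigma> n) u = gauss_mass \<nu> (\<sigma> n) u"
    by metis
  have \<sigma>0: "\<sigma> n > 0" for n using \<sigma>(1)[of n] by (meson le_less_trans of_nat_0_le_iff)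
  \<comment> \<open>For |u| > d half of the exponent already yields the factor exp (- \<sigma> d^2).
    The other half integrates to \<open>pi / \<sigma> n\<close>, twice the total mass, whence the
    factor 2 in the tail.\<close>
  interpret approximate_identity "\<lambda>n d. ennreal (exp (- (2 * \<sigma> n) * d\<^sup>2))" "\<lambda>n. pi / (2 * \<sigma> n)" "\<lambda>d n. 2 * exp (- \<sigma> n * d\<^sup>2)"
  proof
    fix n show "0 < pi / (2 * \<sigma> n)" using \<sigma>0[of n] by simp
    show "(\<integral>\<^sup>+ u. ennreal (exp (- (2 * \<sigma> n) * (norm (u::complex))\<^sup>2)) \<partial>lborel) = ennreal (pi / (2 * \<sigma> n))"
      using \<sigma>0[of n] by (intro nn_integral_gaussian) simp
    fix d :: real assume d: "d > 0"
    have "(\<integral>\<^sup>+ u. ennreal (exp (- (2 * \<sigma> n) * (norm (u::complex))\<^sup>2)) * indicator {d<..} (norm u) \<partial>lborel)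
        \<le> (\<integral>\<^sup>+ u. ennreal (exp (- \<sigma> n * d\<^sup>2)) * ennreal (exp (- \<sigma> n * (norm (u::complex))\<^sup>2)) \<partial>lborel)"
    proof (rule nn_integral_mono)
      fix u :: complex
      show "ennreal (exp (- (2 * \<sigma> n) * (norm u)\<^sup>2)) * indicator {d<..} (norm u)
          \<le> ennreal (exp (- \<sigma> n * d\<^sup>2)) * ennreal (exp (- \<sigma> n * (norm u)\<^sup>2))"
      proof (cases "norm u > d")
        case True
        then have "\<sigma> n * d\<^sup>2 \<le> \<sigma> n * (norm u)\<^sup>2"
          using d \<sigma>0[of n] by (intro mult_left_mono power_mono) auto
        then have "exp (- (2 * \<sigma> n) * (norm u)\<^sup>2) \<le> exp (- \<sigma> n * d\<^sup>2 + - \<sigma> n * (norm u)\<^sup>2)"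
          by simp
        then show ?thesis using True by (simp only: exp_add ennreal_mult[symmetric] exp_ge_zero) (simp add: ennreal_leI)
      qed simp
    qed
    also have "\<dots> = ennreal (exp (- \<sigma> n * d\<^sup>2)) * ennreal (pi / \<sigma> n)"
      using nn_integral_gaussian[OF \<sigma>0[of n]] by (simp add: nn_integral_cmult)
    also have "\<dots> = ennreal (2 * exp (- \<sigma> n * d\<^sup>2) * (pi / (2 * \<sigma> n)))"
      using \<sigma>0[of n] by (subst ennreal_mult[symmetric]) auto
    finally show "(\<integral>\<^sup>+ u. ennreal (exp (- (2 * \<sigma> n) * (norm (u::complex))\<^sup>2)) * indicator {d<..} (norm u) \<partial>lborel)
        \<le> ennreal (2 * exp (- \<sigma> n * d\<^sup>2) * (pi / (2 * \<sigma> n)))" .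
  next
    fix d :: real assume d: "d > 0"
    have "filterlim \<sigma> at_top sequentially"
      using \<sigma>(1) by (intro filterlim_at_top_mono[OF filterlim_real_sequentially]) (auto intro: always_eventually less_imp_le)
    moreover have "((\<lambda>x. 2 * exp (- x * d\<^sup>2)) \<longlongrightarrow> 0) at_top" using d by real_asymp
    ultimately show "(\<lambda>n. 2 * exp (- \<sigma> n * d\<^sup>2)) \<longlonglongrightarrow> 0" by (rule filterlim_compose[rotated])
  qed auto
  show ?thesis
    by (rule measure_eq[OF fm s]) (use \<sigma>(2) in \<open>simp add: gauss_mass_def\<close>)
qed

section \<open>Uniqueness of the equilibrium measure\<close>

context
  fixes N :: "'i \<Rightarrow> 'a measure" and B :: "'a measure" and p :: "'i pmf"
  assumes pr: "\<And>i. prob_space (N i)" and s: "\<And>i. sets (N i) = sets B"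
begin

lemma measurable_pmf_kernel: "N \<in> measure_pmf p \<rightarrow>\<^sub>M subprob_algebra B"
  using pr s by (intro measurable_prob_algebraD) (auto simp: space_prob_algebra)

lemma sets_bind_pmf_kernel: "sets (measure_pmf p \<bind> N) = sets B"
  by (rule sets_bind[where M="measure_pmf p"]) (auto simp: s)

lemma prob_space_bind_pmf_kernel: "prob_space (measure_pmf p \<bind> N)"
  by (rule prob_space.prob_space_bind[OF prob_space_measure_pmf _ measurable_pmf_kernel]) (use pr in auto)

lemma nn_integral_bind_pmf_kernel:
  assumes "f \<in> borel_measurable B"
  shows "(\<integral>\<^sup>+ x. f x \<partial>(measure_pmf p \<bind> N)) = (\<integral>\<^sup>+ i. (\<integral>\<^sup>+ x. f x \<partial>N i) \<partial>measure_pmf p)"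
  by (rule nn_integral_bind[OF assms measurable_pmf_kernel])

end

text \<open>The weight \<open>t\<close> goes to the first measure. As a bind over a discrete
  distribution it shares its mass and integration rules with the countable combination that is used
  as a barrier in \<open>polar_barrier\<close>.\<close>

definition mixture :: "real \<Rightarrow> 'a measure \<Rightarrow> 'a measure \<Rightarrow> 'a measure" where
  "mixture t \<mu> \<nu> = measure_pmf (bernoulli_pmf t) \<bind> (\<lambda>b. if b then \<mu> else \<nu>)"

context
  fixes \<mu> \<nu> B :: "'a measure" and t :: real
  assumes pr: "prob_space \<mu>" "prob_space \<nu>" and s: "sets \<mu> = sets B" "sets \<nu> = sets B"
begin

lemma sets_mixture: "sets (mixture t \<mu> \<nu>) = sets B"
  unfolding mixture_def using pr s by (intro sets_bind_pmf_kernel) auto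

lemma prob_space_mixture: "prob_space (mixture t \<mu> \<nu>)"
  unfolding mixture_def using pr s by (intro prob_space_bind_pmf_kernel[where B=B]) auto

lemma nn_integral_mixture:
  assumes "0 \<le> t" "t \<le> 1" "f \<in> borel_measurable B"
  shows "(\<integral>\<^sup>+ x. f x \<partial>mixture t \<mu> \<nu>) = ennreal t * (\<integral>\<^sup>+ x. f x \<partial>\<mu>) + ennreal (1 - t) * (\<integral>\<^sup>+ x. f x \<partial>\<nu>)"
  unfolding mixture_def using assms pr s
  by (subst nn_integral_bind_pmf_kernel[where B=B]) (auto simp: nn_integral_bernoulli_pmf mult.commute)

end

lemma pot_mixture:
  assumes "prob_space \<mu>" "prob_space \<nu>" "sets \<mu> = sets borel" "sets \<nu> = sets borel" "0 \<le> t" "t \<le> 1"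
  shows "pot R (mixture t \<mu> \<nu>) z = ennreal t * pot R \<mu> z + ennreal (1 - t) * pot R \<nu> z"
  unfolding pot_def using assms by (intro nn_integral_mixture[where B=borel]) auto

lemma borel_prob_on_mixture:
  assumes "borel_prob_on K \<mu>" "borel_prob_on K \<nu>" "closed K" "0 \<le> t" "t \<le> 1"
  shows "borel_prob_on K (mixture t \<mu> \<nu>)"
proof -
  note a = borel_prob_onD[OF assms(1,3)] and b = borel_prob_onD[OF assms(2,3)]
  note S = sets_mixture[OF a(1) b(1), of borel, OF a(3) b(3)]
  have [measurable]: "- K \<in> sets borel" using assms(3) by auto
  have "emeasure (mixture t \<mu> \<nu>) (- K) = (\<integral>\<^sup>+ x. indicator (- K) x \<partial>mixture t \<mu> \<nu>)"
    by (rule nn_integral_indicator[symmetric]) (use S in simp)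
  also have "\<dots> = ennreal t * (\<integral>\<^sup>+ x. indicator (- K) x \<partial>\<mu>) + ennreal (1 - t) * (\<integral>\<^sup>+ x. indicator (- K) x \<partial>\<nu>)"
    using assms(4,5) a b by (intro nn_integral_mixture[where B=borel]) auto
  also have "\<dots> = 0" using assms(1,2,3) a(3) b(3)
    by (subst (1 2) nn_integral_indicator) (auto simp: borel_prob_on_def)
  finally show ?thesis
    using prob_space_mixture[OF a(1) b(1), of borel, OF a(3) b(3)] S by (simp add: borel_prob_on_def)
qed

lemma energy_sym:
  assumes "finite_measure \<mu>" "finite_measure \<nu>" and [measurable_cong]: "sets \<mu> = sets borel" "sets \<nu> = sets borel"
  shows "energy R \<mu> \<nu> = energy R \<nu> \<mu>"
proof -
  interpret m: finite_measure \<mu> by fact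
  interpret n: finite_measure \<nu> by fact
  interpret p: pair_sigma_finite \<mu> \<nu> by standard
  have "energy R \<mu> \<nu> = (\<integral>\<^sup>+ z. (\<integral>\<^sup>+ w. log_kernel R (dist w z) \<partial>\<mu>) \<partial>\<nu>)"
    by (simp add: energy_def pot_def dist_commute)
  also have "\<dots> = (\<integral>\<^sup>+ w. (\<integral>\<^sup>+ z. log_kernel R (dist w z) \<partial>\<nu>) \<partial>\<mu>)"
    by (rule p.Fubini') measurable
  finally show ?thesis by (simp add: energy_def pot_def)
qed

lemma energy_mixture:
  assumes pr: "prob_space \<mu>" "prob_space \<nu>" and s: "sets \<mu> = sets borel" "sets \<nu> = sets borel"
    and t: "0 \<le> t" "t \<le> 1"
  shows "energy R (mixture t \<mu> \<nu>) (mixture t \<mu> \<nu>) =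
    ennreal (t * t) * energy R \<mu> \<mu> + ennreal (2 * t * (1 - t)) * energy R \<nu> \<mu> + ennreal ((1 - t) * (1 - t)) * energy R \<nu> \<nu>"
proof -
  interpret m: prob_space \<mu> by fact
  interpret n: prob_space \<nu> by fact
  have fm: "finite_measure \<mu>" "finite_measure \<nu>" by unfold_locales
  have 1: "energy R \<alpha> (mixture t \<mu> \<nu>) = ennreal t * energy R \<alpha> \<mu> + ennreal (1 - t) * energy R \<alpha> \<nu>"
    if "finite_measure \<alpha>" "sets \<alpha> = sets borel" for \<alpha>
    unfolding energy_def using that pr s t by (intro nn_integral_mixture[where B=borel] pot_measurable)
  interpret x: prob_space "mixture t \<mu> \<nu>" by (rule prob_space_mixture[OF pr s])
  have fx: "finite_measure (mixture t \<mu> \<nu>)" by unfold_locales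
  note sx = sets_mixture[OF pr s, of t]
  have "energy R (mixture t \<mu> \<nu>) (mixture t \<mu> \<nu>) = ennreal t * energy R \<mu> (mixture t \<mu> \<nu>) + ennreal (1 - t) * energy R \<nu> (mixture t \<mu> \<nu>)"
    by (subst 1[OF fx sx]) (simp add: energy_sym[OF fx fm(1) sx s(1)] energy_sym[OF fx fm(2) sx s(2)])
  also have "\<dots> = ennreal t * (ennreal t * energy R \<mu> \<mu> + ennreal (1 - t) * energy R \<nu> \<mu>) + ennreal (1 - t) * (ennreal t * energy R \<nu> \<mu> + ennreal (1 - t) * energy R \<nu> \<nu>)"
    by (simp only: 1[OF fm(1) s(1)] 1[OF fm(2) s(2)] energy_sym[OF fm s])
  also have "\<dots> = ennreal t * ennreal t * energy R \<mu> \<mu> + (2 * ennreal t * ennreal (1 - t)) * energy R \<nu> \<mu> + ennreal (1 - t) * ennreal (1 - t) * energy R \<nu> \<nu>"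
    by (simp add: algebra_simps mult_2 mult_2_right)
  also have "\<dots> = ennreal (t * t) * energy R \<mu> \<mu> + ennreal (2 * t * (1 - t)) * energy R \<nu> \<mu> + ennreal ((1 - t) * (1 - t)) * energy R \<nu> \<nu>"
    using t by (simp add: ennreal_mult)
  finally show ?thesis .
qed

lemma equilibrium_energy_le:
  assumes \<omega>: "equilibrium_measure K \<omega>" and K: "closed K" and R: "R > 0"
    and d: "\<And>z w. z \<in> K \<Longrightarrow> w \<in> K \<Longrightarrow> dist z w \<le> R" and \<mu>: "borel_prob_on K \<mu>"
  shows "energy R \<omega> \<omega> \<le> energy R \<mu> \<mu>"
proof -
  have "borel_prob_on K \<omega>" "log_energy \<mu> \<le> log_energy \<omega>"
    using \<omega> \<mu> by (auto simp: equilibrium_measure_def)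
  then have "ereal (ln R) - enn2ereal (energy R \<mu> \<mu>) \<le> ereal (ln R) - enn2ereal (energy R \<omega> \<omega>)"
    using log_energy_eq[OF _ K R d] \<mu> by simp
  then show ?thesis
    by (cases "energy R \<mu> \<mu>"; cases "energy R \<omega> \<omega>") (auto simp: enn2ereal_ennreal top_unique)
qed

text \<open>First variation: moving a fraction t of the mass from \<omega> to \<mu> cannot lower the
  energy. After division by t, letting t tend to 0 leaves the linear term.\<close>

lemma equilibrium_variational:
  assumes \<omega>: "equilibrium_measure K \<omega>" and K: "closed K" and R: "R > 0"
    and d: "\<And>z w. z \<in> K \<Longrightarrow> w \<in> K \<Longrightarrow> dist z w \<le> R" and \<mu>: "borel_prob_on K \<mu>"
    and fin: "energy R \<omega> \<omega> < \<top>" "energy R \<mu> \<mu> < \<top>"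
  shows "energy R \<omega> \<omega> \<le> energy R \<omega> \<mu>"
proof (cases "energy R \<omega> \<mu>")
  case (real x)
  have \<omega>': "borel_prob_on K \<omega>" using \<omega> by (auto simp: equilibrium_measure_def)
  note a = borel_prob_onD[OF \<mu> K] and b = borel_prob_onD[OF \<omega>' K]
  obtain e where e: "energy R \<omega> \<omega> = ennreal e" "e \<ge> 0" using fin(1) by (cases "energy R \<omega> \<omega>") auto
  obtain m where m: "energy R \<mu> \<mu> = ennreal m" "m \<ge> 0" using fin(2) by (cases "energy R \<mu> \<mu>") auto
  have le: "2 * e \<le> t * m + 2 * (1 - t) * x + t * e" if t: "0 < t" "t < 1" for t
  proof -
    have "ennreal e \<le> energy R (mixture t \<mu> \<omega>) (mixture t \<mu> \<omega>)"
      unfolding e(1)[symmetric] using t by (intro equilibrium_energy_le[OF \<omega> K R d] borel_prob_on_mixture \<mu> \<omega>' K) auto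
    also have "\<dots> = ennreal (t * t) * ennreal m + ennreal (2 * t * (1 - t)) * ennreal x + ennreal ((1 - t) * (1 - t)) * ennreal e"
      using energy_mixture[OF a(1) b(1) a(3) b(3), of t R] t e m real by simp
    also have "\<dots> = ennreal (t * t * m + 2 * t * (1 - t) * x + (1 - t) * (1 - t) * e)"
      using t e m real by (simp add: ennreal_mult flip: ennreal_plus ennreal_mult)
    finally have "e \<le> t * t * m + 2 * t * (1 - t) * x + (1 - t) * (1 - t) * e"
      using t e m real by (subst (asm) ennreal_le_iff) auto
    then have "t * (2 * e) \<le> t * (t * m + 2 * (1 - t) * x + t * e)" by (simp add: algebra_simps)
    then show ?thesis using t by simp
  qed
  have "2 * e \<le> 0 * m + 2 * (1 - 0) * x + 0 * e"
  proof (rule tendsto_lowerbound)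
    show "((\<lambda>t. t * m + 2 * (1 - t) * x + t * e) \<longlongrightarrow> 0 * m + 2 * (1 - 0) * x + 0 * e) (at_right 0)"
      by (intro tendsto_intros)
    have "eventually (\<lambda>t::real. 0 < t \<and> t < 1) (at_right 0)"
      using eventually_at_right_real[of 0 "1::real"] by (auto elim!: eventually_mono)
    then show "eventually (\<lambda>t. 2 * e \<le> t * m + 2 * (1 - t) * x + t * e) (at_right 0)"
      by eventually_elim (use le in auto)
  qed simp
  then show ?thesis using e real by (simp add: ennreal_leI)
qed simp

text \<open>Equal energies and the variational inequality supply both inequalities of
  \<open>eq_of_energy_le\<close>. If the minimal energy were infinite, every probability measure on
  the set would be an equilibrium measure.\<close>

lemma equilibrium_unique:
  assumes \<omega>: "equilibrium_measure K \<omega>" "equilibrium_measure K \<omega>'" and K: "closed K" and R: "R > 0"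
    and d: "\<And>z w. z \<in> K \<Longrightarrow> w \<in> K \<Longrightarrow> dist z w \<le> R" and fin: "energy R \<omega> \<omega> < \<top>"
  shows "\<omega> = \<omega>'"
proof -
  have p: "borel_prob_on K \<omega>" "borel_prob_on K \<omega>'" using \<omega> by (auto simp: equilibrium_measure_def)
  note a = borel_prob_onD[OF p(1) K] and b = borel_prob_onD[OF p(2) K]
  have e: "energy R \<omega>' \<omega>' = energy R \<omega> \<omega>"
    using equilibrium_energy_le[OF \<omega>(1) K R d p(2)] equilibrium_energy_le[OF \<omega>(2) K R d p(1)] by simp
  have "energy R \<omega> \<omega> \<le> energy R \<omega> \<omega>'"
    by (rule equilibrium_variational[OF \<omega>(1) K R d p(2)]) (use fin e in auto)
  then show ?thesis
    by (intro eq_of_energy_le[OF a(1) b(1) a(3) b(3) R a(5) b(5) d]) (use fin e in auto)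
qed

section \<open>Schoenberg's space-filling curve\<close>

definition even_dist :: "real \<Rightarrow> real" where
  "even_dist t = infdist t (range (\<lambda>n::int. 2 * of_int n))"

text \<open>Schoenberg's function of period 2: zero within 1/3 of an even integer, one beyond 2/3,
  linear between. Building it from a distance makes continuity immediate.\<close>

definition schoenberg_wave :: "real \<Rightarrow> real" where
  "schoenberg_wave t = max 0 (min 1 (3 * even_dist t - 1))"

lemma continuous_schoenberg_wave: "continuous_on A schoenberg_wave"
  unfolding schoenberg_wave_def even_dist_def by (intro continuous_intros)

lemma schoenberg_wave_bounds: "0 \<le> schoenberg_wave t" "schoenberg_wave t \<le> 1"
  by (auto simp: schoenberg_wave_def)

lemma schoenberg_wave_0:
  assumes "0 \<le> u" "u \<le> 1/3"
  shows "schoenberg_wave (2 * of_int n + u) = 0"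
proof -
  have "even_dist (2 * of_int n + u) \<le> dist (2 * of_int n + u) (2 * of_int n)"
    unfolding even_dist_def by (rule infdist_le) auto
  then show ?thesis using assms by (simp add: schoenberg_wave_def dist_real_def)
qed

lemma schoenberg_wave_1:
  assumes "2/3 \<le> u" "u \<le> 1"
  shows "schoenberg_wave (2 * of_int n + u) = 1"
proof -
  have "2/3 \<le> (INF x\<in>range (\<lambda>n::int. 2 * of_int n). dist (2 * of_int n + u) x)"
  proof (rule cINF_greatest)
    fix x assume "x \<in> range (\<lambda>n::int. 2 * of_int n :: real)"
    then obtain m :: int where x: "x = 2 * of_int m" by blast
    show "2/3 \<le> dist (2 * of_int n + u) x"
    proof (cases "m \<le> n")
      case True
      then have "real_of_int m \<le> of_int n" by simp
      then show ?thesis using assms x unfolding dist_real_def by linarith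
    next
      case False
      then have "real_of_int n + 1 \<le> of_int m" by linarith
      then show ?thesis using assms x unfolding dist_real_def by linarith
    qed
  qed simp
  then have "2/3 \<le> even_dist (2 * of_int n + u)" by (simp add: even_dist_def infdist_def)
  then show ?thesis by (simp add: schoenberg_wave_def)
qed

text \<open>For bits \<open>a j\<close> this is the point of the Cantor set with ternary digits
  \<open>2 * a j\<close>; \<open>a 0\<close> belongs to the digit of weight 1/3.\<close>

definition cantor_point :: "(nat \<Rightarrow> real) \<Rightarrow> real" where
  "cantor_point a = (\<Sum>j. 2 * a j / 3 ^ Suc j)"

lemma sums_two_thirds: "(\<lambda>j. 2 / 3 ^ Suc j :: real) sums 1"
proof -
  have "(\<lambda>j. 2 / 3 * (1 / 3) ^ j :: real) sums (2 / 3 * (1 / (1 - 1 / 3)))"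
    by (intro sums_mult geometric_sums) simp
  then show ?thesis by (simp add: power_one_over field_simps)
qed

context
  fixes a :: "nat \<Rightarrow> real"
  assumes bit: "\<And>j. a j \<in> {0, 1}"
begin

lemma bit_bounds: "0 \<le> a j" "a j \<le> 1"
  using bit[of j] by auto

lemma summable_cantor: "summable (\<lambda>j. 2 * a j / 3 ^ Suc j)"
  by (rule summable_comparison_test'[OF sums_summable[OF sums_two_thirds], of 0])
    (use bit_bounds in \<open>auto simp: abs_mult divide_right_mono\<close>)

lemma cantor_point_bounds: "0 \<le> cantor_point a" "cantor_point a \<le> 1"
proof -
  show "0 \<le> cantor_point a" unfolding cantor_point_def
    by (intro suminf_nonneg summable_cantor) (use bit_bounds in auto)
  have "cantor_point a \<le> (\<Sum>j. 2 / 3 ^ Suc j :: real)" unfolding cantor_point_def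
    by (intro suminf_le summable_cantor sums_summable[OF sums_two_thirds]) (use bit_bounds in \<open>auto intro!: divide_right_mono\<close>)
  then show "cantor_point a \<le> 1" using sums_two_thirds by (simp add: sums_iff)
qed

lemma cantor_point_Suc: "3 * cantor_point a = 2 * a 0 + cantor_point (\<lambda>j. a (Suc j))"
proof -
  have "cantor_point a = (\<Sum>j. 2 * a (Suc j) / 3 ^ Suc (Suc j)) + 2 * a 0 / 3"
    unfolding cantor_point_def using suminf_split_head[OF summable_cantor] by simp
  also have "(\<Sum>j. 2 * a (Suc j) / 3 ^ Suc (Suc j)) = (\<Sum>j. 2 * a (Suc j) / 3 ^ Suc j / 3)"
    by (simp add: field_simps)
  also have "\<dots> = cantor_point (\<lambda>j. a (Suc j)) / 3"
    unfolding cantor_point_def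
  proof (rule suminf_divide)
    have "summable (\<lambda>j. 2 * a (Suc j) / 3 ^ Suc (Suc j))"
      using summable_cantor by (subst (asm) summable_Suc_iff[symmetric])
    from summable_mult[OF this, of 3] show "summable (\<lambda>j. 2 * a (Suc j) / 3 ^ Suc j)" by simp
  qed
  finally show ?thesis by simp
qed

end

text \<open>Multiplication by 3 moves the leading digit, 0 or 2, in front of the point. The integer
  part split off is always even, hence invisible to a function of period 2.\<close>

lemma cantor_point_shift:
  assumes "\<And>j. a j \<in> {0, 1}"
  shows "\<exists>n::int. 3 ^ k * cantor_point a = 2 * of_int n + cantor_point (\<lambda>j. a (k + j))"
  using assms
proof (induction k arbitrary: a)
  case 0
  show ?case by (intro exI[of _ 0]) simp
next
  case (Suc k)
  obtain n :: int where n: "3 ^ k * cantor_point (\<lambda>j. a (Suc j)) = 2 * of_int n + cantor_point (\<lambda>j. a (Suc (k + j)))"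
    using Suc.IH[of "\<lambda>j. a (Suc j)"] Suc.prems by auto
  obtain b :: int where b: "a 0 = of_int b" using Suc.prems[of 0] by (auto intro: that[of 0] that[of 1])
  have "3 ^ Suc k * cantor_point a = 3 ^ k * (3 * cantor_point a)" by simp
  also have "\<dots> = 3 ^ k * (2 * a 0) + 3 ^ k * cantor_point (\<lambda>j. a (Suc j))"
    unfolding cantor_point_Suc[OF Suc.prems] by (simp add: algebra_simps)
  also have "\<dots> = 2 * of_int (3 ^ k * b + n) + cantor_point (\<lambda>j. a (Suc k + j))"
    unfolding n b by simp
  finally show ?case by blast
qed

text \<open>After the shift the leading digit puts the remainder in [0, 1/3] or in [2/3, 1], where
  the wave is constant with value that digit's bit.\<close>

lemma schoenberg_wave_cantor_point:
  assumes bit: "\<And>j. a j \<in> {0, 1}"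
  shows "schoenberg_wave (3 ^ k * cantor_point a) = a k"
proof -
  obtain n :: int where n: "3 ^ k * cantor_point a = 2 * of_int n + cantor_point (\<lambda>j. a (k + j))"
    using cantor_point_shift[of a, OF bit] by blast
  define u where "u = cantor_point (\<lambda>j. a (k + j))"
  define v where "v = cantor_point (\<lambda>j. a (k + Suc j))"
  have "3 * u = 2 * a k + v" "0 \<le> v" "v \<le> 1"
    unfolding u_def v_def using cantor_point_Suc[of "\<lambda>j. a (k + j)"] bit cantor_point_bounds[of "\<lambda>j. a (k + Suc j)"] by auto
  then show ?thesis unfolding n u_def[symmetric]
    using bit[of k] by (auto intro!: schoenberg_wave_0 schoenberg_wave_1)
qed

text \<open>\<open>y k\<close> is the remainder after k digits, scaled by 2^k; it stays in [0, 1],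
  so the partial sums converge. The end point 1 is covered, with all digits equal to 1.\<close>

lemma binary_expansion:
  assumes "0 \<le> x" "x \<le> 1"
  obtains a :: "nat \<Rightarrow> real" where "\<And>j. a j \<in> {0, 1}" "(\<lambda>k. a k / 2 ^ Suc k) sums x"
proof -
  define y where "y = rec_nat x (\<lambda>_ u. if u \<ge> 1/2 then 2 * u - 1 else 2 * (u::real))"
  define a where "a k = (if y k \<ge> 1/2 then 1 else 0 :: real)" for k
  have y0: "y 0 = x" and yS: "y (Suc k) = 2 * y k - a k" for k by (auto simp: y_def a_def)
  have yb: "0 \<le> y k \<and> y k \<le> 1" for k
  proof (induction k)
    case (Suc k)
    then show ?case unfolding yS by (auto simp: a_def)
  qed (use y0 assms in auto)
  have part: "(\<Sum>k<n. a k / 2 ^ Suc k) = x - y n / 2 ^ n" for n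
    by (induction n) (auto simp: y0 yS field_simps)
  have "(\<lambda>n. x - y n / 2 ^ n) \<longlonglongrightarrow> x - 0"
  proof (intro tendsto_intros)
    show "(\<lambda>n. y n / 2 ^ n) \<longlonglongrightarrow> 0"
    proof (rule tendsto_sandwich[OF _ _ tendsto_const])
      show "(\<lambda>n. 1 / 2 ^ n :: real) \<longlonglongrightarrow> 0"
        using LIMSEQ_realpow_zero[of "1/2::real"] by (simp add: power_one_over)
    qed (use yb in \<open>auto intro!: always_eventually divide_right_mono\<close>)
  qed
  then have "(\<lambda>k. a k / 2 ^ Suc k) sums x" unfolding sums_def part by simp
  then show ?thesis using that[of a] by (auto simp: a_def)
qed

text \<open>The coordinate \<open>b\<close>, 0 or 1, reads the Cantor digits at positions of that
  parity as the binary digits of its value, so two expansions can be interleaved in one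
  parameter.\<close>

definition schoenberg :: "nat \<Rightarrow> real \<Rightarrow> real" where
  "schoenberg b t = (\<Sum>k. schoenberg_wave (3 ^ (2 * k + b) * t) / 2 ^ Suc k)"

lemma continuous_schoenberg: "continuous_on UNIV (schoenberg b)"
proof -
  have "uniform_limit UNIV (\<lambda>n t. \<Sum>k<n. schoenberg_wave (3 ^ (2 * k + b) * t) / 2 ^ Suc k) (schoenberg b) sequentially"
    unfolding schoenberg_def[abs_def]
  proof (rule Weierstrass_m_test[where M="\<lambda>k. 1 / 2 ^ Suc k"])
    show "summable (\<lambda>k. 1 / 2 ^ Suc k :: real)"
      using power_half_series by (auto simp: sums_iff power_one_over)
  qed (auto intro!: divide_right_mono simp: schoenberg_wave_bounds)
  then show ?thesis
    by (rule uniform_limit_theorem[rotated])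
      (auto intro!: always_eventually continuous_intros continuous_on_compose2[OF continuous_schoenberg_wave[of UNIV]])
qed

lemma schoenberg_surj:
  assumes "0 \<le> x" "x \<le> 1" "0 \<le> y" "y \<le> 1"
  obtains t where "t \<in> {0..1}" "schoenberg 0 t = x" "schoenberg 1 t = y"
proof -
  obtain a where a: "\<And>j. a j \<in> {0, 1}" "(\<lambda>k. a k / 2 ^ Suc k) sums x"
    using binary_expansion[OF assms(1,2)] by blast
  obtain b where b: "\<And>j. b j \<in> {0, 1}" "(\<lambda>k. b k / 2 ^ Suc k) sums y"
    using binary_expansion[OF assms(3,4)] by blast
  define c where "c j = (if even j then a (j div 2) else b (j div 2))" for j
  have c: "c j \<in> {0, 1}" for j using a(1) b(1) by (simp add: c_def)
  note w = schoenberg_wave_cantor_point[of c, OF c]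
  show ?thesis
  proof (rule that)
    show "cantor_point c \<in> {0..1}" using cantor_point_bounds[of c, OF c] by auto
    show "schoenberg 0 (cantor_point c) = x" "schoenberg 1 (cantor_point c) = y"
      unfolding schoenberg_def w using a(2) b(2) by (auto simp: c_def sums_iff)
  qed
qed

lemma bounded_subset_curve:
  fixes E :: "complex set"
  assumes "bounded E"
  obtains h :: "real \<Rightarrow> complex" where "continuous_on UNIV h" "E \<subseteq> h ` {0..1}"
proof -
  obtain M where M: "M > 0" "\<And>z. z \<in> E \<Longrightarrow> norm z \<le> M"
    using assms by (auto simp: bounded_pos)
  define h where "h t = Complex (2 * M * schoenberg 0 t - M) (2 * M * schoenberg 1 t - M)" for t
  have "continuous_on UNIV h"
    unfolding h_def Complex_eq by (intro continuous_intros continuous_schoenberg)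
  moreover have "z \<in> h ` {0..1}" if "z \<in> E" for z
  proof -
    have "\<bar>Re z\<bar> \<le> M" "\<bar>Im z\<bar> \<le> M"
      using M(2)[OF that] abs_Re_le_cmod[of z] abs_Im_le_cmod[of z] by auto
    then obtain t where "t \<in> {0..1}" "schoenberg 0 t = (Re z + M) / (2 * M)" "schoenberg 1 t = (Im z + M) / (2 * M)"
      using M(1) by (auto intro: schoenberg_surj[of "(Re z + M) / (2 * M)" "(Im z + M) / (2 * M)"] simp: field_simps abs_le_iff)
    then have "h t = z" using M(1) by (simp add: h_def complex_eq_iff)
    then show ?thesis using \<open>t \<in> {0..1}\<close> by blast
  qed
  ultimately show ?thesis using that by blast
qed

section \<open>Compact sets without measures of finite energy\<close>

text \<open>Allows the kernel inside Fatou's lemma to be cut off at levels tending to infinity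
  without losing the limit.\<close>

lemma min_liminf_le:
  fixes f :: "nat \<Rightarrow> ennreal"
  assumes "x \<le> liminf f" "b \<longlonglongrightarrow> \<top>"
  shows "x \<le> liminf (\<lambda>n. min (b n) (f n))"
  unfolding le_Liminf_iff
proof (intro allI impI)
  fix y assume y: "y < x"
  have "eventually (\<lambda>n. y < f n) sequentially" using assms(1) y unfolding le_Liminf_iff by blast
  moreover have "eventually (\<lambda>n. y < b n) sequentially"
    by (rule order_tendstoD(1)[OF assms(2) less_le_trans[OF y top_greatest]])
  ultimately show "eventually (\<lambda>n. y < min (b n) (f n)) sequentially" by eventually_elim simp
qed

text \<open>A greedy choice controls only the terms below the diagonal. Adding a row and a column
  uses that bound twice by symmetry, and 2 n \<le> (n + 1)^2 - n^2.\<close>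

lemma sum_symmetric_le:
  fixes g :: "nat \<Rightarrow> nat \<Rightarrow> ennreal"
  assumes sym: "\<And>i j. g i j = g j i" and diag: "\<And>i. g i i \<le> b" and low: "\<And>i. (\<Sum>j<i. g i j) \<le> of_nat i * c"
  shows "(\<Sum>i<n. \<Sum>j<n. g i j) \<le> of_nat n * b + of_nat (n * n) * c"
proof (induction n)
  case (Suc n)
  have "(\<Sum>i<Suc n. \<Sum>j<Suc n. g i j) = (\<Sum>i<n. \<Sum>j<n. g i j) + (\<Sum>i<n. g i n) + (\<Sum>j<n. g n j) + g n n"
    by (simp add: sum.distrib add.assoc)
  also have "(\<Sum>i<n. g i n) = (\<Sum>j<n. g n j)" by (simp add: sym)
  also have "(\<Sum>i<n. \<Sum>j<n. g i j) + (\<Sum>j<n. g n j) + (\<Sum>j<n. g n j) + g n n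
      \<le> (of_nat n * b + of_nat (n * n) * c) + of_nat n * c + of_nat n * c + b"
    by (intro add_mono Suc.IH low diag)
  also have "\<dots> \<le> of_nat (Suc n) * b + of_nat (Suc n * Suc n) * c"
    by (simp add: algebra_simps)
  finally show ?case .
qed simp

lemma nn_integral_uniform_points:
  fixes f :: "real \<Rightarrow> ennreal"
  assumes [measurable]: "f \<in> borel_measurable borel"
  shows "(\<integral>\<^sup>+ x. f x \<partial>distr (measure_pmf (pmf_of_set {..n})) borel t) = (\<Sum>i<Suc n. f (t i)) / of_nat (Suc n)"
  by (subst nn_integral_distr) (simp_all add: nn_integral_pmf_of_set lessThan_Suc_atMost)

lemma borel_prob_onI:
  assumes "prob_space \<mu>" "sets \<mu> = sets borel" "AE x in \<mu>. x \<in> K" "K \<in> sets borel"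
  shows "borel_prob_on K \<mu>"
proof -
  have "emeasure \<mu> (- K) = 0"
  proof (rule AE_iff_measurable[THEN iffD1, OF _ _ assms(3)])
    show "- K \<in> sets \<mu>" unfolding assms(2) using assms(4) by (rule borel_comp)
  qed (use sets_eq_imp_space_eq[OF assms(2)] in auto)
  then show ?thesis using assms by (simp add: borel_prob_on_def)
qed

text \<open>The points are chosen greedily, as Leja points. Lifting their empirical measures along a
  space-filling curve makes the compactness theorem of Helly on the real line applicable, and
  Skorohod's coupling reduces the semicontinuity of the energy to Fatou's lemma. The diagonal terms
  are infinite, so the kernel is cut off at the square root of the number of points.\<close>

lemma exists_energy_le:
  fixes E :: "complex set" and L :: real
  assumes E: "compact E" and R: "R > 0" and L: "L \<ge> 0"
    and next_point: "\<And>(w :: nat \<Rightarrow> complex) n. (\<forall>j<n. w j \<in> E) \<Longrightarrow> \<exists>z\<in>E. (\<Sum>j<n. log_kernel R (dist z (w j))) \<le> of_nat n * ennreal L"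
  shows "\<exists>\<mu>. borel_prob_on E \<mu> \<and> energy R \<mu> \<mu> \<le> ennreal L"
proof -
  let ?P = "\<lambda>z n x. x \<in> E \<and> (\<Sum>j<n. log_kernel R (dist x (z j))) \<le> of_nat n * ennreal L"
  have "\<exists>z. \<forall>n. ?P z n (z n)"
  proof (rule dependent_wf_choice[OF wf_less_than, where P="?P"])
    show "?P f n r = ?P g n r" if "\<And>j. (j, n) \<in> less_than \<Longrightarrow> f j = g j" for f g :: "nat \<Rightarrow> complex" and n r
      using that by simp
    show "\<exists>r. ?P f n r" if "\<And>j. (j, n) \<in> less_than \<Longrightarrow> ?P f j (f j)" for n and f :: "nat \<Rightarrow> complex"
      using next_point[of n f] that by auto
  qed
  then obtain z where z: "\<And>n. z n \<in> E" "\<And>n. (\<Sum>j<n. log_kernel R (dist (z n) (z j))) \<le> of_nat n * ennreal L"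
    by blast
  obtain h :: "real \<Rightarrow> complex" where h: "continuous_on UNIV h" "E \<subseteq> h ` {0..1}"
    using bounded_subset_curve[OF compact_imp_bounded[OF E]] by blast
  have [measurable]: "h \<in> borel_measurable borel" using h(1) by (rule borel_measurable_continuous_onI)
  obtain t where t: "\<And>n. t n \<in> {0..1}" "\<And>n. h (t n) = z n"
  proof -
    have "\<exists>x. x \<in> {0..1} \<and> h x = z n" for n using h(2) z(1)[of n] by (force simp: image_iff)
    then show ?thesis using that by metis
  qed
  define M where "M n = distr (measure_pmf (pmf_of_set {..n})) borel t" for n :: nat
  have rd: "real_distribution (M n)" for n
    unfolding M_def by (intro prob_space.real_distribution_distr prob_space_measure_pmf) simp
  have "tight M" unfolding tight_def
  proof (intro conjI allI impI rd)
    fix \<epsilon> :: real assume "\<epsilon> > 0"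
    have "measure (M n) {-1<..1} = 1" for n
    proof -
      have "t -` {-1<..1} = UNIV" using t(1) by (force intro: less_le_trans[of _ 0])
      then show ?thesis by (simp add: M_def measure_distr)
    qed
    then show "\<exists>a b. a < b \<and> (\<forall>n. 1 - \<epsilon> < measure (M n) {a<..b})"
      using \<open>\<epsilon> > 0\<close> by (intro exI[of _ "-1"] exI[of _ 1]) auto
  qed
  then obtain r M' where r: "strict_mono (r :: nat \<Rightarrow> nat)" "real_distribution M'" "weak_conv_m (M \<circ> r) M'"
    using tight_imp_convergent_subsubsequence[of M id] strict_mono_id by auto
  have "real_distribution ((M \<circ> r) n)" for n by (simp add: rd)
  then obtain \<Omega> :: "real measure" and Ys Y where Sk: "prob_space \<Omega>" "\<forall>n. Ys n \<in> measurable \<Omega> borel"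
      "\<forall>n. distr \<Omega> borel (Ys n) = (M \<circ> r) n" "Y \<in> measurable \<Omega> lborel"
      "\<forall>x\<in>space \<Omega>. (\<lambda>n. Ys n x) \<longlonglongrightarrow> Y x"
    using Skorohod[of "M \<circ> r" M', OF _ r(2,3)] by blast
  then have \<Omega>: "prob_space \<Omega>" and Ys[measurable]: "\<And>n. Ys n \<in> measurable \<Omega> borel"
    and Ysd: "\<And>n. distr \<Omega> borel (Ys n) = M (r n)" and Y: "Y \<in> measurable \<Omega> lborel"
    and lim: "\<And>x. x \<in> space \<Omega> \<Longrightarrow> (\<lambda>n. Ys n x) \<longlonglongrightarrow> Y x"
    by simp_all
  have [measurable]: "Y \<in> measurable \<Omega> borel" using Y by simp
  interpret \<Omega>: prob_space \<Omega> by fact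
  define \<mu> where "\<mu> = distr \<Omega> borel (\<lambda>x. h (Y x))"
  have hlim: "(\<lambda>n. h (Ys n x)) \<longlonglongrightarrow> h (Y x)" if "x \<in> space \<Omega>" for x
    using h(1) lim[OF that] by (intro continuous_on_tendsto_compose[OF h(1)]) auto
  have AE_E: "AE x in \<Omega>. h (Y x) \<in> E"
  proof -
    have "AE x in \<Omega>. h (Ys n x) \<in> E" for n
    proof -
      have [measurable]: "E \<in> sets borel" using E by (simp add: borel_compact)
      have "AE x in M (r n). h x \<in> E" unfolding M_def
        by (subst AE_distr_iff) (auto simp: t z)
      then show ?thesis unfolding Ysd[symmetric] by (subst (asm) AE_distr_iff) auto
    qed
    then have "AE x in \<Omega>. \<forall>n. h (Ys n x) \<in> E" by (simp add: AE_all_countable)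
    then show ?thesis
      by (rule AE_mp) (intro AE_I2 impI closed_sequentially[OF compact_imp_closed[OF E] _ hlim], auto)
  qed
  have \<mu>: "borel_prob_on E \<mu>"
  proof -
    have [measurable]: "E \<in> sets borel" using E by (simp add: borel_compact)
    show ?thesis unfolding \<mu>_def
      by (intro borel_prob_onI \<Omega>.prob_space_distr) (use AE_E in \<open>auto simp: AE_distr_iff\<close>)
  qed
  \<comment> \<open>With N points the N diagonal terms contribute at most N sqrt N / N^2 = 1 / sqrt
    N to the normalised double sum, which tends to 0 although the cutoff tends to infinity.\<close>
  define b where "b n = ennreal (sqrt (real (Suc (r n))))" for n
  define k where "k n x y = min (b n) (log_kernel R (dist x y))" for n and x y :: complex
  have k_meas[measurable]: "(\<lambda>x. k n (f x) (g x)) \<in> borel_measurable N"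
    if [measurable]: "f \<in> borel_measurable N" "g \<in> borel_measurable N" for n f g and N :: "'z measure"
    unfolding k_def by measurable
  have r_top: "filterlim (\<lambda>n. real (Suc (r n))) at_top sequentially"
    by (rule filterlim_compose[OF filterlim_real_sequentially], rule filterlim_compose[OF filterlim_Suc filterlim_subseq[OF r(1)]])
  have b_top: "b \<longlonglongrightarrow> \<top>"
    unfolding b_def by (intro ennreal_tendsto_top_eq_at_top[THEN iffD2] filterlim_compose[OF sqrt_at_top r_top])
  have "energy R \<mu> \<mu> = (\<integral>\<^sup>+ x. (\<integral>\<^sup>+ y. log_kernel R (dist (h (Y x)) (h (Y y))) \<partial>\<Omega>) \<partial>\<Omega>)"
  proof -
    have D: "(\<integral>\<^sup>+ x. f x \<partial>\<mu>) = (\<integral>\<^sup>+ x. f (h (Y x)) \<partial>\<Omega>)" if [measurable]: "f \<in> borel_measurable borel" for f :: "complex \<Rightarrow> ennreal"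
      unfolding \<mu>_def by (rule nn_integral_distr) measurable
    show ?thesis
      unfolding energy_def D[OF pot_measurable[OF borel_prob_onD(2,3)[OF \<mu> compact_imp_closed[OF E]]]]
      unfolding pot_def by (intro nn_integral_cong D) measurable
  qed
  also have "\<dots> \<le> (\<integral>\<^sup>+ x. (\<integral>\<^sup>+ y. liminf (\<lambda>n. k n (h (Ys n x)) (h (Ys n y))) \<partial>\<Omega>) \<partial>\<Omega>)"
    unfolding k_def
    by (intro nn_integral_mono min_liminf_le[OF log_kernel_lsc b_top] tendsto_dist hlim R zero_le_dist)
  also have "\<dots> \<le> (\<integral>\<^sup>+ x. liminf (\<lambda>n. (\<integral>\<^sup>+ y. k n (h (Ys n x)) (h (Ys n y)) \<partial>\<Omega>)) \<partial>\<Omega>)"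
    by (intro nn_integral_mono nn_integral_liminf) measurable
  also have "\<dots> \<le> liminf (\<lambda>n. (\<integral>\<^sup>+ x. (\<integral>\<^sup>+ y. k n (h (Ys n x)) (h (Ys n y)) \<partial>\<Omega>) \<partial>\<Omega>))"
    by (intro nn_integral_liminf) measurable
  also have "\<dots> \<le> liminf (\<lambda>n. ennreal (L + 1 / sqrt (real (Suc (r n)))))"
  proof (intro Liminf_mono always_eventually allI)
    fix n
    define N where "N = Suc (r n)"
    have N: "real N > 0" by (simp add: N_def)
    have DYs: "(\<integral>\<^sup>+ v. f v \<partial>M (r n)) = (\<integral>\<^sup>+ x. f (Ys n x) \<partial>\<Omega>)" if [measurable]: "f \<in> borel_measurable borel" for f :: "real \<Rightarrow> ennreal"
      unfolding Ysd[symmetric] by (rule nn_integral_distr) measurable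
    have "(\<integral>\<^sup>+ x. (\<integral>\<^sup>+ y. k n (h (Ys n x)) (h (Ys n y)) \<partial>\<Omega>) \<partial>\<Omega>)
       = (\<integral>\<^sup>+ x. (\<integral>\<^sup>+ v. k n (h (Ys n x)) (h v) \<partial>M (r n)) \<partial>\<Omega>)"
      by (intro nn_integral_cong DYs[symmetric]) measurable
    also have "\<dots> = (\<integral>\<^sup>+ x. (\<Sum>j<N. k n (h (Ys n x)) (z j)) / of_nat N \<partial>\<Omega>)"
      unfolding M_def N_def by (simp add: nn_integral_uniform_points t)
    also have "\<dots> = (\<integral>\<^sup>+ u. (\<Sum>j<N. k n (h u) (z j)) / of_nat N \<partial>M (r n))"
      by (rule DYs[symmetric]) measurable
    also have "\<dots> = (\<Sum>i<N. (\<Sum>j<N. k n (z i) (z j)) / of_nat N) / of_nat N"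
      unfolding M_def N_def by (subst nn_integral_uniform_points) (simp_all add: t)
    also have "\<dots> = (\<Sum>i<N. \<Sum>j<N. k n (z i) (z j)) / of_nat (N * N)"
    proof -
      have d: "x / of_nat m = x * ennreal (1 / real m)" if "m > 0" for x :: ennreal and m :: nat
        using that by (simp add: divide_ennreal_def ennreal_of_nat_eq_real_of_nat inverse_ennreal inverse_eq_divide)
      have "ennreal (1 / real N) * ennreal (1 / real N) = ennreal (1 / real (N * N))"
        by (subst ennreal_mult[symmetric]) auto
      then show ?thesis using N by (simp only: d of_nat_0_less_iff sum_distrib_right[symmetric] mult.assoc nat_0_less_mult_iff)
    qed
    also have "\<dots> \<le> (of_nat N * b n + of_nat (N * N) * ennreal L) / of_nat (N * N)"
    proof (intro divide_right_mono_ennreal sum_symmetric_le)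
      show "k n (z i) (z j) = k n (z j) (z i)" for i j by (simp add: k_def dist_commute)
      show "k n (z i) (z i) \<le> b n" for i by (simp add: k_def)
      show "(\<Sum>j<i. k n (z i) (z j)) \<le> of_nat i * ennreal L" for i
        by (rule order_trans[OF sum_mono z(2)]) (simp add: k_def)
    qed
    also have "\<dots> = ennreal ((real N * sqrt (real N) + real (N * N) * L) / real (N * N))"
      unfolding b_def N_def[symmetric] using N L
      by (simp only: ennreal_of_nat_eq_real_of_nat ennreal_mult[symmetric] ennreal_plus[symmetric] divide_ennreal
          of_nat_0_le_iff real_sqrt_ge_zero mult_nonneg_nonneg add_nonneg_nonneg of_nat_mult mult_pos_pos)
    also have "(real N * sqrt (real N) + real (N * N) * L) / real (N * N) = L + 1 / sqrt (real N)"
    proof -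
      define s where "s = sqrt (real N)"
      have s: "s > 0" "real N = s * s" using N by (simp_all add: s_def)
      have "(s * s * s + s * s * (s * s) * L) / (s * s * (s * s)) = L + 1 / s"
        using s(1) by (simp add: field_simps)
      then show ?thesis by (simp only: of_nat_mult s_def[symmetric]) (simp only: s(2))
    qed
    finally show "(\<integral>\<^sup>+ x. (\<integral>\<^sup>+ y. k n (h (Ys n x)) (h (Ys n y)) \<partial>\<Omega>) \<partial>\<Omega>) \<le> ennreal (L + 1 / sqrt (real (Suc (r n))))"
      by (simp only: N_def)
  qed
  also have "\<dots> = ennreal (L + 0)"
  proof (rule lim_imp_Liminf)
    show "(\<lambda>n. ennreal (L + 1 / sqrt (real (Suc (r n))))) \<longlonglongrightarrow> ennreal (L + 0)"
      by (intro tendsto_ennrealI tendsto_add tendsto_const tendsto_divide_0[OF tendsto_const]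
          filterlim_at_top_imp_at_infinity filterlim_compose[OF sqrt_at_top r_top])
  qed simp
  finally show ?thesis using \<mu> by auto
qed

text \<open>A form of Evans' theorem at one finite level, by contraposition of
  \<open>exists_energy_le\<close>: some finite configuration cannot be continued greedily at level
  \<open>L\<close>, so its empirical measure has potential above \<open>L\<close> on all of
  \<open>E\<close>. The configuration is nonempty because the strict inequality fails for n =
  0.\<close>

lemma polar_large_potential:
  assumes E: "compact E" "E \<noteq> {}" and R: "R > 0"
    and polar: "\<And>\<mu>. borel_prob_on E \<mu> \<Longrightarrow> energy R \<mu> \<mu> = \<top>"
  shows "\<exists>\<nu>. borel_prob_on E \<nu> \<and> (\<forall>z\<in>E. ennreal L \<le> pot R \<nu> z)"
proof -
  have "\<not> (\<forall>(w :: nat \<Rightarrow> complex) n. (\<forall>j<n. w j \<in> E) \<longrightarrow> (\<exists>z\<in>E. (\<Sum>j<n. log_kernel R (dist z (w j))) \<le> of_nat n * ennreal (max 0 L)))"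
  proof
    assume "\<forall>(w :: nat \<Rightarrow> complex) n. (\<forall>j<n. w j \<in> E) \<longrightarrow> (\<exists>z\<in>E. (\<Sum>j<n. log_kernel R (dist z (w j))) \<le> of_nat n * ennreal (max 0 L))"
    then obtain \<mu> where "borel_prob_on E \<mu>" "energy R \<mu> \<mu> \<le> ennreal (max 0 L)"
      using exists_energy_le[OF E(1) R, of "max 0 L"] by auto
    with polar[of \<mu>] show False by (simp add: top_unique)
  qed
  then obtain w :: "nat \<Rightarrow> complex" and n where w: "\<And>j. j < n \<Longrightarrow> w j \<in> E"
    and big: "\<And>z. z \<in> E \<Longrightarrow> of_nat n * ennreal (max 0 L) < (\<Sum>j<n. log_kernel R (dist z (w j)))"
    by (auto simp: not_le)
  have n: "n > 0" using big E(2) by (cases n) auto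
  then obtain m where m: "n = Suc m" by (cases n) auto
  define \<nu> where "\<nu> = distr (measure_pmf (pmf_of_set {..m})) borel w"
  have [measurable]: "E \<in> sets borel" using E by (simp add: borel_compact)
  have "borel_prob_on E \<nu>" unfolding \<nu>_def
    by (intro borel_prob_onI prob_space.prob_space_distr prob_space_measure_pmf)
      (auto simp: AE_distr_iff AE_measure_pmf_iff w m)
  moreover have "ennreal L \<le> pot R \<nu> z" if "z \<in> E" for z
  proof -
    have "pot R \<nu> z = (\<Sum>j<n. log_kernel R (dist z (w j))) / of_nat n"
      unfolding pot_def \<nu>_def by (subst nn_integral_distr) (simp_all add: nn_integral_pmf_of_set m lessThan_Suc_atMost)
    moreover have "ennreal L = of_nat n * ennreal L / of_nat n"
      using n by (simp add: ennreal_mult_divide_eq mult.commute)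
    moreover have "of_nat n * ennreal L \<le> (\<Sum>j<n. log_kernel R (dist z (w j)))"
      using big[OF that] by (simp add: ennreal_max_0)
    ultimately show ?thesis by (metis divide_right_mono_ennreal)
  qed
  ultimately show ?thesis by blast
qed

section \<open>Subharmonicity of potentials\<close>

lemma circle_mean_nn_integral:
  assumes "sigma_finite_measure \<alpha>"
    and meas: "(\<lambda>(t, w). f (u + rcis r t) w) \<in> borel_measurable (lborel \<Otimes>\<^sub>M \<alpha>)"
  shows "circle_mean r (\<lambda>z. \<integral>\<^sup>+ w. f z w \<partial>\<alpha>) u = (\<integral>\<^sup>+ w. circle_mean r (\<lambda>z. f z w) u \<partial>\<alpha>)"
proof -
  interpret sigma_finite_measure \<alpha> by fact
  interpret p: pair_sigma_finite \<alpha> lborel by standard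
  note [measurable] = meas
  have [measurable]: "(\<lambda>(w, t). f (u + rcis r t) w) \<in> borel_measurable (\<alpha> \<Otimes>\<^sub>M lborel)"
    using measurable_compose[OF measurable_pair_swap' meas] by (simp add: split_beta')
  have "(\<integral>\<^sup>+ t. (\<integral>\<^sup>+ w. f (u + rcis r t) w \<partial>\<alpha>) * indicator {0..2 * pi} t \<partial>lborel)
      = (\<integral>\<^sup>+ t. (\<integral>\<^sup>+ w. f (u + rcis r t) w * indicator {0..2 * pi} t \<partial>\<alpha>) \<partial>lborel)"
    by (intro nn_integral_cong nn_integral_multc[symmetric]) measurable
  also have "\<dots> = (\<integral>\<^sup>+ w. (\<integral>\<^sup>+ t. f (u + rcis r t) w * indicator {0..2 * pi} t \<partial>lborel) \<partial>\<alpha>)"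
    by (rule p.Fubini') measurable
  finally show ?thesis
    unfolding circle_mean_def by (simp add: nn_integral_cmult)
qed

lemma circle_mean_mono:
  assumes "\<And>t. f (u + rcis r t) \<le> g (u + rcis r t)"
  shows "circle_mean r f u \<le> circle_mean r g u"
  unfolding circle_mean_def using assms by (intro mult_left_mono nn_integral_mono mult_right_mono) auto

lemma circle_mean_const: "circle_mean r (\<lambda>_. c) u = c"
proof -
  have "(\<integral>\<^sup>+ t. c * indicator {0..2 * pi} t \<partial>lborel) = c * ennreal (2 * pi)"
    by (subst nn_integral_cmult_indicator) auto
  moreover have "ennreal (1 / (2 * pi)) * ennreal (2 * pi) = 1"
    by (subst ennreal_mult[symmetric]) auto
  ultimately show ?thesis unfolding circle_mean_def by (simp add: mult.left_commute)
qed

lemma measurable_rcis[measurable]: "rcis r \<in> borel_measurable borel"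
  unfolding rcis_def[abs_def] cis_conv_exp by measurable

text \<open>Jensen's formula with \<open>F = 1\<close>, integrated over the measure. It is stated as
  a sum since \<open>pot r \<alpha> u\<close> and \<open>pot R \<alpha> u\<close> may both be
  infinite.\<close>

lemma pot_circle_mean:
  assumes fin: "finite_measure \<alpha>" and s[measurable_cong]: "sets \<alpha> = sets borel" and r: "r > 0" and R: "R > 0"
    and le: "AE w in \<alpha>. dist u w + r \<le> R"
  shows "circle_mean r (pot R \<alpha>) u + pot r \<alpha> u = pot R \<alpha> u"
proof -
  interpret finite_measure \<alpha> by fact
  have cm: "circle_mean r (\<lambda>z. log_kernel R (dist z w)) u + log_kernel r (dist u w) = log_kernel R (dist u w)"
    if "dist u w + r \<le> R" for w
  proof -
    have "circle_mean r (\<lambda>z. log_kernel R (norm ((z - w) * 1))) u + log_kernel r (dist u w) = log_kernel R (norm ((u - w) * 1))"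
    proof (rule circle_mean_log_kernel[where F="\<lambda>_. 1" and r'="r + 1"])
      fix z assume z: "z \<in> cball u r"
      have "dist z w \<le> dist u z + dist u w" by (rule dist_triangle3)
      then show "norm ((z - w) * 1) \<le> R" using z that by (simp add: dist_norm)
    qed (use r R in auto)
    then show ?thesis by (simp add: dist_norm)
  qed
  have "circle_mean r (pot R \<alpha>) u = (\<integral>\<^sup>+ w. circle_mean r (\<lambda>z. log_kernel R (dist z w)) u \<partial>\<alpha>)"
    unfolding pot_def[abs_def] by (rule circle_mean_nn_integral) (unfold_locales, measurable)
  moreover have [measurable]: "(\<lambda>w. circle_mean r (\<lambda>z. log_kernel R (dist z w)) u) \<in> borel_measurable \<alpha>"
    unfolding circle_mean_def by measurable
  ultimately have "circle_mean r (pot R \<alpha>) u + pot r \<alpha> u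
      = (\<integral>\<^sup>+ w. circle_mean r (\<lambda>z. log_kernel R (dist z w)) u + log_kernel r (dist u w) \<partial>\<alpha>)"
    unfolding pot_def by (simp add: nn_integral_add)
  also have "\<dots> = pot R \<alpha> u"
    unfolding pot_def by (rule nn_integral_cong_AE) (use le in \<open>eventually_elim, simp add: cm\<close>)
  finally show ?thesis .
qed

lemma ereal_minus_enn2ereal_le_iff:
  "ereal a - enn2ereal x \<le> ereal a - enn2ereal y \<longleftrightarrow> y \<le> x"
  by (cases x; cases y) (auto simp: enn2ereal_ennreal top_unique)

lemma ereal_minus_enn2ereal_less_iff:
  "ereal a - enn2ereal x < ereal c \<longleftrightarrow> a - c < 0 \<or> ennreal (a - c) < x"
  by (cases x; cases "a < c") (auto simp: enn2ereal_ennreal ennreal_less_iff)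

text \<open>Makes potentials admissible test functions for non-thinness. Semicontinuity comes from
  Fatou's lemma for \<open>pot\<close>, the submean inequality from the nonnegative correction in
  \<open>pot_circle_mean\<close>.\<close>

lemma subharmonic_on_log_potential:
  assumes pr: "prob_space \<alpha>" and s: "sets \<alpha> = sets borel" and sup: "AE w in \<alpha>. w \<in> ball 0 \<rho>"
  shows "subharmonic_on (ball 0 \<rho>) (log_potential \<alpha>)"
proof (cases "\<rho> > 0")
  case False
  then have "ball (0::complex) \<rho> = {}" by (simp add: ball_empty)
  show ?thesis unfolding subharmonic_on_def \<open>ball (0::complex) \<rho> = {}\<close> by simp
next
  case \<rho>: True
  interpret prob_space \<alpha> by fact
  have fin: "finite_measure \<alpha>" by unfold_locales
  \<comment> \<open>Points of the ball are less than 2 \<rho> apart and the circles have radius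
    below \<rho>, so every distance that occurs is below \<open>R\<close>.\<close>
  define R where "R = 4 * \<rho>"
  have R: "R > 0" using \<rho> by (simp add: R_def)
  have lp: "log_potential \<alpha> z = ereal (ln R) - enn2ereal (pot R \<alpha> z)" if z: "z \<in> ball 0 \<rho>" for z
  proof -
    have "AE w in \<alpha>. dist z w \<le> R"
      using sup
    proof eventually_elim
      case (elim w)
      have "dist z w \<le> dist 0 z + dist 0 w" by (rule dist_triangle3)
      then show ?case using elim z \<rho> by (simp add: R_def)
    qed
    from log_potential_eq[OF fin s R this] show ?thesis by (simp add: prob_space)
  qed
  have finite: "log_potential \<alpha> z < \<infinity>" if "z \<in> ball 0 \<rho>" for z
    unfolding lp[OF that] by (cases "pot R \<alpha> z") (auto simp: enn2ereal_ennreal)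
  show ?thesis unfolding subharmonic_on_def
  proof (intro conjI ballI allI)
    show "log_potential \<alpha> z < \<infinity>" if "z \<in> ball 0 \<rho>" for z by (rule finite[OF that])
  next
    fix c :: ereal
    show "open {z \<in> ball 0 \<rho>. log_potential \<alpha> z < c}"
    proof (cases c)
      case (real x)
      have "{z \<in> ball 0 \<rho>. log_potential \<alpha> z < c} = ball 0 \<rho> \<inter> (if ln R - x < 0 then UNIV else - {z. pot R \<alpha> z \<le> ennreal (ln R - x)})"
        by (auto simp: lp real ereal_minus_enn2ereal_less_iff not_le)
      then show ?thesis using closed_pot_le[OF s R] by auto
    next
      case PInf
      then have "{z \<in> ball 0 \<rho>. log_potential \<alpha> z < c} = ball 0 \<rho>" using finite by auto
      then show ?thesis by simp
    qed simp
  next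
    fix z :: complex assume z: "z \<in> ball 0 \<rho>"
    show "\<exists>\<delta>>0. ball z \<delta> \<subseteq> ball 0 \<rho> \<and> (\<forall>r. 0 < r \<and> r < \<delta> \<longrightarrow> log_potential \<alpha> z
        \<le> ereal (1 / (2 * pi)) * ereal_integral (restrict_space lborel {0..2 * pi}) (\<lambda>t. log_potential \<alpha> (z + rcis r t)))"
    proof (intro exI[of _ "\<rho> - norm z"] conjI allI impI)
      show "\<rho> - norm z > 0" using z by simp
      show sub: "ball z (\<rho> - norm z) \<subseteq> ball 0 \<rho>" by (simp add: ball_subset_ball_iff dist_norm)
      fix r assume r: "0 < r \<and> r < \<rho> - norm z"
      have zt: "z + rcis r t \<in> ball 0 \<rho>" for t using r by (intro subsetD[OF sub]) (simp add: dist_norm)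
      let ?I = "restrict_space lborel {0..2 * pi}"
      have fI: "finite_measure ?I" by (rule finite_measureI) (simp add: space_restrict_space emeasure_restrict_space)
      have mI: "measure ?I (space ?I) = 2 * pi" by (simp add: space_restrict_space measure_restrict_space)
      have [measurable]: "pot R \<alpha> \<in> borel_measurable borel" by (rule pot_measurable[OF fin s])
      have "ereal_integral ?I (\<lambda>t. log_potential \<alpha> (z + rcis r t)) = ereal_integral ?I (\<lambda>t. ereal (ln R) - enn2ereal (pot R \<alpha> (z + rcis r t)))"
        by (simp only: lp[OF zt])
      also have "\<dots> = ereal (ln R * measure ?I (space ?I)) - enn2ereal (\<integral>\<^sup>+ t. e2ennreal (ereal (ln R) - (ereal (ln R) - enn2ereal (pot R \<alpha> (z + rcis r t)))) \<partial>?I)"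
      proof (rule ereal_integral_eq_bound_minus[OF fI])
        show "(\<lambda>t. ereal (ln R) - enn2ereal (pot R \<alpha> (z + rcis r t))) \<in> borel_measurable ?I"
          by (intro measurable_restrict_space1) measurable
      qed (auto simp: ereal_minus_le_iff enn2ereal_nonneg ereal_le_add_self)
      also have "\<dots> = ereal (ln R * (2 * pi)) - enn2ereal (\<integral>\<^sup>+ t. pot R \<alpha> (z + rcis r t) * indicator {0..2*pi} t \<partial>lborel)"
        unfolding e2ennreal_minus_minus mI by (subst nn_integral_restrict_space) auto
      also have "(\<integral>\<^sup>+ t. pot R \<alpha> (z + rcis r t) * indicator {0..2*pi} t \<partial>lborel) = ennreal (2 * pi) * circle_mean r (pot R \<alpha>) z"
      proof -
        have "ennreal (2 * pi) * ennreal (1 / (2 * pi)) = 1" by (subst ennreal_mult[symmetric]) auto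
        then show ?thesis unfolding circle_mean_def by (simp add: mult.assoc[symmetric])
      qed
      finally have "ereal (1 / (2 * pi)) * ereal_integral ?I (\<lambda>t. log_potential \<alpha> (z + rcis r t))
          = ereal (ln R) - enn2ereal (circle_mean r (pot R \<alpha>) z)"
        by (cases "circle_mean r (pot R \<alpha>) z")
          (auto simp: enn2ereal_ennreal ennreal_mult_top field_simps simp flip: ennreal_mult)
      moreover have "AE w in \<alpha>. dist z w + r \<le> R"
        using sup
      proof eventually_elim
        case (elim w)
        have "dist z w \<le> dist 0 z + dist 0 w" by (rule dist_triangle3)
        then show ?case using elim z r \<rho> by (simp add: R_def)
      qed
      from pot_circle_mean[OF fin s _ R this] r have "circle_mean r (pot R \<alpha>) z \<le> pot R \<alpha> z"
        by (metis le_iff_add)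
      ultimately show "log_potential \<alpha> z \<le> ereal (1 / (2 * pi)) * ereal_integral ?I (\<lambda>t. log_potential \<alpha> (z + rcis r t))"
        unfolding lp[OF z] by (simp add: ereal_minus_enn2ereal_le_iff)
    qed
  qed simp
qed

section \<open>The potential of the equilibrium measure on a non-thin set\<close>

lemma log_kernel_antimono:
  assumes "0 \<le> d'" "d' \<le> d" "R > 0"
  shows "log_kernel R d \<le> log_kernel R d'"
  using assms by (auto simp: log_kernel_def intro!: ennreal_leI ln_mono divide_left_mono mult_pos_pos)

lemma pot_le_of_far:
  assumes pr: "prob_space \<nu>" and s: "sets \<nu> = sets borel" and R: "R > 0" and d: "d > 0" and far: "AE w in \<nu>. d \<le> dist z w"
  shows "pot R \<nu> z \<le> log_kernel R d"
proof -
  interpret prob_space \<nu> by fact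
  have "pot R \<nu> z \<le> (\<integral>\<^sup>+ w. log_kernel R d \<partial>\<nu>)"
    unfolding pot_def using far
    by (intro nn_integral_mono_AE) (use R d in \<open>auto elim!: eventually_mono intro!: log_kernel_antimono\<close>)
  then show ?thesis by (simp add: emeasure_space_1)
qed

lemma borel_prob_on_mono:
  assumes "borel_prob_on A \<mu>" "closed A" "A \<subseteq> B"
  shows "borel_prob_on B \<mu>"
proof -
  have "emeasure \<mu> (- B) \<le> emeasure \<mu> (- A)"
    using assms by (intro emeasure_mono) (auto simp: borel_prob_on_def)
  then show ?thesis using assms by (auto simp: borel_prob_on_def)
qed

lemma dyadic_annulus:
  assumes "0 < x" "x \<le> (1::real)"
  obtains i :: nat where "(1/2) ^ Suc i \<le> x" "x \<le> (1/2) ^ i"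
proof -
  define i where "i = (LEAST n. (1/2) ^ Suc n \<le> x)"
  obtain n where "(1/2::real) ^ n < x" using real_arch_pow_inv[of x "1/2"] assms by auto
  then have "(1/2::real) ^ Suc n \<le> x" using assms(1) by simp
  then have 1: "(1/2) ^ Suc i \<le> x" unfolding i_def by (rule LeastI)
  have "x \<le> (1/2) ^ i"
  proof (cases i)
    case (Suc j)
    then have "\<not> (1/2) ^ Suc j \<le> x" using not_less_Least[of j "\<lambda>n. (1/2) ^ Suc n \<le> x"] unfolding i_def by simp
    then show ?thesis using Suc by simp
  qed (use assms in simp)
  with 1 show ?thesis by (rule that)
qed

lemma nn_integral_geometric_pmf_half:
  "(\<integral>\<^sup>+ i. ennreal (a + real i) \<partial>measure_pmf (geometric_pmf (1/2))) = ennreal (a + 1)" if "a \<ge> 0"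
proof -
  have "integrable (measure_pmf (geometric_pmf (1/2))) real"
    by (rule integrable_real_geometric_pmf) auto
  then have "(\<integral>\<^sup>+ i. ennreal (a + real i) \<partial>measure_pmf (geometric_pmf (1/2)))
      = ennreal (measure_pmf.expectation (geometric_pmf (1/2)) (\<lambda>i. a + real i))"
    using that by (intro nn_integral_eq_integral) auto
  also have "measure_pmf.expectation (geometric_pmf (1/2)) (\<lambda>i. a + real i) = a + 1"
    using \<open>integrable _ real\<close> by (simp add: expectation_geometric_pmf)
  finally show ?thesis .
qed

text \<open>The bound at \<open>\<zeta>\<close> does not depend on \<open>q\<close>: the potential on the \<open>i\<close>-th dyadic annulus around \<open>\<zeta>\<close> can
  be made arbitrarily large at a cost of order \<open>i\<close> at \<open>\<zeta>\<close>, and the weights \<open>2 ^ (- i - 1)\<close> make these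
  costs summable.\<close>

lemma polar_barrier:
  fixes E :: "complex set" and q :: real
  assumes E: "compact E" and R: "R \<ge> 1" and q: "q \<ge> 0"
    and polar: "\<And>\<mu>. borel_prob_on E \<mu> \<Longrightarrow> energy R \<mu> \<mu> = \<top>"
  obtains \<nu> where "borel_prob_on (cball \<zeta> 1) \<nu>" "pot R \<nu> \<zeta> \<le> ennreal (ln R + 2)"
    "\<And>z. z \<in> E \<Longrightarrow> z \<noteq> \<zeta> \<Longrightarrow> dist z \<zeta> \<le> 1 \<Longrightarrow> ennreal q \<le> pot R \<nu> z"
proof -
  have R0: "R > 0" using R by simp
  define S where "S i = {w. (1/2) ^ Suc i \<le> dist w \<zeta> \<and> dist w \<zeta> \<le> (1/2) ^ i}" for i :: nat
  have S_closed: "closed (S i)" for i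
    unfolding S_def by (intro closed_Collect_conj closed_Collect_le continuous_intros)
  \<comment> \<open>The factor \<open>2 ^ Suc i\<close> compensates the weight that the geometric
    distribution gives to i.\<close>
  have "\<exists>\<nu>. borel_prob_on (S i) \<nu> \<and> (\<forall>z\<in>E \<inter> S i. ennreal (2 ^ Suc i * q) \<le> pot R \<nu> z)" for i
  proof (cases "E \<inter> S i = {}")
    case True
    \<comment> \<open>\<open>E\<close> misses this annulus, so any point mass in it serves as a
      placeholder.\<close>
    define x where "x = \<zeta> + of_real ((1/2) ^ i)"
    have x: "x \<in> S i" by (simp add: x_def S_def dist_norm norm_power norm_divide)
    have [measurable]: "S i \<in> sets borel" using S_closed by simp
    have "borel_prob_on (S i) (return borel x)"
      using x by (intro borel_prob_onI prob_space_return) (simp_all add: AE_return)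
    with True show ?thesis by auto
  next
    case False
    have c: "compact (E \<inter> S i)" using E S_closed by (intro compact_Int_closed)
    have "borel_prob_on E \<mu>" if "borel_prob_on (E \<inter> S i) \<mu>" for \<mu>
      using that compact_imp_closed[OF c] by (rule borel_prob_on_mono) auto
    then obtain \<nu> where "borel_prob_on (E \<inter> S i) \<nu>" "\<forall>z\<in>E \<inter> S i. ennreal (2 ^ Suc i * q) \<le> pot R \<nu> z"
      using polar_large_potential[OF c False R0] polar by blast
    moreover from this(1) have "borel_prob_on (S i) \<nu>"
      using compact_imp_closed[OF c] by (rule borel_prob_on_mono) auto
    ultimately show ?thesis by blast
  qed
  then obtain N where N: "\<And>i. borel_prob_on (S i) (N i)"
      "\<And>i z. z \<in> E \<Longrightarrow> z \<in> S i \<Longrightarrow> ennreal (2 ^ Suc i * q) \<le> pot R (N i) z"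
    by (metis IntI)
  note D = borel_prob_onD[OF N(1) S_closed]
  define \<nu> where "\<nu> = measure_pmf (geometric_pmf (1/2)) \<bind> N"
  have pr: "prob_space \<nu>" and s: "sets \<nu> = sets borel"
    unfolding \<nu>_def by (rule prob_space_bind_pmf_kernel[OF D(1,3)], rule sets_bind_pmf_kernel[OF D(1,3)])
  have nn: "(\<integral>\<^sup>+ w. f w \<partial>\<nu>) = (\<integral>\<^sup>+ i. (\<integral>\<^sup>+ w. f w \<partial>N i) \<partial>measure_pmf (geometric_pmf (1/2)))"
    if "f \<in> borel_measurable borel" for f
    unfolding \<nu>_def using D(1,3) that by (intro nn_integral_bind_pmf_kernel[where B=borel]) auto
  have pot_\<nu>: "pot R \<nu> z = (\<integral>\<^sup>+ i. pot R (N i) z \<partial>measure_pmf (geometric_pmf (1/2)))" for z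
    unfolding pot_def by (intro nn) measurable
  show ?thesis
  proof
    have [measurable]: "- cball \<zeta> 1 \<in> sets borel" by simp
    have sub: "S i \<subseteq> cball \<zeta> 1" for i
    proof
      fix w assume "w \<in> S i"
      then have "dist w \<zeta> \<le> (1/2) ^ i" by (simp add: S_def)
      also have "\<dots> \<le> 1" by (simp add: power_le_one)
      finally show "w \<in> cball \<zeta> 1" by (simp add: dist_commute)
    qed
    have "borel_prob_on (cball \<zeta> 1) (N i)" for i
      using N(1) S_closed sub by (rule borel_prob_on_mono)
    then have "emeasure (N i) (- cball \<zeta> 1) = 0" for i by (simp add: borel_prob_on_def)
    then have "emeasure \<nu> (- cball \<zeta> 1) = 0"
      using nn[of "indicator (- cball \<zeta> 1)"] D(3) s by (simp add: nn_integral_indicator)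
    then show "borel_prob_on (cball \<zeta> 1) \<nu>" using pr s by (simp add: borel_prob_on_def)
  next
    \<comment> \<open>Mass at distance at least 2^(- i - 1) costs at most ln R + (i + 1) ln 2 at
      \<zeta>. The geometric distribution counts from 0 and has mean 1, so averaging gives
      \<open>ln R + 2\<close>.\<close>
    have "pot R (N i) \<zeta> \<le> ennreal (ln R + 1 + real i)" for i
    proof -
      have "pot R (N i) \<zeta> \<le> log_kernel R ((1/2) ^ Suc i)"
        by (rule pot_le_of_far[OF D(1,3) R0]) (use D(5)[of i] in \<open>auto simp: S_def dist_commute elim!: eventually_mono\<close>)
      also have "\<dots> = ennreal (ln R + real (Suc i) * ln 2)"
        using R0 by (simp add: log_kernel_def ln_div ln_mult ln_realpow algebra_simps power_one_over del: power_Suc)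
      also have "\<dots> \<le> ennreal (ln R + 1 + real i)"
      proof (rule ennreal_leI)
        have "ln 2 \<le> (1::real)" using ln_le_minus_one[of 2] by simp
        then have "real (Suc i) * ln 2 \<le> real (Suc i) * 1" by (intro mult_left_mono) auto
        then show "ln R + real (Suc i) * ln 2 \<le> ln R + 1 + real i" by simp
      qed
      finally show ?thesis .
    qed
    then have "pot R \<nu> \<zeta> \<le> (\<integral>\<^sup>+ i. ennreal (ln R + 1 + real i) \<partial>measure_pmf (geometric_pmf (1/2)))"
      unfolding pot_\<nu> by (intro nn_integral_mono)
    also have "\<dots> = ennreal (ln R + 1 + 1)" using R by (intro nn_integral_geometric_pmf_half) simp
    finally show "pot R \<nu> \<zeta> \<le> ennreal (ln R + 2)" by (simp add: add.commute)
  next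
    fix z assume z: "z \<in> E" "z \<noteq> \<zeta>" "dist z \<zeta> \<le> 1"
    obtain i where "(1/2) ^ Suc i \<le> dist z \<zeta>" "dist z \<zeta> \<le> (1/2) ^ i"
      using dyadic_annulus[of "dist z \<zeta>"] z by auto
    then have zS: "z \<in> S i" by (simp add: S_def)
    have "ennreal q = ennreal (2 ^ Suc i * q) * ennreal ((1/2) ^ Suc i)"
      using q by (subst ennreal_mult[symmetric]) (auto simp: power_one_over)
    also have "\<dots> = (\<integral>\<^sup>+ j. ennreal (2 ^ Suc i * q) * indicator {i} j \<partial>measure_pmf (geometric_pmf (1/2)))"
      by (subst nn_integral_cmult_indicator) (auto simp: emeasure_pmf_single)
    also have "\<dots> \<le> pot R \<nu> z"
      unfolding pot_\<nu> using N(2)[OF z(1) zS] by (intro nn_integral_mono) (auto simp: indicator_def)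
    finally show "ennreal q \<le> pot R \<nu> z" .
  qed
qed

text \<open>Frostman's theorem without an exceptional set. Non-thinness speaks only of boundary
  points; at interior points of \<open>K\<close> the mean over a circle inside \<open>K\<close>
  takes its place.\<close>

lemma energy_le_pot_of_non_thin:
  assumes K: "non_thin_compact K" and \<omega>: "equilibrium_measure K \<omega>"
    and \<rho>: "\<rho> \<ge> 1" "\<And>z. z \<in> K \<Longrightarrow> norm z + 1 < \<rho>" and R: "R = 4 * \<rho>"
    and fin: "energy R \<omega> \<omega> < \<top>" and \<zeta>: "\<zeta> \<in> K"
  shows "energy R \<omega> \<omega> \<le> pot R \<omega> \<zeta>"
proof (rule ccontr)
  assume "\<not> energy R \<omega> \<omega> \<le> pot R \<omega> \<zeta>"
  then obtain q' where q': "pot R \<omega> \<zeta> < q'" "q' < energy R \<omega> \<omega>" using dense not_le by metis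
  obtain q where q: "q' = ennreal q" "q \<ge> 0" using q'(2) fin by (cases q') auto
  obtain p where p: "pot R \<omega> \<zeta> = ennreal p" "p \<ge> 0" using q'(1) by (cases "pot R \<omega> \<zeta>") auto
  have pq: "p < q" using q' p q by (simp add: ennreal_less_iff)
  have R1: "R \<ge> 1" "R > 0" using \<rho> R by auto
  have cK: "compact K" "closed K" using K by (auto simp: non_thin_compact_def compact_imp_closed)
  have \<omega>K: "borel_prob_on K \<omega>" using \<omega> by (simp add: equilibrium_measure_def)
  note D = borel_prob_onD[OF \<omega>K cK(2)]
  have dR: "dist z w + 1 \<le> R" if "norm z < \<rho>" "norm w < \<rho>" for z w :: complex
    using that dist_triangle3[of z w 0] \<rho>(1) by (simp add: R)
  have dK: "dist z w \<le> R" if "z \<in> K" "w \<in> K" for z w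
    using dR[of z w] \<rho>(2)[OF that(1)] \<rho>(2)[OF that(2)] by linarith
  define E where "E = K \<inter> {z. pot R \<omega> z \<le> ennreal q}"
  have E: "compact E" unfolding E_def
    using cK(1) by (intro compact_Int_closed closed_pot_le D R1)
  \<comment> \<open>A measure of finite energy on \<open>E\<close> would have mutual energy at most
    q with \<omega>, below the minimum allowed by the variational inequality.\<close>
  have polar: "energy R \<mu> \<mu> = \<top>" if \<mu>: "borel_prob_on E \<mu>" for \<mu>
  proof (rule ccontr)
    assume ne: "energy R \<mu> \<mu> \<noteq> \<top>"
    note M = borel_prob_onD[OF \<mu> compact_imp_closed[OF E]]
    interpret M: prob_space \<mu> by (rule M)
    have "borel_prob_on K \<mu>"
      using \<mu> compact_imp_closed[OF E] by (rule borel_prob_on_mono) (auto simp: E_def)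
    then have "energy R \<omega> \<omega> \<le> energy R \<omega> \<mu>"
      using ne fin by (intro equilibrium_variational[OF \<omega> cK(2) R1(2) dK]) (auto simp: less_top)
    also have "\<dots> \<le> (\<integral>\<^sup>+ z. ennreal q \<partial>\<mu>)"
      unfolding energy_def using M(5) by (intro nn_integral_mono_AE) (auto simp: E_def elim!: eventually_mono)
    also have "\<dots> < energy R \<omega> \<omega>" using q'(2) q by (simp add: M.emeasure_space_1)
    finally show False by simp
  qed
  \<comment> \<open>\<open>V\<close> bounds the barrier at \<zeta> whatever its height, so t can be
    fixed before the height \<open>q / t\<close>. The requirement t V + (1 - t) p < (1 - t) q
    amounts to t (V + q - p) < q - p, and t is half the critical value.\<close>
  define V where "V = ln R + 2"
  have V: "V > 0" using R1 by (simp add: V_def add_nonneg_pos)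
  define m where "m = V + (q - p)"
  define t where "t = (q - p) / (2 * m)"
  have m0: "m > 0" "q - p < 2 * m" using V pq by (simp_all add: m_def)
  have "t * m = (q - p) / 2" using m0 by (simp add: t_def)
  then have t: "0 < t" "t < 1" "t * (V + (q - p)) < q - p"
    using m0 pq by (simp_all add: t_def flip: m_def)
  obtain \<nu> where \<nu>: "borel_prob_on (cball \<zeta> 1) \<nu>" "pot R \<nu> \<zeta> \<le> ennreal V"
    "\<And>z. z \<in> E \<Longrightarrow> z \<noteq> \<zeta> \<Longrightarrow> dist z \<zeta> \<le> 1 \<Longrightarrow> ennreal (q / t) \<le> pot R \<nu> z"
    using polar_barrier[OF E R1(1), of "q / t" \<zeta>] polar q t unfolding V_def by auto
  note N = borel_prob_onD[OF \<nu>(1) closed_cball]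
  define \<alpha> where "\<alpha> = mixture t \<nu> \<omega>"
  have \<alpha>: "prob_space \<alpha>" "sets \<alpha> = sets borel"
    unfolding \<alpha>_def using prob_space_mixture[OF N(1) D(1) N(3) D(3)] sets_mixture[OF N(1) D(1) N(3) D(3)] by auto
  interpret \<alpha>: prob_space \<alpha> by (rule \<alpha>)
  have f\<alpha>: "finite_measure \<alpha>" by unfold_locales
  have pot_\<alpha>: "pot R \<alpha> z = ennreal t * pot R \<nu> z + ennreal (1 - t) * pot R \<omega> z" for z
    unfolding \<alpha>_def using t by (intro pot_mixture N D) auto
  \<comment> \<open>On \<open>E\<close> the barrier alone contributes t (q / t) = q; off
    \<open>E\<close> the share of \<omega> is at least (1 - t) q. The point \<zeta> belongs to
    \<open>E\<close> but is exempt.\<close>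
  have low: "ennreal ((1 - t) * q) \<le> pot R \<alpha> z" if z: "z \<in> K" "z \<noteq> \<zeta>" "dist z \<zeta> \<le> 1" for z
  proof (cases "z \<in> E")
    case True
    have "ennreal ((1 - t) * q) \<le> ennreal q" using t q by (intro ennreal_leI) (simp add: algebra_simps)
    also have "\<dots> = ennreal t * ennreal (q / t)" using t q by (subst ennreal_mult[symmetric]) auto
    also have "\<dots> \<le> ennreal t * pot R \<nu> z" by (intro mult_left_mono \<nu>(3) True z) auto
    also have "\<dots> \<le> pot R \<alpha> z" unfolding pot_\<alpha> by simp
    finally show ?thesis .
  next
    case False
    then have "ennreal q \<le> pot R \<omega> z" using z by (auto simp: E_def)
    have "ennreal ((1 - t) * q) = ennreal (1 - t) * ennreal q" using t q by (intro ennreal_mult) auto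
    also have "\<dots> \<le> ennreal (1 - t) * pot R \<omega> z" by (intro mult_left_mono \<open>ennreal q \<le> _\<close>) auto
    also have "\<dots> \<le> pot R \<alpha> z" unfolding pot_\<alpha> by simp
    finally show ?thesis .
  qed
  have high: "pot R \<alpha> \<zeta> < ennreal ((1 - t) * q)"
  proof -
    have "pot R \<alpha> \<zeta> \<le> ennreal t * ennreal V + ennreal (1 - t) * ennreal p"
      unfolding pot_\<alpha> p(1) by (intro add_mono mult_left_mono \<nu>(2)) auto
    also have "\<dots> = ennreal (t * V + (1 - t) * p)"
      using t V p by (simp add: ennreal_mult)
    also have "\<dots> < ennreal ((1 - t) * q)"
    proof -
      have "0 \<le> t * V + (1 - t) * p" using t V p by (intro add_nonneg_nonneg mult_nonneg_nonneg) auto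
      moreover have "t * V + (1 - t) * p < (1 - t) * q" using t(3) by (simp add: algebra_simps)
      ultimately show ?thesis by (simp only: ennreal_less_iff)
    qed
    finally show ?thesis .
  qed
  have supp: "AE w in \<alpha>. w \<in> ball 0 \<rho>"
  proof -
    have sub: "K \<subseteq> ball 0 \<rho>" using \<rho>(2) by force
    have K': "borel_prob_on (cball 0 (norm \<zeta> + 1) \<union> K) \<omega>"
      using \<omega>K cK(2) by (rule borel_prob_on_mono) auto
    have N': "borel_prob_on (cball 0 (norm \<zeta> + 1) \<union> K) \<nu>"
    proof (rule borel_prob_on_mono)
      have "cball \<zeta> 1 \<subseteq> cball 0 (norm \<zeta> + 1)" by (simp add: cball_subset_cball_iff dist_norm)
      then show "cball \<zeta> 1 \<subseteq> cball 0 (norm \<zeta> + 1) \<union> K" by blast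
    qed (use \<nu>(1) in auto)
    have cl: "closed (cball 0 (norm \<zeta> + 1) \<union> K)" using cK by auto
    have "borel_prob_on (cball 0 (norm \<zeta> + 1) \<union> K) \<alpha>"
      unfolding \<alpha>_def using t by (intro borel_prob_on_mixture[OF N' K' cl]) auto
    from borel_prob_onD(5)[OF this cl] show ?thesis
      by eventually_elim (use \<rho>(2)[OF \<zeta>] sub in auto)
  qed
  have \<zeta>\<rho>: "norm \<zeta> + 1 < \<rho>" by (rule \<rho>(2)[OF \<zeta>])
  have lp: "log_potential \<alpha> z = ereal (ln R) - enn2ereal (pot R \<alpha> z)" if z: "z \<in> ball 0 \<rho>" for z
  proof -
    have "AE w in \<alpha>. dist z w \<le> R"
      using supp by eventually_elim (use dR[of z] z in force)
    from log_potential_eq[OF f\<alpha> \<alpha>(2) R1(2) this] show ?thesis by (simp add: \<alpha>.prob_space)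
  qed
  show False
  proof (cases "\<zeta> \<in> interior K")
    case True
    then obtain e where e: "e > 0" "cball \<zeta> e \<subseteq> K" by (meson mem_interior_cball)
    define r where "r = min e 1"
    have r: "r > 0" "r \<le> 1" "cball \<zeta> r \<subseteq> K" using e by (auto simp: r_def)
    have "AE w in \<alpha>. dist \<zeta> w + r \<le> R"
      using supp by eventually_elim (use dR[of \<zeta>] \<zeta>\<rho> r in force)
    from pot_circle_mean[OF f\<alpha> \<alpha>(2) r(1) R1(2) this]
    have "circle_mean r (pot R \<alpha>) \<zeta> \<le> pot R \<alpha> \<zeta>" by (metis le_iff_add)
    moreover have "circle_mean r (\<lambda>_. ennreal ((1 - t) * q)) \<zeta> \<le> circle_mean r (pot R \<alpha>) \<zeta>"
    proof (intro circle_mean_mono low)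
      fix t show "\<zeta> + rcis r t \<in> K" using r by (intro subsetD[OF r(3)]) (simp add: dist_norm)
    qed (use r in \<open>auto simp: dist_norm rcis_def norm_mult\<close>)
    ultimately show False using high by (simp add: circle_mean_const)
  next
    case False
    then have "\<zeta> \<in> frontier K" using \<zeta> cK by (simp add: frontier_def)
    then have "non_thin_at K \<zeta>" using K by (simp add: non_thin_compact_def)
    moreover have "\<zeta> \<in> ball 0 \<rho>" using \<zeta>\<rho> by simp
    ultimately have L: "Limsup (at \<zeta> within K) (log_potential \<alpha>) = log_potential \<alpha> \<zeta>"
      using subharmonic_on_log_potential[OF \<alpha> supp] unfolding non_thin_at_def by blast
    have "Limsup (at \<zeta> within K) (log_potential \<alpha>) \<le> ereal (ln R - (1 - t) * q)"
    proof (rule Limsup_bounded)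
      show "\<forall>\<^sub>F z in at \<zeta> within K. log_potential \<alpha> z \<le> ereal (ln R - (1 - t) * q)"
        unfolding eventually_at
      proof (intro exI[of _ 1] conjI ballI impI)
        fix z assume z: "z \<in> K" "z \<noteq> \<zeta> \<and> dist z \<zeta> < 1"
        have "log_potential \<alpha> z = ereal (ln R) - enn2ereal (pot R \<alpha> z)"
          using \<rho>(2)[OF z(1)] by (intro lp) simp
        also have "\<dots> \<le> ereal (ln R) - enn2ereal (ennreal ((1 - t) * q))"
          unfolding ereal_minus_enn2ereal_le_iff using z by (intro low) auto
        finally show "log_potential \<alpha> z \<le> ereal (ln R - (1 - t) * q)"
          using t q by (simp add: enn2ereal_ennreal)
      qed simp
    qed
    also have "\<dots> = ereal (ln R) - enn2ereal (ennreal ((1 - t) * q))"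
      using t q by (simp add: enn2ereal_ennreal)
    finally have "ereal (ln R) - enn2ereal (pot R \<alpha> \<zeta>) \<le> ereal (ln R) - enn2ereal (ennreal ((1 - t) * q))"
      unfolding L using lp[of \<zeta>] \<zeta>\<rho> by simp
    then show False using high unfolding ereal_minus_enn2ereal_le_iff by simp
  qed
qed

section \<open>Level sets and conformal pullback\<close>

lemma open_log_potential_less:
  assumes pr: "prob_space \<alpha>" and s: "sets \<alpha> = sets borel" and sup: "AE w in \<alpha>. norm w \<le> M"
  shows "open {z. log_potential \<alpha> z < c}"
proof -
  have "open {z \<in> ball 0 (M + real (Suc n)). log_potential \<alpha> z < c}" for n
  proof -
    have "AE w in \<alpha>. w \<in> ball 0 (M + real (Suc n))"
      using sup by eventually_elim simp
    then show ?thesis using subharmonic_on_log_potential[OF pr s] by (simp add: subharmonic_on_def)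
  qed
  then have "open (\<Union>n. {z \<in> ball 0 (M + real (Suc n)). log_potential \<alpha> z < c})" by blast
  moreover have "\<exists>n. norm z < M + real (Suc n)" for z :: complex
    using reals_Archimedean2[of "norm z - M"] by (metis add.commute diff_less_eq less_trans lessI of_nat_less_iff)
  then have "(\<Union>n. {z \<in> ball 0 (M + real (Suc n)). log_potential \<alpha> z < c}) = {z. log_potential \<alpha> z < c}"
    by auto
  ultimately show ?thesis by simp
qed

lemma log_kernel_le_add:
  assumes "0 < a" "0 < R" "b \<ge> a * exp (- \<epsilon>)" "\<epsilon> \<ge> 0"
  shows "log_kernel R b \<le> log_kernel R a + ennreal \<epsilon>"
proof -
  have b: "b > 0" using assms(1,3) by (meson exp_gt_zero less_le_trans mult_pos_pos)
  have "ln (a * exp (- \<epsilon>)) \<le> ln b" using assms b by (intro ln_mono) auto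
  then have "ln (R / b) \<le> ln (R / a) + \<epsilon>" using assms b by (simp add: ln_div ln_mult)
  then have "ennreal (ln (R / b)) \<le> ennreal (max 0 (ln (R / a)) + \<epsilon>)" by (intro ennreal_leI) simp
  also have "\<dots> = ennreal (ln (R / a)) + ennreal \<epsilon>" using assms by (simp add: ennreal_max_0)
  finally show ?thesis using assms b by (simp add: log_kernel_def)
qed

text \<open>Off \<open>K\<close> the kernel has no pole. Moving \<open>z0\<close> by less than the
  fraction 1 - exp (- \<epsilon>) of its distance to \<open>K\<close> shrinks distances to points of
  \<open>K\<close> by no more than the factor exp (- \<epsilon>), so \<open>pot\<close> grows by at
  most \<epsilon>.\<close>

lemma open_log_potential_greater:
  assumes pr: "prob_space \<alpha>" and s: "sets \<alpha> = sets borel" and sup: "AE w in \<alpha>. w \<in> K" and K: "compact K"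
  shows "open {z. z \<notin> K \<and> ereal c < log_potential \<alpha> z}"
  unfolding open_dist
proof
  interpret prob_space \<alpha> by fact
  have fin: "finite_measure \<alpha>" by unfold_locales
  fix z0 assume "z0 \<in> {z. z \<notin> K \<and> ereal c < log_potential \<alpha> z}"
  then have z0: "z0 \<notin> K" "ereal c < log_potential \<alpha> z0" by auto
  obtain d where d: "d > 0" "\<And>w. w \<in> K \<Longrightarrow> d \<le> dist z0 w"
    using separate_point_closed[OF compact_imp_closed[OF K] z0(1)] by blast
  obtain M where M: "M > 0" "\<And>w. w \<in> K \<Longrightarrow> norm w \<le> M"
    using compact_imp_bounded[OF K] by (auto simp: bounded_pos)
  define R where "R = norm z0 + M + d"
  have R: "R > 0" using d M by (simp add: R_def add_nonneg_pos)
  have dR: "dist z w \<le> R" if "dist z z0 < d" "w \<in> K" for z w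
    using dist_triangle3[of z w z0] dist_triangle3[of z0 w 0] M(2)[OF that(2)] that(1)
    by (simp add: R_def dist_commute)
  have lp: "log_potential \<alpha> z = ereal (ln R) - enn2ereal (pot R \<alpha> z)" if z: "dist z z0 < d" for z
  proof -
    have "AE w in \<alpha>. dist z w \<le> R" using sup by eventually_elim (rule dR[OF z])
    from log_potential_eq[OF fin s R this] show ?thesis by (simp add: prob_space)
  qed
  have "pot R \<alpha> z0 \<noteq> \<top>" using z0(2) d unfolding lp[of z0, simplified, OF d(1)] by auto
  then obtain p where p: "pot R \<alpha> z0 = ennreal p" "p \<ge> 0" by (cases "pot R \<alpha> z0") auto
  define \<epsilon> where "\<epsilon> = (ln R - p - c) / 2"
  have \<epsilon>: "\<epsilon> > 0" "c + p + \<epsilon> < ln R"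
    using z0(2) d p unfolding lp[of z0, simplified, OF d(1)] by (auto simp: \<epsilon>_def enn2ereal_ennreal field_simps)
  define e where "e = min d (d * (1 - exp (- \<epsilon>)))"
  have e: "e > 0" "e \<le> d" "e \<le> d * (1 - exp (- \<epsilon>))" using d \<epsilon> by (auto simp: e_def)
  have in_set: "z \<notin> K \<and> ereal c < log_potential \<alpha> z" if z: "dist z z0 < e" for z
  proof
    show "z \<notin> K" using d(2)[of z] z e by (auto simp: dist_commute)
    have "pot R \<alpha> z \<le> (\<integral>\<^sup>+ w. log_kernel R (dist z0 w) + ennreal \<epsilon> \<partial>\<alpha>)"
      unfolding pot_def
    proof (rule nn_integral_mono_AE)
      show "AE w in \<alpha>. log_kernel R (dist z w) \<le> log_kernel R (dist z0 w) + ennreal \<epsilon>"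
        using sup
      proof eventually_elim
        case (elim w)
        have D: "d \<le> dist z0 w" by (rule d(2)[OF elim])
        have "e \<le> dist z0 w * (1 - exp (- \<epsilon>))"
          using e(3) D \<epsilon> by (meson diff_ge_0_iff_ge exp_le_one_iff less_imp_le mult_right_mono neg_le_0_iff_le order_trans)
        moreover have "dist z0 w \<le> dist z w + dist z z0" by (metis add.commute dist_commute dist_triangle)
        ultimately have "dist z0 w * exp (- \<epsilon>) \<le> dist z w" using z by (simp add: algebra_simps)
        then show ?case using d D \<epsilon> R by (intro log_kernel_le_add) auto
      qed
    qed
    also have "\<dots> = ennreal (p + \<epsilon>)"
    proof -
      have [measurable]: "(\<lambda>w. log_kernel R (dist z0 w)) \<in> borel_measurable \<alpha>"
        using s by (simp cong: measurable_cong_sets)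
      show ?thesis using p \<epsilon> unfolding pot_def by (subst nn_integral_add) (auto simp: emeasure_space_1)
    qed
    finally have "ereal (ln R) - enn2ereal (ennreal (p + \<epsilon>)) \<le> log_potential \<alpha> z"
      using z e by (subst lp) (auto simp: ereal_minus_enn2ereal_le_iff)
    moreover have "ereal c < ereal (ln R) - enn2ereal (ennreal (p + \<epsilon>))"
      using p \<epsilon> by (simp add: enn2ereal_ennreal del: ennreal_plus)
    ultimately show "ereal c < log_potential \<alpha> z" by (rule less_le_trans[rotated])
  qed
  show "\<exists>e>0. \<forall>z. dist z z0 < e \<longrightarrow> z \<in> {z. z \<notin> K \<and> ereal c < log_potential \<alpha> z}"
    using e(1) in_set by blast
qed

section \<open>Circle means of potentials and of their conformal pullbacks\<close>

text \<open>Although the kernel is unbounded, its mean is ln R minus the logarithm of the larger of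
  |u - w| and r, uniformly bounded in w.\<close>

lemma circle_mean_log_kernel_bounded:
  assumes r: "r > 0" and R: "R > 0" and le: "dist u w + r \<le> R"
  shows "circle_mean r (\<lambda>z. log_kernel R (dist z w)) u \<le> ennreal (ln (R / r))"
proof (cases "u = w")
  case True
  have "circle_mean r (\<lambda>z. log_kernel R (dist z w)) u \<le> circle_mean r (\<lambda>z. ennreal (ln (R / r))) u"
    using r True by (intro circle_mean_mono) (simp add: log_kernel_def dist_norm)
  then show ?thesis by (simp add: circle_mean_const)
next
  case False
  have "circle_mean r (\<lambda>z. log_kernel R (norm ((z - w) * 1))) u + log_kernel r (dist u w) = log_kernel R (norm ((u - w) * 1))"
  proof (rule circle_mean_log_kernel[where F="\<lambda>_. 1" and r'="r + 1"])
    fix z assume z: "z \<in> cball u r"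
    have "dist z w \<le> dist u z + dist u w" by (rule dist_triangle3)
    then show "norm ((z - w) * 1) \<le> R" using z le by (simp add: dist_norm)
  qed (use r R in auto)
  then have eq: "circle_mean r (\<lambda>z. log_kernel R (dist z w)) u + log_kernel r (dist u w) = log_kernel R (dist u w)"
    by (simp add: dist_norm)
  define d where "d = dist u w"
  have d: "d > 0" using False by (simp add: d_def)
  show ?thesis
  proof (cases "d \<ge> r")
    case True
    have "circle_mean r (\<lambda>z. log_kernel R (dist z w)) u \<le> log_kernel R d"
      using eq unfolding d_def by (metis le_iff_add)
    also have "\<dots> \<le> log_kernel R r" using True r R by (intro log_kernel_antimono) auto
    finally show ?thesis using r by (simp add: log_kernel_def)
  next
    case False
    have "r \<le> R" using le zero_le_dist[of u w] by linarith
    then have "0 \<le> ln (r / d)" "0 \<le> ln (R / r)" using False d r by (auto intro!: ln_ge_zero)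
    moreover have "ln (R / d) = ln (R / r) + ln (r / d)" using d r R by (simp add: ln_div)
    ultimately have "log_kernel R d = ennreal (ln (R / r)) + log_kernel r d"
      using d by (simp add: log_kernel_def)
    then have "circle_mean r (\<lambda>z. log_kernel R (dist z w)) u + log_kernel r d = ennreal (ln (R / r)) + log_kernel r d"
      using eq unfolding d_def by simp
    moreover have "log_kernel r d \<noteq> \<top>" using d by (simp add: log_kernel_def)
    ultimately show ?thesis by (simp add: ennreal_add_left_cancel add.commute[of _ "log_kernel r d"])
  qed
qed

text \<open>Permits cancelling a mean even when the potential at the centre is infinite.\<close>

lemma circle_mean_pot_finite:
  assumes pr: "prob_space \<alpha>" and s[measurable_cong]: "sets \<alpha> = sets borel" and r: "r > 0" and R: "R > 0"
    and le: "AE w in \<alpha>. dist u w + r \<le> R"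
  shows "circle_mean r (pot R \<alpha>) u < \<top>"
proof -
  interpret prob_space \<alpha> by fact
  have "circle_mean r (pot R \<alpha>) u = (\<integral>\<^sup>+ w. circle_mean r (\<lambda>z. log_kernel R (dist z w)) u \<partial>\<alpha>)"
    unfolding pot_def[abs_def] by (rule circle_mean_nn_integral) (unfold_locales, measurable)
  also have "\<dots> \<le> (\<integral>\<^sup>+ w. ennreal (ln (R / r)) \<partial>\<alpha>)"
    using le by (intro nn_integral_mono_AE) (auto elim!: eventually_mono intro!: circle_mean_log_kernel_bounded r R)
  also have "\<dots> < \<top>" by (simp add: emeasure_space_1)
  finally show ?thesis .
qed

lemma circle_mean_affine:
  assumes [measurable]: "(\<lambda>t. f (u + rcis r t)) \<in> borel_measurable borel"
  shows "circle_mean r (\<lambda>z. c * f z + a) u = c * circle_mean r f u + a"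
proof -
  have "(\<integral>\<^sup>+ t. (c * f (u + rcis r t) + a) * indicator {0..2 * pi} t \<partial>lborel)
     = (\<integral>\<^sup>+ t. c * (f (u + rcis r t) * indicator {0..2 * pi} t) + a * indicator {0..2 * pi} t \<partial>lborel)"
    by (simp add: distrib_right mult.assoc)
  also have "\<dots> = c * (\<integral>\<^sup>+ t. f (u + rcis r t) * indicator {0..2 * pi} t \<partial>lborel) + (\<integral>\<^sup>+ t. a * indicator {0..2 * pi} t \<partial>lborel)"
    by (subst nn_integral_add) (auto simp: nn_integral_cmult)
  finally have "circle_mean r (\<lambda>z. c * f z + a) u = c * circle_mean r f u + circle_mean r (\<lambda>_. a) u"
    unfolding circle_mean_def by (simp add: distrib_left mult.left_commute)
  then show ?thesis by (simp add: circle_mean_const)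
qed

lemma circle_mean_cong:
  assumes "\<And>t. f (u + rcis r t) = g (u + rcis r t)"
  shows "circle_mean r f u = circle_mean r g u"
  unfolding circle_mean_def using assms by simp

text \<open>\<open>F\<close> is the difference quotient of \<psi> at y with the derivative filled
  in: holomorphic since the singularity is removable, and zero-free by injectivity away from y and
  because an injective holomorphic map has nonzero derivative at y.\<close>

lemma circle_mean_pullback_kernel:
  assumes holo: "\<psi> holomorphic_on ball u r'" and inj: "inj_on \<psi> (ball u r')"
    and r: "0 < r" "r < r'" and R: "R > 0" and le: "\<And>z. z \<in> ball u r' \<Longrightarrow> dist (\<psi> z) w \<le> R"
    and y: "y \<in> ball u r'" "\<psi> y = w"
  shows "circle_mean r (\<lambda>z. log_kernel R (dist (\<psi> z) w)) u + log_kernel r (dist u y) = log_kernel R (dist (\<psi> u) w)"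
proof -
  define F where "F z = (if z = y then deriv \<psi> y else (\<psi> z - w) / (z - y))" for z
  have eq: "\<psi> z - w = (z - y) * F z" if "z \<in> ball u r'" for z
    using y by (simp add: F_def)
  have dne: "deriv \<psi> y \<noteq> 0" by (rule holomorphic_injective_imp_regular[OF holo open_ball inj y(1)])
  have F_holo: "F holomorphic_on ball u r'"
  proof (rule pole_theorem_open_0[where g="\<lambda>z. \<psi> z - w" and a=y])
    show "(\<lambda>z. \<psi> z - w) holomorphic_on ball u r'" by (intro holomorphic_intros holo)
    have "\<psi> field_differentiable at y"
      using holo y(1) holomorphic_on_imp_differentiable_at open_ball by blast
    then show "F y = deriv (\<lambda>z. \<psi> z - w) y" by (simp add: F_def)
  qed (use eq y in auto)
  have F_ne: "F z \<noteq> 0" if z: "z \<in> ball u r'" for z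
  proof (cases "z = y")
    case False
    then have "\<psi> z \<noteq> w" using inj z y by (auto dest: inj_onD)
    then show ?thesis using False by (simp add: F_def)
  qed (simp add: F_def dne)
  have sub: "cball u r \<subseteq> ball u r'" using r by auto
  have "circle_mean r (\<lambda>z. log_kernel R (norm ((z - y) * F z))) u + log_kernel r (dist u y) = log_kernel R (norm ((u - y) * F u))"
  proof (rule circle_mean_log_kernel[OF F_holo F_ne r R])
    fix z assume "z \<in> cball u r"
    then have z: "z \<in> ball u r'" using sub by blast
    show "norm ((z - y) * F z) \<le> R" using le[OF z] by (simp add: eq[OF z] dist_norm)
  qed
  moreover have "circle_mean r (\<lambda>z. log_kernel R (norm ((z - y) * F z))) u = circle_mean r (\<lambda>z. log_kernel R (dist (\<psi> z) w)) u"
  proof (rule circle_mean_cong)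
    fix t
    have "u + rcis r t \<in> ball u r'" using r by (simp add: dist_norm)
    from eq[OF this] show "log_kernel R (norm ((u + rcis r t - y) * F (u + rcis r t))) = log_kernel R (dist (\<psi> (u + rcis r t)) w)"
      by (simp only: dist_norm)
  qed
  moreover have "u \<in> ball u r'" using r by simp
  from eq[OF this] have "norm ((u - y) * F u) = dist (\<psi> u) w" by (simp only: dist_norm)
  ultimately show ?thesis by simp
qed

lemma circle_mean_pullback_kernel_omit:
  assumes holo: "\<psi> holomorphic_on ball u r'"
    and r: "0 < r" "r < r'" and R: "R > 0" and le: "\<And>z. z \<in> ball u r' \<Longrightarrow> dist (\<psi> z) w \<le> R"
    and w: "w \<notin> \<psi> ` ball u r'"
  shows "circle_mean r (\<lambda>z. log_kernel R (dist (\<psi> z) w)) u = log_kernel R (dist (\<psi> u) w)"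
proof -
  have sub: "cball u r \<subseteq> ball u r'" using r by auto
  have "circle_mean r (\<lambda>z. log_kernel R (norm (\<psi> z - w))) u = log_kernel R (norm (\<psi> u - w))"
  proof (rule circle_mean_log_kernel_nonzero[OF _ _ r R])
    show "(\<lambda>z. \<psi> z - w) holomorphic_on ball u r'" by (intro holomorphic_intros holo)
    show "norm (\<psi> z - w) \<le> R" if "z \<in> cball u r" for z
      using le[of z] sub that by (auto simp: dist_norm)
  qed (use w in auto)
  then show ?thesis by (simp add: dist_norm)
qed

text \<open>Points \<open>w\<close> outside the image of the ball give no correction on either side:
  such \<open>w\<close> lies outside \<open>W\<close>, or \<open>\<phi> w\<close> lies outside the
  ball of radius r', farther than r from u.\<close>

lemma circle_mean_pullback_pot:
  assumes pr: "prob_space \<omega>" and s[measurable_cong]: "sets \<omega> = sets borel" and K: "AE w in \<omega>. w \<in> K" "K \<in> sets borel"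
    and W: "open W" and \<phi>: "continuous_on W \<phi>" "inj_on \<phi> W"
    and holo: "\<psi> holomorphic_on ball u r'" and \<psi>W: "\<And>z. z \<in> ball u r' \<Longrightarrow> \<psi> z \<in> W"
    and inv: "\<And>z. z \<in> ball u r' \<Longrightarrow> \<phi> (\<psi> z) = z"
    and r: "0 < r" "r < r'" and R: "R > 0" and le: "\<And>z w. z \<in> ball u r' \<Longrightarrow> w \<in> K \<Longrightarrow> dist (\<psi> z) w \<le> R"
  shows "circle_mean r (\<lambda>z. pot R \<omega> (\<psi> z)) u + (\<integral>\<^sup>+ w. log_kernel r (dist u (\<phi> w)) * indicator (K \<inter> W) w \<partial>\<omega>)
    = pot R \<omega> (\<psi> u)"
proof -
  interpret prob_space \<omega> by fact
  have zt: "u + rcis r t \<in> ball u r'" for t using r by (simp add: dist_norm)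
  have "continuous_on UNIV (\<lambda>t. \<psi> (u + rcis r t))"
  proof (rule continuous_on_compose2[OF holomorphic_on_imp_continuous_on[OF holo]])
    show "continuous_on UNIV (\<lambda>t. u + rcis r t)"
      unfolding rcis_def cis_conv_exp by (intro continuous_intros)
  qed (use zt in auto)
  then have [measurable]: "(\<lambda>t. \<psi> (u + rcis r t)) \<in> borel_measurable borel"
    by (rule borel_measurable_continuous_onI)
  have [measurable]: "W \<in> sets borel" "K \<in> sets borel" using W K by auto
  \<comment> \<open>Extending \<phi> by 0 outside \<open>W\<close> makes it Borel on the plane; the
    indicator of \<open>K \<inter> W\<close> hides the change.\<close>
  define \<phi>' where "\<phi>' w = indicator W w *\<^sub>R \<phi> w" for w
  have [measurable]: "\<phi>' \<in> borel_measurable borel"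
    unfolding \<phi>'_def[abs_def] using \<phi>(1) by (intro borel_measurable_continuous_on_indicator) auto
  have ind: "log_kernel r (dist u (\<phi> w)) * indicator (K \<inter> W) w = log_kernel r (dist u (\<phi>' w)) * indicator (K \<inter> W) w" for w
    by (simp add: \<phi>'_def indicator_def)
  have pw: "circle_mean r (\<lambda>z. log_kernel R (dist (\<psi> z) w)) u + log_kernel r (dist u (\<phi>' w)) * indicator (K \<inter> W) w
      = log_kernel R (dist (\<psi> u) w)" if w: "w \<in> K" for w
  proof (cases "w \<in> \<psi> ` ball u r'")
    case True
    then obtain y where y: "y \<in> ball u r'" "\<psi> y = w" by blast
    have "inj_on \<psi> (ball u r')" by (rule inj_on_inverseI[where g=\<phi>]) (rule inv)
    note circle_mean_pullback_kernel[OF holo this r R le[OF _ w] y]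
    moreover have "w \<in> W" "\<phi>' w = y" using y \<psi>W[OF y(1)] inv[OF y(1)] by (auto simp: \<phi>'_def)
    ultimately show ?thesis using w by simp
  next
    case False
    have "log_kernel r (dist u (\<phi> w)) = 0" if "w \<in> W"
    proof -
      have "\<phi> w \<notin> ball u r'"
      proof
        assume b: "\<phi> w \<in> ball u r'"
        have "\<psi> (\<phi> w) = w" using inj_onD[OF \<phi>(2) inv[OF b] \<psi>W[OF b] that] .
        then show False using False b by force
      qed
      then have "dist u (\<phi> w) > r" using r by simp
      then show ?thesis using r by (auto simp: log_kernel_def intro!: ennreal_neg ln_le_zero_iff[THEN iffD2])
    qed
    then have "log_kernel r (dist u (\<phi>' w)) * indicator (K \<inter> W) w = 0"
      by (simp add: \<phi>'_def indicator_def)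
    then show ?thesis
      using circle_mean_pullback_kernel_omit[OF holo r R le[OF _ w] False] by simp
  qed
  have "circle_mean r (\<lambda>z. pot R \<omega> (\<psi> z)) u = (\<integral>\<^sup>+ w. circle_mean r (\<lambda>z. log_kernel R (dist (\<psi> z) w)) u \<partial>\<omega>)"
    unfolding pot_def by (rule circle_mean_nn_integral) (unfold_locales, measurable)
  moreover have [measurable]: "(\<lambda>w. circle_mean r (\<lambda>z. log_kernel R (dist (\<psi> z) w)) u) \<in> borel_measurable \<omega>"
    unfolding circle_mean_def by measurable
  ultimately have "circle_mean r (\<lambda>z. pot R \<omega> (\<psi> z)) u + (\<integral>\<^sup>+ w. log_kernel r (dist u (\<phi> w)) * indicator (K \<inter> W) w \<partial>\<omega>)
      = (\<integral>\<^sup>+ w. circle_mean r (\<lambda>z. log_kernel R (dist (\<psi> z) w)) u + log_kernel r (dist u (\<phi>' w)) * indicator (K \<inter> W) w \<partial>\<omega>)"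
    unfolding ind by (simp add: nn_integral_add)
  also have "\<dots> = pot R \<omega> (\<psi> u)"
    unfolding pot_def
  proof (rule nn_integral_cong_AE)
    show "AE w in \<omega>. circle_mean r (\<lambda>z. log_kernel R (dist (\<psi> z) w)) u + log_kernel r (dist u (\<phi>' w)) * indicator (K \<inter> W) w
        = log_kernel R (dist (\<psi> u) w)"
      using K(1) by eventually_elim (rule pw)
  qed
  finally show ?thesis .
qed

section \<open>Green's functions in terms of the nonnegative kernel\<close>

text \<open>Clears the negative terms from the relation between two Green's functions. If
  \<open>y\<close> is infinite, then either c > 0 and \<open>x\<close> is infinite too, or c = 0 and
  the convention that 0 times -infinity is 0 gives \<open>x = ennreal e\<close>.\<close>

lemma green_identity_ennreal:
  assumes "0 \<le> c" "0 \<le> e" "0 \<le> f"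
    and "(ereal a - enn2ereal x) - (ereal a - enn2ereal (ennreal e)) = ereal c * ((ereal b - enn2ereal y) - (ereal b - enn2ereal (ennreal f)))"
  shows "x + ennreal (c * f) = ennreal c * y + ennreal e"
proof (cases "y = \<top>")
  case True
  show ?thesis
  proof (cases "c = 0")
    case True
    then have "x = ennreal e" using assms by (cases x) (auto simp: enn2ereal_ennreal simp flip: zero_ereal_def)
    then show ?thesis using True by simp
  next
    case False
    then have "x = \<top>" using assms True by (cases x) (auto simp: enn2ereal_ennreal)
    then show ?thesis using True False assms by (simp add: ennreal_mult_top)
  qed
next
  case False
  then obtain y' where y: "y = ennreal y'" "y' \<ge> 0" by (cases y) auto
  then obtain x' where x: "x = ennreal x'" "x' \<ge> 0" using assms by (cases x) (auto simp: enn2ereal_ennreal)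
  have "x' + c * f = c * y' + e" using assms x y by (simp add: enn2ereal_ennreal algebra_simps)
  then show ?thesis using x y assms(1-3) by (simp flip: ennreal_plus ennreal_mult)
qed

text \<open>One value of \<open>g\<close> other than \<infinity> rules out infinite energy, since
  subtracting a \<open>log_energy\<close> of -infinity would give \<infinity> everywhere. Uniqueness
  then identifies the measure hidden in \<open>greens_function\<close> with the given one.\<close>

lemma greens_function_normal_form:
  assumes g: "greens_function K g" and K: "closed K" and R: "R > 0"
    and d: "\<And>z w. z \<in> K \<Longrightarrow> w \<in> K \<Longrightarrow> dist z w \<le> R" and ne: "g (Some z0) \<noteq> \<infinity>"
    and \<omega>: "equilibrium_measure K \<omega>"
  shows "energy R \<omega> \<omega> < \<top>" "\<And>z. g (Some z) = log_potential \<omega> z - log_energy \<omega>"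
proof -
  obtain \<omega>' where \<omega>': "equilibrium_measure K \<omega>'" "\<And>z. g (Some z) = log_potential \<omega>' z - log_energy \<omega>'"
    using g unfolding greens_function_def by blast
  have p: "borel_prob_on K \<omega>'" "borel_prob_on K \<omega>" using \<omega>' \<omega> by (auto simp: equilibrium_measure_def)
  have fin: "energy R \<omega>' \<omega>' < \<top>"
  proof (rule ccontr)
    assume "\<not> energy R \<omega>' \<omega>' < \<top>"
    then have "log_energy \<omega>' = - \<infinity>" using log_energy_eq[OF p(1) K R d] by (simp add: less_top[symmetric])
    then show False using ne \<omega>'(2)[of z0] by simp
  qed
  then have "\<omega>' = \<omega>" by (intro equilibrium_unique[OF \<omega>'(1) \<omega> K R d])
  then show "energy R \<omega> \<omega> < \<top>" "\<And>z. g (Some z) = log_potential \<omega> z - log_energy \<omega>"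
    using fin \<omega>'(2) by auto
qed

theorem corollary2:
  fixes K :: "complex set" and \<omega> :: "complex measure" and g :: "complex option \<Rightarrow> ereal"
    and l :: real and n :: nat and W :: "nat \<Rightarrow> complex set"
    and \<phi> :: "nat \<Rightarrow> complex \<Rightarrow> complex"
    and gh :: "nat \<Rightarrow> complex option \<Rightarrow> ereal" and \<omega>h :: "nat \<Rightarrow> complex measure"
  assumes K: "non_thin_compact K"
    and g: "greens_function K g"
    and \<omega>: "equilibrium_measure K \<omega>"
    and l: "l > 0"
    and W: "bij_betw W {1..n} {C \<in> components {z. g (Some z) \<noteq> ereal l}. bounded C}"
    and univalent: "\<And>j. j \<in> {1..n} \<Longrightarrow> univalent_on (\<phi> j) (W j)"
    and Kh: "\<And>j. j \<in> {1..n} \<Longrightarrow> non_thin_compact (\<phi> j ` (K \<inter> W j))"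
    and gh: "\<And>j. j \<in> {1..n} \<Longrightarrow> greens_function (\<phi> j ` (K \<inter> W j)) (gh j)"
    and gh_eq: "\<And>j z. j \<in> {1..n} \<Longrightarrow> z \<in> \<phi> j ` W j \<Longrightarrow>
      gh j (Some z) = ereal (1 / measure \<omega> (K \<inter> W j)) * g (Some (inv_into (W j) (\<phi> j) z))"
    and \<omega>h: "\<And>j. j \<in> {1..n} \<Longrightarrow> equilibrium_measure (\<phi> j ` (K \<inter> W j)) (\<omega>h j)"
  shows "\<forall>j\<in>{1..n}. \<omega>h j =
    scale_measure (ennreal (1 / measure \<omega> (K \<inter> W j)))
      (distr (restrict_space \<omega> (K \<inter> W j)) borel (\<phi> j))"
proof
  fix j assume j: "j \<in> {1..n}"
  define V where "V = W j"
  define f where "f = \<phi> j"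
  define h where "h = inv_into V f"
  define Q where "Q = f ` (K \<inter> V)"
  define \<nu> where "\<nu> = \<omega>h j"
  \<comment> \<open>Division by zero would make this 0; the argument uses only
    \<open>c \<ge> 0\<close> and makes no case distinction.\<close>
  define c where "c = 1 / measure \<omega> (K \<inter> V)"
  have c: "c \<ge> 0" by (simp add: c_def)
  have V: "V \<in> components {z. g (Some z) \<noteq> ereal l}" "bounded V"
    using bij_betwE[OF W] j by (auto simp: V_def)
  have cK: "compact K" "closed K" using K by (auto simp: non_thin_compact_def compact_imp_closed)
  have cQ: "compact Q" "closed Q" "Q \<noteq> {}"
    using Kh[OF j] by (auto simp: non_thin_compact_def Q_def f_def V_def compact_imp_closed)
  have \<omega>K: "borel_prob_on K \<omega>" using \<omega> by (simp add: equilibrium_measure_def)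
  have \<nu>: "equilibrium_measure Q \<nu>" using \<omega>h[OF j] by (simp add: Q_def \<nu>_def f_def V_def)
  then have \<nu>Q: "borel_prob_on Q \<nu>" by (simp add: equilibrium_measure_def)
  note D = borel_prob_onD[OF \<omega>K cK(2)]
  note N = borel_prob_onD[OF \<nu>Q cQ(2)]
  have "bounded (K \<union> V)" using cK V compact_imp_bounded by auto
  then obtain M where M: "M > 0" "\<And>z. z \<in> K \<union> V \<Longrightarrow> norm z \<le> M" by (auto simp: bounded_pos)
  \<comment> \<open>The margin 2 provides norm z + 1 < \<rho> on \<open>K\<close>, as
    \<open>energy_le_pot_of_non_thin\<close> asks along with R = 4 \<rho>.\<close>
  define \<rho> where "\<rho> = M + 2"
  define R where "R = 4 * \<rho>"
  have R: "R > 0" using M by (simp add: R_def \<rho>_def)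
  have dR: "dist z w \<le> R" if "z \<in> K \<union> V" "w \<in> K" for z w
    using dist_triangle3[of z w 0] M(1) M(2)[of z] M(2)[of w] that by (simp add: R_def \<rho>_def)
  \<comment> \<open>If \<open>g\<close> were \<infinity> throughout, the only component would be the
    whole plane, but \<open>V\<close> is a bounded one.\<close>
  have ne: "\<exists>z0. g (Some z0) \<noteq> \<infinity>"
  proof (rule ccontr)
    assume "\<nexists>z0. g (Some z0) \<noteq> \<infinity>"
    then have "{z. g (Some z) \<noteq> ereal l} = UNIV" by auto
    then have "V = UNIV" using V(1) connected_UNIV components_eq_sing_iff[of "UNIV::complex set"] by auto
    then show False using V(2) by (simp add: not_bounded_UNIV)
  qed
  then obtain z0 where "g (Some z0) \<noteq> \<infinity>" by blast
  note G = greens_function_normal_form[OF g cK(2) R dR this \<omega>, simplified]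
  obtain e where e: "energy R \<omega> \<omega> = ennreal e" "e \<ge> 0" using G(1) by (cases "energy R \<omega> \<omega>") auto
  define I where "I = ln R - e"
  have leI: "log_energy \<omega> = ereal (ln R) - enn2ereal (ennreal e)" "log_energy \<omega> = ereal I"
    using log_energy_eq[OF \<omega>K cK(2) R dR] e by (auto simp: I_def enn2ereal_ennreal)
  have lp: "log_potential \<omega> z = ereal (ln R) - enn2ereal (pot R \<omega> z)" if "z \<in> K \<union> V" for z
  proof -
    interpret prob_space \<omega> by (rule D)
    have "AE w in \<omega>. dist z w \<le> R" using D(5) by eventually_elim (rule dR[OF that])
    from log_potential_eq[OF D(2,3) R this] show ?thesis by (simp add: prob_space)
  qed
  have g_le: "log_potential \<omega> z \<le> ereal I" if z: "z \<in> K" for z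
  proof -
    have "energy R \<omega> \<omega> \<le> pot R \<omega> z"
    proof (rule energy_le_pot_of_non_thin[OF K \<omega> _ _ R_def G(1) z])
      show "norm w + 1 < \<rho>" if "w \<in> K" for w using M(2)[of w] that by (simp add: \<rho>_def)
    qed (use M(1) in \<open>simp add: \<rho>_def\<close>)
    then show ?thesis using lp[of z] z unfolding leI(2)[symmetric] leI(1) e(1) by (simp add: ereal_minus_enn2ereal_le_iff)
  qed
  have lpI: "log_potential \<omega> z - log_energy \<omega> = ereal l \<longleftrightarrow> log_potential \<omega> z = ereal (l + I)" for z
    unfolding leI(2) by (cases "log_potential \<omega> z") auto
  \<comment> \<open>On \<open>K\<close> the potential is only upper semicontinuous. Since
    \<open>g \<le> 0 < l\<close> there, the part where \<open>g > l\<close> avoids \<open>K\<close>,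
    and both parts are open.\<close>
  have "{z. g (Some z) \<noteq> ereal l} = {z. log_potential \<omega> z < ereal (l + I)} \<union> {z. z \<notin> K \<and> ereal (l + I) < log_potential \<omega> z}"
    (is "?S = ?T")
  proof -
    have "\<not> ereal (l + I) < log_potential \<omega> z" if "z \<in> K" for z
      using order_trans[OF g_le[OF that], of "ereal (l + I)"] l by (simp add: not_less)
    then show ?thesis unfolding G(2) lpI by (auto simp: neq_iff)
  qed
  moreover have "open ?T"
    using M D(5) by (intro open_Un open_log_potential_less[OF D(1,3), of M] open_log_potential_greater[OF D(1,3,5) cK(1)])
      (auto elim!: eventually_mono)
  ultimately have oV: "open V" using V(1) open_components by metis
  have f: "f holomorphic_on V" "inj_on f V" using univalent[OF j] by (auto simp: univalent_on_def f_def V_def)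
  have hf: "h (f w) = w" if "w \<in> V" for w unfolding h_def using f(2) that by (rule inv_into_f_f)
  have fh: "f (h z) = z" "h z \<in> V" if "z \<in> f ` V" for z
    unfolding h_def using that by (auto intro: f_inv_into_f inv_into_into)
  have ofV: "open (f ` V)" by (rule open_mapping_thm3[OF f(1) oV f(2)])
  have h: "h holomorphic_on f ` V"
  proof -
    obtain k where k: "k holomorphic_on (f ` V)" "\<And>z. z \<in> V \<Longrightarrow> k (f z) = z"
      using holomorphic_has_inverse[OF f(1) oV f(2)] by metis
    show ?thesis by (rule holomorphic_transform[OF k(1)]) (auto simp: k hf)
  qed
  have QV: "Q \<subseteq> f ` V" by (auto simp: Q_def)
  obtain \<epsilon> where \<epsilon>: "\<epsilon> > 0" "(\<Union>x\<in>Q. ball x \<epsilon>) \<subseteq> f ` V"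
    using compact_subset_open_imp_ball_epsilon_subset[OF cQ(1) ofV QV] by blast
  \<comment> \<open>If y in \<open>Q\<close> is within r < \<open>r0\<close> of u, then the ball of
    radius \<open>r0\<close> about u lies within \<open>2 * r0\<close> of y, hence in the image of
    \<open>V\<close>; the cap 1 keeps it within distance 2 of \<open>Q\<close>.\<close>
  define r0 where "r0 = min 1 (\<epsilon> / 2)"
  have r0: "r0 > 0" "r0 \<le> 1" "2 * r0 \<le> \<epsilon>" using \<epsilon> by (auto simp: r0_def)
  obtain M' where M': "M' > 0" "\<And>z. z \<in> Q \<Longrightarrow> norm z \<le> M'" using compact_imp_bounded[OF cQ(1)] by (auto simp: bounded_pos)
  \<comment> \<open>A point within 2 of \<open>Q\<close> is at most 2 + 2 M' from every point of
    \<open>Q\<close>; the remaining 1 leaves room for the circle radius.\<close>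
  define R' where "R' = 2 * M' + 3"
  have R': "R' > 0" using M' by (simp add: R'_def)
  have dR': "dist z w + 1 \<le> R'" if "w \<in> Q" "y \<in> Q" "dist y z \<le> 2" for z w y
    using dist_triangle3[of z w y] dist_triangle3[of y w 0] M'(2)[OF that(1)] M'(2)[OF that(2)] that(3) by (simp add: R'_def)
  have dQ: "dist z w \<le> R'" if "z \<in> Q" "w \<in> Q" for z w using dR'[OF that(2,1), of z] by simp
  have ghe: "gh j (Some z) = ereal c * g (Some (h z))" if "z \<in> f ` V" for z
    using gh_eq[OF j] that by (simp add: f_def V_def c_def h_def)
  \<comment> \<open>At a point of \<open>Q\<close> the functional equation gives \<open>gh j\<close>
    a value at most 0, because \<open>g \<le> 0\<close> on \<open>K\<close>.\<close>
  have ne': "\<exists>z0. gh j (Some z0) \<noteq> \<infinity>"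
  proof -
    obtain w where w: "w \<in> K" "w \<in> V" using cQ(3) by (auto simp: Q_def)
    have "g (Some w) \<le> 0" using g_le[OF w(1)] unfolding G(2) leI(2) by (cases "log_potential \<omega> w") auto
    then have "ereal c * g (Some (h (f w))) \<le> 0" using c hf[OF w(2)] by (simp add: ereal_mult_le_0_iff)
    then have "gh j (Some (f w)) \<noteq> \<infinity>" using ghe[of "f w"] w by auto
    then show ?thesis by blast
  qed
  then obtain z1 where "gh j (Some z1) \<noteq> \<infinity>" by blast
  moreover have "greens_function Q (gh j)" using gh[OF j] by (simp add: Q_def f_def V_def)
  ultimately have G': "energy R' \<nu> \<nu> < \<top>" "\<And>z. gh j (Some z) = log_potential \<nu> z - log_energy \<nu>"
    using greens_function_normal_form[OF _ cQ(2) R' dQ _ \<nu>] by blast+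
  obtain e' where e': "energy R' \<nu> \<nu> = ennreal e'" "e' \<ge> 0" using G'(1) by (cases "energy R' \<nu> \<nu>") auto
  \<comment> \<open>The hypothesis on the Green's functions with all terms made nonnegative, near
    \<open>Q\<close> where \<open>R'\<close> bounds the distances to the support of \<nu>.\<close>
  have identity: "pot R' \<nu> z + ennreal (c * e) = ennreal c * pot R \<omega> (h z) + ennreal e'"
    if z: "z \<in> f ` V" "y \<in> Q" "dist y z \<le> 2" for z y
  proof (rule green_identity_ennreal[OF c e'(2) e(2), of "ln R'" _ "ln R"])
    interpret n: prob_space \<nu> by (rule N)
    have "AE w in \<nu>. dist z w \<le> R'"
      using N(5)
    proof eventually_elim
      case (elim w)
      from dR'[OF elim z(2,3)] show ?case by linarith
    qed
    from log_potential_eq[OF N(2,3) R' this]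
    have "log_potential \<nu> z = ereal (ln R') - enn2ereal (pot R' \<nu> z)" by (simp add: n.prob_space)
    then show "ereal (ln R') - enn2ereal (pot R' \<nu> z) - (ereal (ln R') - enn2ereal (ennreal e')) =
       ereal c * (ereal (ln R) - enn2ereal (pot R \<omega> (h z)) - (ereal (ln R) - enn2ereal (ennreal e)))"
      using ghe[OF z(1)] fh[OF z(1)] lp[of "h z"] log_energy_eq[OF \<nu>Q cQ(2) R' dQ] leI(1) e'(1)
      unfolding G(2) G'(2) by simp
  qed
  have [measurable]: "K \<in> sets borel" "V \<in> sets borel" using cK oV by auto
  have KV: "K \<inter> V \<inter> space \<omega> \<in> sets \<omega>" unfolding D(3) D(4) by simp
  have sKV: "sets (restrict_space \<omega> (K \<inter> V)) = sets (restrict_space borel (K \<inter> V))"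
    by (rule sets_restrict_space_cong[OF D(3)])
  have f_meas: "f \<in> borel_measurable (restrict_space \<omega> (K \<inter> V))"
    unfolding measurable_cong_sets[OF sKV refl]
    using holomorphic_on_imp_continuous_on[OF f(1)] by (intro borel_measurable_continuous_on_restrict) (auto intro: continuous_on_subset)
  define \<beta> where "\<beta> = scale_measure (ennreal c) (distr (restrict_space \<omega> (K \<inter> V)) borel f)"
  have "finite_measure (distr (restrict_space \<omega> (K \<inter> V)) borel f)"
    using finite_measure_restrict_space[OF D(2), of "K \<inter> V"] D(3) by (intro finite_measure.finite_measure_distr f_meas) simp
  then have fin\<beta>: "finite_measure \<beta>" unfolding \<beta>_def
    by (intro finite_measureI) (auto simp: finite_measure.emeasure_finite ennreal_mult_eq_top_iff)
  have pot\<beta>: "pot r \<beta> u = ennreal c * (\<integral>\<^sup>+ w. log_kernel r (dist u (f w)) * indicator (K \<inter> V) w \<partial>\<omega>)" for r u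
    unfolding pot_def \<beta>_def
    by (subst nn_integral_scale_measure, simp, subst nn_integral_distr[OF f_meas], simp)
      (simp add: nn_integral_restrict_space[OF KV])
  have "\<nu> = \<beta>"
  proof (rule measure_eq_of_pot_eq[OF N(2) fin\<beta> N(3) _ r0(1)])
    show "sets \<beta> = sets borel" by (simp add: \<beta>_def)
    fix r u assume r: "0 < r" "r < r0"
    show "pot r \<nu> u = pot r \<beta> u"
    \<comment> \<open>Both measures live on \<open>Q\<close>, so at distance at least r from
      \<open>Q\<close> both smoothings vanish; the identity is needed only close to
      \<open>Q\<close>.\<close>
    proof (cases "\<exists>y\<in>Q. dist u y < r")
      case False
      have z: "log_kernel r (dist u y) = 0" if "y \<in> Q" for y
        using False that r by (auto simp: log_kernel_def not_less intro!: ennreal_neg ln_le_zero_iff[THEN iffD2])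
      have "pot r \<nu> u = (\<integral>\<^sup>+ w. 0 \<partial>\<nu>)"
        unfolding pot_def using N(5) by (intro nn_integral_cong_AE) (auto elim!: eventually_mono simp: z)
      moreover have "log_kernel r (dist u (f w)) * indicator (K \<inter> V) w = 0" for w
        using z[of "f w"] by (auto simp: indicator_def Q_def)
      ultimately show ?thesis unfolding pot\<beta> by (simp only: nn_integral_const mult_zero_left mult_zero_right)
    next
      case True
      then obtain y where y: "y \<in> Q" "dist u y < r" by blast
      have near: "dist y z \<le> 2 \<and> z \<in> f ` V" if "z \<in> ball u r0" for z
      proof -
        have "dist y z < 2 * r0" using dist_triangle[of y z u] y(2) r that by (simp add: dist_commute)
        then have "dist y z \<le> 2" "z \<in> ball y \<epsilon>" using r0 by auto
        then show ?thesis using \<epsilon>(2) y(1) by blast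
      qed
      define B where "B = (\<integral>\<^sup>+ w. log_kernel r (dist u (f w)) * indicator (K \<inter> V) w \<partial>\<omega>)"
      define P where "P = circle_mean r (\<lambda>z. pot R \<omega> (h z)) u"
      define A where "A = circle_mean r (pot R' \<nu>) u"
      have sub: "ball u r0 \<subseteq> f ` V" using near by blast
      have cu: "u + rcis r t \<in> ball u r0" for t using r by (simp add: dist_norm)
      have hb: "h holomorphic_on ball u r0" by (rule holomorphic_on_subset[OF h sub])
      have PB: "P + B = pot R \<omega> (h u)"
        unfolding P_def B_def
      proof (rule circle_mean_pullback_pot[OF D(1,3,5) _ oV holomorphic_on_imp_continuous_on[OF f(1)] f(2) hb _ _ r R])
        show "dist (h z) w \<le> R" if "z \<in> ball u r0" "w \<in> K" for z w
          using fh(2)[of z] sub that by (intro dR) auto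
      qed (use fh sub in auto)
      have le: "AE w in \<nu>. dist u w + r \<le> R'"
        using N(5)
      proof eventually_elim
        case (elim w)
        have "dist y u \<le> 2" using y(2) r r0(2) by (simp add: dist_commute)
        from dR'[OF elim y(1) this] show ?case using r r0(2) by linarith
      qed
      have A: "A + pot r \<nu> u = pot R' \<nu> u" "A < \<top>"
        unfolding A_def using pot_circle_mean[OF N(2,3) r(1) R' le] circle_mean_pot_finite[OF N(1,3) r(1) R' le] by auto
      have [measurable]: "pot R' \<nu> \<in> borel_measurable borel" "pot R \<omega> \<in> borel_measurable borel"
        by (rule pot_measurable[OF N(2,3)], rule pot_measurable[OF D(2,3)])
      have "continuous_on UNIV (\<lambda>t. h (u + rcis r t))"
      proof (rule continuous_on_compose2[OF holomorphic_on_imp_continuous_on[OF hb]])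
        show "continuous_on UNIV (\<lambda>t. u + rcis r t)"
          unfolding rcis_def cis_conv_exp by (intro continuous_intros)
      qed (use cu in auto)
      then have [measurable]: "(\<lambda>t. h (u + rcis r t)) \<in> borel_measurable borel"
        by (rule borel_measurable_continuous_onI)
      have "A + ennreal (c * e) = circle_mean r (\<lambda>z. 1 * pot R' \<nu> z + ennreal (c * e)) u"
        unfolding A_def by (subst circle_mean_affine) auto
      also have "\<dots> = circle_mean r (\<lambda>z. ennreal c * pot R \<omega> (h z) + ennreal e') u"
        using near[OF cu] by (intro circle_mean_cong) (simp add: identity[OF _ y(1)])
      also have "\<dots> = ennreal c * P + ennreal e'"
        unfolding P_def by (rule circle_mean_affine) measurable
      finally have AP: "A + ennreal (c * e) = ennreal c * P + ennreal e'" .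
      have "u \<in> ball u r0" using r0 by simp
      then have "pot R' \<nu> u + ennreal (c * e) = ennreal c * pot R \<omega> (h u) + ennreal e'"
        using near[of u] by (intro identity[OF _ y(1)]) auto
      then have "(A + ennreal (c * e)) + pot r \<nu> u = (ennreal c * P + ennreal e') + ennreal c * B"
        unfolding PB[symmetric] A(1)[symmetric] by (simp only: distrib_left ac_simps)
      then have "(A + ennreal (c * e)) + pot r \<nu> u = (A + ennreal (c * e)) + ennreal c * B"
        unfolding AP .
      \<comment> \<open>The two sides may be infinite at u, but the common summand is a circle mean
        plus a constant and hence finite.\<close>
      moreover have "A + ennreal (c * e) \<noteq> \<top>" using A(2) by auto
      ultimately have "pot r \<nu> u = ennreal c * B" by (simp only: ennreal_add_left_cancel simp_thms infinity_ennreal_def)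
      then show ?thesis unfolding pot\<beta> B_def .
    qed
  qed
  then show "\<omega>h j = scale_measure (ennreal (1 / measure \<omega> (K \<inter> W j)))
      (distr (restrict_space \<omega> (K \<inter> W j)) borel (\<phi> j))"
    unfolding \<nu>_def \<beta>_def c_def V_def f_def .
qed

end
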